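(* Let $d\ge2$, $1<r<\infty$, $0<\beta<\frac{d_k}{r'}$, and fix $t>0$. Then there are positive constants $C_{d,r,\beta,t,k}$, $D_{d,r,\beta,t,k}$, $E_{d,r,\beta,t,k}$ such that for all $f\in L^r(\mathbb{R}^d,|x|^{\beta r}w_k)$: (i) $\|e^{t\Delta_k}f\|_{L^\infty(\mathbb{R}^d)}\le C_{d,r,\beta,t,k}\,\||x|^\beta f\|_{L^r(\mathbb{R}^d,w_k)}$; (ii) $\||x|^{w}e^{t\Delta_k}f\|_{L^\infty(\mathbb{R}^d)}\le D_{d,r,\beta,t,k}\,\||x|^\beta f\|_{L^r(\mathbb{R}^d,w_k)}$ for every real $w$ with $\beta\ge w>0$; (iii) $\|\partial_{x_i}e^{t\Delta_k}f\|_{L^\infty(\mathbb{R}^d)}\le E_{d,r,\beta,t,k}\,\||x|^\beta f\|_{L^r(\mathbb{R}^d,w_k)}$ for $i=1,2,\dots,d$.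
   Context: $r'$ is the conjugate exponent, $\frac1r+\frac1{r'}=1$. Let $R\subset\mathbb{R}^d\setminus\{0\}$ be a finite root system, i.e. $R\cap\mathbb{R}\nu=\{\nu,-\nu\}$ and $\sigma_\nu(R)=R$ for all $\nu\in R$, where $\sigma_\nu(x)=x-2\frac{\langle\nu,x\rangle}{|\nu|^2}\nu$; it is normalized so that $\langle\nu,\nu\rangle=2$ for all $\nu\in R$. Let $G$ be the finite reflection group generated by $\{\sigma_\nu:\nu\in R\}$, $R_+$ a fixed positive subsystem, and $k:R\to[0,\infty)$ a $G$-invariant function. Put $\gamma_k=\sum_{\nu\in R_+}k(\nu)$, $d_k=d+2\gamma_k$, $w_k(x)=\prod_{\nu\in R_+}|\langle\nu,x\rangle|^{2k(\nu)}$ and $c_k=\int_{\mathbb{R}^d}e^{-|x|^2/2}w_k(x)dx$. $L^p(\mathbb{R}^d,w)$ is the $L^p$ space for the measure $w(x)dx$. Dunkl operators: $T_\xi f(x)=\partial_\xi f(x)+\sum_{\nu\in R_+}k(\nu)\langle\nu,\xi\rangle\frac{f(x)-f(\sigma_\nu(x))}{\langle\nu,x\rangle}$; $\Delta_k=\sum_iT_{e_i}^2$. The Dunkl kernel $E_k(x,y)$ is, for fixed $y$, the unique real-analytic solution $f=E_k(\cdot,y)$ of $T_\xi f=\langle\xi,y\rangle f$ for all $\xi\in\mathbb{R}^d$, $f(0)=1$. Heat semigroup: for $t>0$, $$e^{t\Delta_k}f(x)=c_k^{-1}\int_{\mathbb{R}^d}f(y)\,\tau_y^kq_t^k(x)\,w_k(y)\,dy,\qquad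 \tau_y^kq_t^k(x)=(2t)^{-d_k/2}e^{-\frac{|x|^2+|y|^2}{4t}}E_k\Big(\frac{x}{\sqrt{2t}},\frac{y}{\sqrt{2t}}\Big).$$ $\partial_{x_i}$ is the ordinary partial derivative. *)

theory Defs
  imports
    "HOL-Analysis.Analysis"
    "HOL-Probability.Essential_Supremum"
    "HOL-Algebra.Bij"
    "HOL-Algebra.Generated_Groups"
begin

definition root_reflection :: "real ^ 'n \<Rightarrow> real ^ 'n \<Rightarrow> real ^ 'n" where
  "root_reflection \<nu> x = x - (2 * (\<nu> \<bullet> x) / (norm \<nu>)\<^sup>2) *\<^sub>R \<nu>"

definition normalized_root_system :: "(real ^ 'n) set \<Rightarrow> bool" where
  "normalized_root_system R \<longleftrightarrow>
     finite R \<and> 0 \<notin> R \<and>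
     (\<forall>\<nu>\<in>R. R \<inter> range (\<lambda>a. a *\<^sub>R \<nu>) = {\<nu>, - \<nu>}) \<and>
     (\<forall>\<nu>\<in>R. root_reflection \<nu> ` R = R) \<and>
     (\<forall>\<nu>\<in>R. \<nu> \<bullet> \<nu> = 2)"

(* The roots lying strictly on one side of a hyperplane through 0 that contains no root. *)
definition positive_subsystem :: "(real ^ 'n) set \<Rightarrow> (real ^ 'n) set \<Rightarrow> bool" where
  "positive_subsystem R Rp \<longleftrightarrow>
     (\<exists>b. (\<forall>\<nu>\<in>R. \<nu> \<bullet> b \<noteq> 0) \<and> Rp = {\<nu>\<in>R. 0 < \<nu> \<bullet> b})"

definition reflection_group :: "(real ^ 'n) set \<Rightarrow> (real ^ 'n \<Rightarrow> real ^ 'n) set" where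
  "reflection_group R = generate (BijGroup UNIV) (root_reflection ` R)"

definition multiplicity_function :: "(real ^ 'n) set \<Rightarrow> (real ^ 'n \<Rightarrow> real) \<Rightarrow> bool" where
  "multiplicity_function R k \<longleftrightarrow>
     (\<forall>\<nu>\<in>R. 0 \<le> k \<nu>) \<and> (\<forall>g\<in>reflection_group R. \<forall>\<nu>\<in>R. k (g \<nu>) = k \<nu>)"

definition dunkl_gamma :: "(real ^ 'n) set \<Rightarrow> (real ^ 'n \<Rightarrow> real) \<Rightarrow> real" where
  "dunkl_gamma Rp k = (\<Sum>\<nu>\<in>Rp. k \<nu>)"

definition dunkl_dim :: "(real ^ 'n) set \<Rightarrow> (real ^ 'n \<Rightarrow> real) \<Rightarrow> real" where
  "dunkl_dim Rp k = real CARD('n) + 2 * dunkl_gamma Rp k"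

(* The case distinction implements 0^0 = 1; in the library, 0 powr 0 = 0. *)
definition dunkl_weight :: "(real ^ 'n) set \<Rightarrow> (real ^ 'n \<Rightarrow> real) \<Rightarrow> real ^ 'n \<Rightarrow> real" where
  "dunkl_weight Rp k x = (\<Prod>\<nu>\<in>Rp. if k \<nu> = 0 then 1 else \<bar>\<nu> \<bullet> x\<bar> powr (2 * k \<nu>))"

definition dunkl_const :: "(real ^ 'n) set \<Rightarrow> (real ^ 'n \<Rightarrow> real) \<Rightarrow> real" where
  "dunkl_const Rp k = (LINT x|lebesgue. exp (- (norm x)\<^sup>2 / 2) * dunkl_weight Rp k x)"

definition dir_deriv :: "real ^ 'n \<Rightarrow> (real ^ 'n \<Rightarrow> 'b) \<Rightarrow> real ^ 'n \<Rightarrow> 'b::real_normed_vector" where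
  "dir_deriv \<xi> f x = vector_derivative (\<lambda>s. f (x + s *\<^sub>R \<xi>)) (at 0)"

definition has_dir_deriv :: "real ^ 'n \<Rightarrow> (real ^ 'n \<Rightarrow> 'b::real_normed_vector) \<Rightarrow> real ^ 'n \<Rightarrow> bool" where
  "has_dir_deriv \<xi> f x \<longleftrightarrow> (\<lambda>s. f (x + s *\<^sub>R \<xi>)) differentiable (at 0)"

(* The quotient (f x - f (root_reflection nu x)) / (nu . x), extended to the hyperplane
   nu . x = 0 by its limit there for smooth f: root_reflection nu x differs from x by
   (2 (nu . x) / |nu|^2) nu. With the library's x / 0 = 0 the quotient alone would
   vanish on the hyperplane. *)
definition reflection_quotient :: "real ^ 'n \<Rightarrow> (real ^ 'n \<Rightarrow> real) \<Rightarrow> real ^ 'n \<Rightarrow> real" where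
  "reflection_quotient \<nu> f x =
     (if \<nu> \<bullet> x = 0 then 2 / (norm \<nu>)\<^sup>2 * dir_deriv \<nu> f x
      else (f x - f (root_reflection \<nu> x)) / (\<nu> \<bullet> x))"

definition dunkl_operator ::
    "(real ^ 'n) set \<Rightarrow> (real ^ 'n \<Rightarrow> real) \<Rightarrow> real ^ 'n \<Rightarrow> (real ^ 'n \<Rightarrow> real) \<Rightarrow> real ^ 'n \<Rightarrow> real" where
  "dunkl_operator Rp k \<xi> f x =
     dir_deriv \<xi> f x + (\<Sum>\<nu>\<in>Rp. k \<nu> * (\<nu> \<bullet> \<xi>) * reflection_quotient \<nu> f x)"

(* Local expansion into a convergent power series; \<alpha> ranges over the multi-indices. *)
definition real_analytic :: "(real ^ 'n \<Rightarrow> real) \<Rightarrow> bool" where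
  "real_analytic f \<longleftrightarrow>
     (\<forall>a. \<exists>c. \<exists>\<rho>>0. \<forall>x\<in>ball a \<rho>.
        ((\<lambda>\<alpha>::'n \<Rightarrow> nat. c \<alpha> * (\<Prod>i\<in>UNIV. (x $ i - a $ i) ^ \<alpha> i)) has_sum f x) UNIV)"

definition dunkl_kernel ::
    "(real ^ 'n) set \<Rightarrow> (real ^ 'n \<Rightarrow> real) \<Rightarrow> real ^ 'n \<Rightarrow> real ^ 'n \<Rightarrow> real" where
  "dunkl_kernel Rp k x y =
     (THE f. real_analytic f \<and>
             (\<forall>\<xi> z. dunkl_operator Rp k \<xi> f z = (\<xi> \<bullet> y) * f z) \<and>
             f 0 = 1) x"

(* The translate tau_y q_t evaluated at x. *)
definition dunkl_heat_kernel ::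
    "(real ^ 'n) set \<Rightarrow> (real ^ 'n \<Rightarrow> real) \<Rightarrow> real \<Rightarrow> real ^ 'n \<Rightarrow> real ^ 'n \<Rightarrow> real" where
  "dunkl_heat_kernel Rp k t x y =
     (2 * t) powr (- dunkl_dim Rp k / 2) *
     exp (- ((norm x)\<^sup>2 + (norm y)\<^sup>2) / (4 * t)) *
     dunkl_kernel Rp k ((1 / sqrt (2 * t)) *\<^sub>R x) ((1 / sqrt (2 * t)) *\<^sub>R y)"

definition dunkl_heat_integrand ::
    "(real ^ 'n) set \<Rightarrow> (real ^ 'n \<Rightarrow> real) \<Rightarrow> real \<Rightarrow> (real ^ 'n \<Rightarrow> complex) \<Rightarrow> real ^ 'n \<Rightarrow> real ^ 'n \<Rightarrow> complex" where
  "dunkl_heat_integrand Rp k t f x y =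
     f y * of_real (dunkl_heat_kernel Rp k t x y) * of_real (dunkl_weight Rp k y)"

definition dunkl_heat ::
    "(real ^ 'n) set \<Rightarrow> (real ^ 'n \<Rightarrow> real) \<Rightarrow> real \<Rightarrow> (real ^ 'n \<Rightarrow> complex) \<Rightarrow> real ^ 'n \<Rightarrow> complex" where
  "dunkl_heat Rp k t f x =
     of_real (inverse (dunkl_const Rp k)) * (LINT y|lebesgue. dunkl_heat_integrand Rp k t f x y)"

definition weighted_measure :: "(real ^ 'n \<Rightarrow> real) \<Rightarrow> (real ^ 'n) measure" where
  "weighted_measure w = density lebesgue (\<lambda>x. ennreal (w x))"

definition Lp_space :: "real \<Rightarrow> 'a measure \<Rightarrow> ('a \<Rightarrow> complex) set" where
  "Lp_space p M = {f. f \<in> borel_measurable M \<and> integrable M (\<lambda>x. norm (f x) powr p)}"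

(* Only meaningful on Lp_space p M: the library integral is 0 for non-integrable functions. *)
definition Lp_norm :: "real \<Rightarrow> 'a measure \<Rightarrow> ('a \<Rightarrow> complex) \<Rightarrow> real" where
  "Lp_norm p M f = (LINT x|M. norm (f x) powr p) powr (1 / p)"

(* esssup is infinite for non-measurable functions, so a finite bound entails measurability
   of the modulus. *)
definition Linf_norm :: "(real ^ 'n \<Rightarrow> complex) \<Rightarrow> ennreal" where
  "Linf_norm f = esssup lebesgue (\<lambda>x. ennreal (norm (f x)))"

end

theory Submission
  imports Defs "HOL-Probability.Probability"
begin

text \<open>The Dunkl kernel \<open>E\<close> is the sum of homogeneous components \<open>p n\<close>, obtained by solving
  \<open>(n + 1) p (n + 1) + (\<Sum>\<nu>. k \<nu> (p (n + 1) - p (n + 1) \<circ> \<sigma> \<nu>)) = (x \<bullet> y) p n\<close>; the inverse of the operator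
  on the left is a weighted sum over the finite reflection group. Since the Dunkl operators commute,
  a maximum principle on orbits gives \<open>T \<xi> (p (n + 1)) = (\<xi> \<bullet> y) p n\<close>.

  The integral representation of \<open>E\<close> is replaced by another maximum principle: an inequality
  \<open>0 \<le> (\<Sum>j. c j exp (z \<bullet> x j))\<close> valid for \<open>norm z \<le> norm y\<close> implies \<open>0 \<le> (\<Sum>j. c j E (x j, y))\<close>. It yields
  the uniqueness of \<open>E\<close>, the bounds \<open>0 \<le> E (x, y) \<le> exp (norm x * norm y)\<close>, and a bound for the increments
  in \<open>x\<close> of the heat kernel at time \<open>t\<close> by the heat kernel at time \<open>4 t\<close>.

  Integration by parts against a regularized weight shows that the heat kernel has constant mass.
  Being also bounded, it has uniformly bounded \<open>r'\<close>-th moments with respect to \<open>norm y powr (- \<beta> * r') * w y\<close>,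
  and all three estimates follow by duality.\<close>

section \<open>Root systems and the reflection group\<close>

text \<open>\<open>dunkl_kernel\<close> is a definite description, so it carries no information
  before existence and uniqueness are proved. The key is the direction \<open>\<xi> = x\<close>:
  there the denominators \<open>\<nu> \<bullet> x\<close> cancel and the eigenvalue equation becomes
  Euler's operator plus differences along reflections. On degree \<open>n + 1\<close> Euler's
  operator is multiplication by \<open>n + 1\<close>, which explains the recursion; the same scalar
  equation drives uniqueness and positivity.

  Positivity transfers an inequality between exponentials to \<open>E\<close>, provided it holds for
  every \<open>z\<close> in the ball of radius \<open>norm y\<close>. Gaussians meet this proviso:
  \<open>exp (- s * ((norm x)\<^sup>2 + (norm y)\<^sup>2) + 2 * s * (x \<bullet> z))\<close> is a
  Gaussian in \<open>x\<close> centred at \<open>z\<close>, times a factor constant in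
  \<open>x\<close>. Time \<open>4 * t\<close> instead of \<open>t\<close> pays for the linear factor
  produced by differentiation.

  The condition \<open>\<beta> * r' < dunkl_dim Rp k\<close> makes
  \<open>norm y powr (- \<beta> * r') * w y\<close> integrable near 0. Outside the unit ball this
  power is at most 1, and a kernel \<open>V\<close> with values in \<open>[0, 1]\<close> satisfies
  \<open>V powr r' \<le> V\<close>, so its mass controls its moments.\<close>

locale dunkl =
  fixes R Rp :: "(real ^ 'n) set" and k :: "real ^ 'n \<Rightarrow> real"
  assumes root_system: "normalized_root_system R"
    and positive: "positive_subsystem R Rp"
    and multiplicity: "multiplicity_function R k"
begin

lemma finite_R: "finite R"
  using root_system by (simp add: normalized_root_system_def)

lemma inner_root_self: "\<nu> \<in> R \<Longrightarrow> \<nu> \<bullet> \<nu> = 2"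
  using root_system by (simp add: normalized_root_system_def)

lemma norm_root_sq: "\<nu> \<in> R \<Longrightarrow> (norm \<nu>)\<^sup>2 = 2"
  by (metis dot_square_norm inner_root_self)

lemma Rp_subset: "Rp \<subseteq> R"
  using positive by (auto simp: positive_subsystem_def)

lemma Rp_in_R: "\<nu> \<in> Rp \<Longrightarrow> \<nu> \<in> R"
  using Rp_subset by blast

lemma finite_Rp: "finite Rp"
  using Rp_subset finite_R finite_subset by blast

lemma reflection_eq: "\<nu> \<in> R \<Longrightarrow> root_reflection \<nu> x = x - (\<nu> \<bullet> x) *\<^sub>R \<nu>"
  by (simp add: root_reflection_def norm_root_sq)

lemma minus_root: "\<nu> \<in> R \<Longrightarrow> - \<nu> \<in> R"
  using root_system unfolding normalized_root_system_def by blast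

lemma reflection_root: "\<mu> \<in> R \<Longrightarrow> \<nu> \<in> R \<Longrightarrow> root_reflection \<mu> \<nu> \<in> R"
  using root_system unfolding normalized_root_system_def by blast

lemma reflection_minus_root: "root_reflection (- \<nu>) x = root_reflection \<nu> x"
  by (simp add: root_reflection_def)

lemma reflection_involutive:
  assumes "\<nu> \<in> R" shows "root_reflection \<nu> (root_reflection \<nu> x) = x"
  using assms by (simp add: reflection_eq inner_diff_right inner_root_self algebra_simps)

lemma linear_reflection: "\<nu> \<in> R \<Longrightarrow> linear (root_reflection \<nu>)"
  by (intro linearI) (simp_all add: reflection_eq inner_add_right algebra_simps)

lemma inner_reflection_left:
  "\<nu> \<in> R \<Longrightarrow> root_reflection \<nu> x \<bullet> y = x \<bullet> root_reflection \<nu> y"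
  by (simp add: reflection_eq inner_diff_right inner_diff_left inner_commute)

lemma reflection_orthogonal:
  assumes "\<nu> \<in> R" shows "orthogonal_transformation (root_reflection \<nu>)"
  unfolding orthogonal_transformation_def
  using linear_reflection[OF assms] by (simp add: inner_reflection_left assms reflection_involutive)

lemma norm_reflection: "\<nu> \<in> R \<Longrightarrow> norm (root_reflection \<nu> x) = norm x"
  using reflection_orthogonal orthogonal_transformation_norm by blast

lemma reflection_self: "\<nu> \<in> R \<Longrightarrow> root_reflection \<nu> \<nu> = - \<nu>"
  by (simp add: reflection_eq inner_root_self scaleR_2)

lemma inner_root_reflection: "\<nu> \<in> R \<Longrightarrow> \<nu> \<bullet> root_reflection \<nu> x = - (\<nu> \<bullet> x)"
  by (metis inner_minus_left inner_reflection_left reflection_self)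

lemma reflection_fixed: "\<nu> \<in> R \<Longrightarrow> \<nu> \<bullet> x = 0 \<Longrightarrow> root_reflection \<nu> x = x"
  by (simp add: reflection_eq)

lemma root_cases: "\<nu> \<in> R \<Longrightarrow> \<nu> \<in> Rp \<or> - \<nu> \<in> Rp"
  using positive minus_root unfolding positive_subsystem_def
  by (metis (mono_tags, lifting) inner_minus_left linorder_neqE_linordered_idom mem_Collect_eq
      neg_0_less_iff_less)

lemma minus_notin_Rp: "\<nu> \<in> Rp \<Longrightarrow> - \<nu> \<notin> Rp"
  using positive by (auto simp: positive_subsystem_def)

lemma reflection_in_group: "\<mu> \<in> R \<Longrightarrow> root_reflection \<mu> \<in> reflection_group R"
  unfolding reflection_group_def by (simp add: generate.incl)

lemma k_reflection: "\<mu> \<in> R \<Longrightarrow> \<nu> \<in> R \<Longrightarrow> k (root_reflection \<mu> \<nu>) = k \<nu>"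
  using multiplicity reflection_in_group by (simp add: multiplicity_function_def)

lemma k_minus: "\<nu> \<in> R \<Longrightarrow> k (- \<nu>) = k \<nu>"
  using k_reflection[of \<nu> \<nu>] by (simp add: reflection_self)

lemma k_nonneg: "\<nu> \<in> Rp \<Longrightarrow> 0 \<le> k \<nu>"
  using multiplicity Rp_in_R by (simp add: multiplicity_function_def)

text \<open>A reflection permutes \<open>R\<close> but need not preserve \<open>Rp\<close>. It does
  permute the lines spanned by roots, and each line is represented here by its positive root. Hence
  sums and products over \<open>Rp\<close> of even functions of the root are invariant.\<close>

definition pos_rep :: "real ^ 'n \<Rightarrow> real ^ 'n \<Rightarrow> real ^ 'n" where
  "pos_rep \<mu> \<nu> = (if root_reflection \<mu> \<nu> \<in> Rp then root_reflection \<mu> \<nu> else - root_reflection \<mu> \<nu>)"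

lemma bij_pos_rep:
  assumes "\<mu> \<in> R" shows "bij_betw (pos_rep \<mu>) Rp Rp"
proof -
  have m: "pos_rep \<mu> \<nu> \<in> Rp" if "\<nu> \<in> Rp" for \<nu>
    using that assms root_cases reflection_root Rp_in_R unfolding pos_rep_def by metis
  have "inj_on (pos_rep \<mu>) Rp"
  proof (rule inj_onI)
    fix a b assume ab: "a \<in> Rp" "b \<in> Rp" "pos_rep \<mu> a = pos_rep \<mu> b"
    then have "root_reflection \<mu> a = root_reflection \<mu> b \<or> root_reflection \<mu> a = - root_reflection \<mu> b"
      unfolding pos_rep_def by (metis minus_minus)
    then have "a = b \<or> a = - b"
      by (metis assms linear_neg linear_reflection reflection_involutive)
    then show "a = b" using ab minus_notin_Rp by auto
  qed
  then show ?thesis using m finite_Rp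
    by (simp add: bij_betw_def endo_inj_surj image_subset_iff)
qed

lemma even_pos_rep:
  assumes "\<mu> \<in> R" "\<nu> \<in> Rp" "\<And>\<nu>. \<nu> \<in> R \<Longrightarrow> \<phi> (- \<nu>) = \<phi> \<nu>"
  shows "\<phi> (pos_rep \<mu> \<nu>) = \<phi> (root_reflection \<mu> \<nu>)"
  using assms by (simp add: pos_rep_def reflection_root Rp_in_R)

lemma sum_reflection:
  assumes "\<mu> \<in> R" "\<And>\<nu>. \<nu> \<in> R \<Longrightarrow> \<phi> (- \<nu>) = \<phi> \<nu>"
  shows "(\<Sum>\<nu>\<in>Rp. \<phi> (root_reflection \<mu> \<nu>)) = (\<Sum>\<nu>\<in>Rp. \<phi> \<nu>)"
proof -
  have "(\<Sum>\<nu>\<in>Rp. \<phi> \<nu>) = (\<Sum>\<nu>\<in>Rp. \<phi> (pos_rep \<mu> \<nu>))"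
    by (rule sum.reindex_bij_betw[OF bij_pos_rep[OF assms(1)], symmetric])
  also have "\<dots> = (\<Sum>\<nu>\<in>Rp. \<phi> (root_reflection \<mu> \<nu>))"
    by (intro sum.cong refl even_pos_rep assms)
  finally show ?thesis by simp
qed

lemma prod_reflection:
  assumes "\<mu> \<in> R" "\<And>\<nu>. \<nu> \<in> R \<Longrightarrow> \<phi> (- \<nu>) = \<phi> \<nu>"
  shows "(\<Prod>\<nu>\<in>Rp. \<phi> (root_reflection \<mu> \<nu>)) = (\<Prod>\<nu>\<in>Rp. \<phi> \<nu>)"
proof -
  have "(\<Prod>\<nu>\<in>Rp. \<phi> \<nu>) = (\<Prod>\<nu>\<in>Rp. \<phi> (pos_rep \<mu> \<nu>))"
    by (rule prod.reindex_bij_betw[OF bij_pos_rep[OF assms(1)], symmetric])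
  also have "\<dots> = (\<Prod>\<nu>\<in>Rp. \<phi> (root_reflection \<mu> \<nu>))"
    by (intro prod.cong refl even_pos_rep assms)
  finally show ?thesis by simp
qed

text \<open>The conjugation rule for reflections: it lets a reflection be pulled through the sums
  over \<open>Rp\<close> at the price of reindexing the roots.\<close>

lemma reflection_conj:
  assumes "\<mu> \<in> R" "\<nu> \<in> R"
  shows "root_reflection (root_reflection \<mu> \<nu>) (root_reflection \<mu> x)
    = root_reflection \<mu> (root_reflection \<nu> x)"
proof -
  have "root_reflection \<mu> \<nu> \<bullet> root_reflection \<mu> x = \<nu> \<bullet> x"
    using assms by (simp add: inner_reflection_left reflection_involutive)
  then have "root_reflection (root_reflection \<mu> \<nu>) (root_reflection \<mu> x)
      = root_reflection \<mu> x - (\<nu> \<bullet> x) *\<^sub>R root_reflection \<mu> \<nu>"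
    using reflection_eq[OF reflection_root[OF assms]] by simp
  also have "\<dots> = root_reflection \<mu> (x - (\<nu> \<bullet> x) *\<^sub>R \<nu>)"
    using linear_reflection[OF assms(1)] by (simp only: linear_diff linear_scale)
  finally show ?thesis by (simp only: reflection_eq[OF assms(2)])
qed

text \<open>The reflection group again, as plain functions instead of elements of
  \<open>BijGroup\<close>. Reflections are involutions, so words in them exhaust the group; building
  words on the right fits the reindexing \<open>g \<circ> root_reflection \<nu>\<close> used in the
  Neumann series.\<close>

inductive_set W :: "(real ^ 'n \<Rightarrow> real ^ 'n) set" where
  W_id: "id \<in> W"
| W_step: "g \<in> W \<Longrightarrow> \<nu> \<in> R \<Longrightarrow> g \<circ> root_reflection \<nu> \<in> W"

lemma W_left: "g \<in> W \<Longrightarrow> \<nu> \<in> R \<Longrightarrow> root_reflection \<nu> \<circ> g \<in> W"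
proof (induction rule: W.induct)
  case W_id
  show ?case using W.W_step[OF W.W_id W_id] by simp
next
  case (W_step g \<mu>)
  then show ?case using W.W_step[of "root_reflection \<nu> \<circ> g" \<mu>] by (simp only: comp_assoc)
qed

lemma W_orthogonal: "g \<in> W \<Longrightarrow> orthogonal_transformation g"
proof (induction rule: W.induct)
  case W_id
  show ?case using orthogonal_transformation_id by (simp add: id_def)
next
  case (W_step g \<nu>)
  then show ?case by (intro orthogonal_transformation_compose reflection_orthogonal)
qed

lemma W_norm: "g \<in> W \<Longrightarrow> norm (g x) = norm x"
  using W_orthogonal orthogonal_transformation_norm by blast

lemma W_root: "g \<in> W \<Longrightarrow> \<nu> \<in> R \<Longrightarrow> g \<nu> \<in> R"
  by (induction arbitrary: \<nu> rule: W.induct) (simp_all add: reflection_root)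

lemma W_fixes_orthogonal: "g \<in> W \<Longrightarrow> (\<And>\<nu>. \<nu> \<in> R \<Longrightarrow> \<nu> \<bullet> z = 0) \<Longrightarrow> g z = z"
  by (induction rule: W.induct) (simp_all add: reflection_fixed)

text \<open>The roots need not span the space. An element of \<open>W\<close> is determined by its
  action on \<open>R\<close>, because it is linear and fixes the orthogonal complement of
  \<open>span R\<close> pointwise; and there are only finitely many maps from \<open>R\<close> to
  \<open>R\<close>.\<close>

lemma finite_W: "finite W"
proof (rule inj_on_finite)
  show "finite (PiE R (\<lambda>_. R))" by (simp add: finite_PiE finite_R)
  show "(\<lambda>g. restrict g R) ` W \<subseteq> PiE R (\<lambda>_. R)" using W_root by auto
  show "inj_on (\<lambda>g. restrict g R) W"
  proof (rule inj_onI)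
    fix g h assume gh: "g \<in> W" "h \<in> W" "restrict g R = restrict h R"
    have lin: "linear g" "linear h" using gh W_orthogonal orthogonal_transformation_linear by auto
    show "g = h"
    proof
      fix x
      obtain y z where yz: "y \<in> span R" "\<And>w. w \<in> span R \<Longrightarrow> orthogonal z w" "x = y + z"
        using orthogonal_subspace_decomp_exists by blast
      have "g y = h y"
        using linear_eq_on_span[OF lin _ yz(1)] gh(3) by (metis restrict_apply')
      moreover have "\<nu> \<bullet> z = 0" if "\<nu> \<in> R" for \<nu>
        using yz(2)[of \<nu>] that by (simp add: orthogonal_def inner_commute span_base)
      ultimately show "g x = h x"
        using gh lin W_fixes_orthogonal[of g z] W_fixes_orthogonal[of h z] yz(3)
        by (simp add: linear_add)
    qed
  qed
qed

lemma bij_W_step: assumes "\<nu> \<in> R" shows "bij_betw (\<lambda>g. g \<circ> root_reflection \<nu>) W W"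
proof (rule bij_betw_byWitness[where f' = "\<lambda>g. g \<circ> root_reflection \<nu>"])
  have "root_reflection \<nu> \<circ> root_reflection \<nu> = id"
    by (rule ext) (simp add: reflection_involutive assms)
  then show "\<forall>g\<in>W. (g \<circ> root_reflection \<nu>) \<circ> root_reflection \<nu> = g"
    "\<forall>g\<in>W. (g \<circ> root_reflection \<nu>) \<circ> root_reflection \<nu> = g"
    by (auto simp: comp_assoc)
qed (use assms W_step in auto)

section \<open>Inverting the reflection operator in the group algebra of \<open>W\<close>\<close>

abbreviation gam :: real where "gam \<equiv> dunkl_gamma Rp k"

lemma gam_nonneg: "0 \<le> gam"
  unfolding dunkl_gamma_def by (intro sum_nonneg k_nonneg)

text \<open>The operator \<open>f \<mapsto> c f + (\<Sum>\<nu>. k \<nu> (f - f \<circ> root_reflection \<nu>))\<close> is inverted by a Neumann series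
  in \<open>(\<Sum>\<nu>. k \<nu> f \<circ> root_reflection \<nu>) / (c + gam)\<close>, whose terms are weighted sums over \<open>W\<close>.\<close>
fun neumann_term :: "real \<Rightarrow> nat \<Rightarrow> (real ^ 'n \<Rightarrow> real ^ 'n) \<Rightarrow> real" where
  "neumann_term c 0 g = (if g = id then 1 / (c + gam) else 0)"
| "neumann_term c (Suc m) g = (\<Sum>\<nu>\<in>Rp. k \<nu> / (c + gam) * neumann_term c m (g \<circ> root_reflection \<nu>))"

lemma neumann_term_nonneg:
  assumes "0 < c" shows "0 \<le> neumann_term c m g"
proof (induction m arbitrary: g)
  case 0
  then show ?case using assms gam_nonneg by simp
next
  case (Suc m)
  have "0 \<le> k \<nu> / (c + gam) * neumann_term c m (g \<circ> root_reflection \<nu>)" if "\<nu> \<in> Rp" for \<nu>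
    using Suc k_nonneg[OF that] assms gam_nonneg by simp
  then show ?case by (simp only: neumann_term.simps sum_nonneg)
qed

text \<open>Composition with a reflection permutes \<open>W\<close>, so each step multiplies the
  total mass by \<open>gam / (c + gam)\<close>, a ratio below 1.\<close>

lemma sum_neumann_term:
  assumes "0 < c" shows "(\<Sum>g\<in>W. neumann_term c m g) = 1 / (c + gam) * (gam / (c + gam)) ^ m"
proof (induction m)
  case 0
  then show ?case using finite_W W_id by (simp add: sum.delta)
next
  case (Suc m)
  have "(\<Sum>g\<in>W. neumann_term c (Suc m) g)
      = (\<Sum>\<nu>\<in>Rp. \<Sum>g\<in>W. k \<nu> / (c + gam) * neumann_term c m (g \<circ> root_reflection \<nu>))"
    unfolding neumann_term.simps by (rule sum.swap)
  also have "\<dots> = (\<Sum>\<nu>\<in>Rp. k \<nu> / (c + gam) * (\<Sum>g\<in>W. neumann_term c m g))"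
  proof (rule sum.cong[OF refl])
    fix \<nu> assume "\<nu> \<in> Rp"
    then show "(\<Sum>g\<in>W. k \<nu> / (c + gam) * neumann_term c m (g \<circ> root_reflection \<nu>))
        = k \<nu> / (c + gam) * (\<Sum>g\<in>W. neumann_term c m g)"
      using sum.reindex_bij_betw[OF bij_W_step[OF Rp_in_R], of \<nu> "neumann_term c m"]
      by (simp only: sum_distrib_left[symmetric])
  qed
  also have "\<dots> = gam / (c + gam) * (\<Sum>g\<in>W. neumann_term c m g)"
    by (simp add: sum_distrib_right[symmetric] sum_divide_distrib[symmetric] dunkl_gamma_def)
  finally show ?case using Suc by simp
qed

text \<open>The inverse operator as an element of the group algebra with nonnegative coefficients.
  Its total mass is \<open>1 / c\<close>, as testing on constants suggests; with
  \<open>c = n + 1\<close> these masses produce the factorials in all later bounds.\<close>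

definition resolvent_weight :: "real \<Rightarrow> (real ^ 'n \<Rightarrow> real ^ 'n) \<Rightarrow> real" where
  "resolvent_weight c g = (\<Sum>m. neumann_term c m g)"

lemma summable_neumann_term:
  assumes "0 < c" "g \<in> W" shows "summable (\<lambda>m. neumann_term c m g)"
proof (rule summable_comparison_test)
  have "neumann_term c m g \<le> 1 / (c + gam) * (gam / (c + gam)) ^ m" for m
    using member_le_sum[OF assms(2), of "neumann_term c m"] finite_W neumann_term_nonneg[OF assms(1)] sum_neumann_term[OF assms(1)]
    by simp
  then show "\<exists>N. \<forall>m\<ge>N. norm (neumann_term c m g) \<le> 1 / (c + gam) * (gam / (c + gam)) ^ m"
    using neumann_term_nonneg[OF assms(1)] by simp
  show "summable (\<lambda>m. 1 / (c + gam) * (gam / (c + gam)) ^ m)"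
    using assms gam_nonneg by (intro summable_mult summable_geometric) (simp add: field_simps)
qed

lemma resolvent_weight_nonneg: "0 < c \<Longrightarrow> g \<in> W \<Longrightarrow> 0 \<le> resolvent_weight c g"
  unfolding resolvent_weight_def by (intro suminf_nonneg summable_neumann_term neumann_term_nonneg)

lemma sum_resolvent_weight:
  assumes "0 < c" shows "(\<Sum>g\<in>W. resolvent_weight c g) = 1 / c"
proof -
  have "(\<Sum>g\<in>W. resolvent_weight c g) = (\<Sum>m. \<Sum>g\<in>W. neumann_term c m g)"
    unfolding resolvent_weight_def by (rule suminf_sum[symmetric]) (simp add: summable_neumann_term assms)
  also have "\<dots> = (\<Sum>m. 1 / (c + gam) * (gam / (c + gam)) ^ m)" using sum_neumann_term[OF assms] by simp
  also have "\<dots> = 1 / (c + gam) * (1 / (1 - gam / (c + gam)))"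
  proof -
    have "norm (gam / (c + gam)) < 1" using assms gam_nonneg by (simp add: field_simps)
    then show ?thesis using suminf_geometric[of "gam / (c + gam)"] summable_geometric[of "gam / (c + gam)"]
      by (subst suminf_mult) auto
  qed
  also have "\<dots> = 1 / c" using assms gam_nonneg by (simp add: field_simps)
  finally show ?thesis .
qed

text \<open>The coefficient at \<open>g\<close> of the equation saying that the weights invert
  \<open>c + gam\<close> minus the weighted sum of the reflections.\<close>

lemma resolvent_weight_eq:
  assumes "0 < c" "g \<in> W"
  shows "(c + gam) * resolvent_weight c g
    = (if g = id then 1 else 0) + (\<Sum>\<nu>\<in>Rp. k \<nu> * resolvent_weight c (g \<circ> root_reflection \<nu>))"
proof -
  have s: "summable (\<lambda>m. neumann_term c m (g \<circ> root_reflection \<nu>))" if "\<nu> \<in> Rp" for \<nu>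
    using that assms by (simp add: summable_neumann_term W_step Rp_in_R)
  have "resolvent_weight c g = neumann_term c 0 g + (\<Sum>m. neumann_term c (Suc m) g)"
    unfolding resolvent_weight_def using suminf_split_head[OF summable_neumann_term[OF assms]] by simp
  also have "(\<Sum>m. neumann_term c (Suc m) g)
      = (\<Sum>\<nu>\<in>Rp. k \<nu> / (c + gam) * resolvent_weight c (g \<circ> root_reflection \<nu>))"
    unfolding resolvent_weight_def neumann_term.simps
    using s by (subst suminf_sum) (auto intro!: summable_mult sum.cong suminf_mult simp del: times_divide_eq_left)
  finally have e: "resolvent_weight c g = neumann_term c 0 g
      + (\<Sum>\<nu>\<in>Rp. k \<nu> * resolvent_weight c (g \<circ> root_reflection \<nu>)) / (c + gam)"
    by (simp add: sum_divide_distrib)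
  have "c + gam \<noteq> 0" using assms gam_nonneg by simp
  then show ?thesis unfolding e by (simp add: distrib_left)
qed

lemma resolvent:
  fixes q :: "real ^ 'n \<Rightarrow> real"
  assumes "0 < c"
  defines "f \<equiv> \<lambda>x. \<Sum>g\<in>W. resolvent_weight c g * q (g x)"
  shows "c * f x + (\<Sum>\<nu>\<in>Rp. k \<nu> * (f x - f (root_reflection \<nu> x))) = q x"
proof -
  have r: "f (root_reflection \<nu> x) = (\<Sum>g\<in>W. resolvent_weight c (g \<circ> root_reflection \<nu>) * q (g x))"
    if "\<nu> \<in> Rp" for \<nu>
  proof -
    have "(\<Sum>g\<in>W. resolvent_weight c (g \<circ> root_reflection \<nu>) * q (g x))
      = (\<Sum>g\<in>W. resolvent_weight c (g \<circ> root_reflection \<nu> \<circ> root_reflection \<nu>) * q ((g \<circ> root_reflection \<nu>) x))"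
      by (rule sum.reindex_bij_betw[OF bij_W_step[OF Rp_in_R[OF that]], symmetric])
    also have "\<dots> = f (root_reflection \<nu> x)"
    proof -
      have "g \<circ> root_reflection \<nu> \<circ> root_reflection \<nu> = g" for g :: "real ^ 'n \<Rightarrow> real ^ 'n"
        by (rule ext) (simp add: reflection_involutive Rp_in_R that)
      then show ?thesis unfolding f_def by (simp only: comp_apply)
    qed
    finally show ?thesis by (rule sym)
  qed
  have "(\<Sum>\<nu>\<in>Rp. k \<nu> * (f x - f (root_reflection \<nu> x)))
      = gam * f x - (\<Sum>\<nu>\<in>Rp. k \<nu> * f (root_reflection \<nu> x))"
    by (simp add: right_diff_distrib sum_subtractf sum_distrib_right dunkl_gamma_def)
  also have "(\<Sum>\<nu>\<in>Rp. k \<nu> * f (root_reflection \<nu> x))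
      = (\<Sum>\<nu>\<in>Rp. \<Sum>g\<in>W. k \<nu> * resolvent_weight c (g \<circ> root_reflection \<nu>) * q (g x))"
    by (intro sum.cong refl) (simp add: r sum_distrib_left mult.assoc)
  also have "\<dots> = (\<Sum>g\<in>W. (\<Sum>\<nu>\<in>Rp. k \<nu> * resolvent_weight c (g \<circ> root_reflection \<nu>)) * q (g x))"
    by (subst sum.swap) (simp add: sum_distrib_right)
  also have "\<dots> = (\<Sum>g\<in>W. (c + gam) * resolvent_weight c g * q (g x) - (if g = id then q (g x) else 0))"
  proof (rule sum.cong[OF refl])
    fix g assume "g \<in> W"
    then have "(\<Sum>\<nu>\<in>Rp. k \<nu> * resolvent_weight c (g \<circ> root_reflection \<nu>))
        = (c + gam) * resolvent_weight c g - (if g = id then 1 else 0)"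
      using resolvent_weight_eq[OF assms(1), of g] by simp
    then show "(\<Sum>\<nu>\<in>Rp. k \<nu> * resolvent_weight c (g \<circ> root_reflection \<nu>)) * q (g x)
        = (c + gam) * resolvent_weight c g * q (g x) - (if g = id then q (g x) else 0)"
      by (simp add: left_diff_distrib)
  qed
  also have "\<dots> = (c + gam) * f x - q x"
    using finite_W W_id by (simp add: sum_subtractf f_def sum_distrib_left mult.assoc sum.delta)
  finally show ?thesis by (simp add: algebra_simps)
qed

text \<open>At a point of the finite orbit where \<open>norm q\<close> is largest, the reflected
  terms have total norm at most \<open>gam\<close> times the maximum, whereas the remaining term has
  \<open>c + gam\<close> times the maximum. The isometries \<open>S\<close> allow for vector fields
  that are themselves reflected; for scalar functions \<open>S\<close> is the identity.\<close>

lemma orbit_maximum_principle: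
  fixes q :: "real ^ 'n \<Rightarrow> 'b::real_normed_vector"
  assumes c: "0 < c"
    and S: "\<And>\<nu> v. \<nu> \<in> Rp \<Longrightarrow> norm (S \<nu> v) = norm v"
    and q: "\<And>x. c *\<^sub>R q x + (\<Sum>\<nu>\<in>Rp. k \<nu> *\<^sub>R (q x - S \<nu> (q (root_reflection \<nu> x)))) = 0"
  shows "q x = 0"
proof -
  let ?O = "(\<lambda>g. norm (q (g x))) ` W"
  have fin: "finite ?O" "?O \<noteq> {}" using finite_W W_id by auto
  obtain g where g: "g \<in> W" "norm (q (g x)) = Max ?O"
    using Max_in[OF fin] by (metis (mono_tags, lifting) imageE)
  have le: "norm (q (h x)) \<le> norm (q (g x))" if "h \<in> W" for h
    using g(2) fin that by simp
  have gsum: "(\<Sum>\<nu>\<in>Rp. k \<nu> *\<^sub>R q (g x)) = gam *\<^sub>R q (g x)"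
    by (simp add: dunkl_gamma_def scaleR_sum_left)
  have "(c + gam) *\<^sub>R q (g x) = (\<Sum>\<nu>\<in>Rp. k \<nu> *\<^sub>R S \<nu> (q (root_reflection \<nu> (g x))))"
    using q[of "g x"] gsum by (simp add: scaleR_diff_right sum_subtractf scaleR_add_left algebra_simps)
  then have "(c + gam) * norm (q (g x)) = norm (\<Sum>\<nu>\<in>Rp. k \<nu> *\<^sub>R S \<nu> (q (root_reflection \<nu> (g x))))"
    using c gam_nonneg norm_scaleR[of "c + gam" "q (g x)"] by simp
  also have "\<dots> \<le> (\<Sum>\<nu>\<in>Rp. k \<nu> * norm (q (g x)))"
  proof (rule sum_norm_le)
    fix \<nu> assume nu: "\<nu> \<in> Rp"
    have "norm (q (root_reflection \<nu> (g x))) \<le> norm (q (g x))"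
      using le[OF W_left[OF g(1) Rp_in_R[OF nu]]] by simp
    then show "norm (k \<nu> *\<^sub>R S \<nu> (q (root_reflection \<nu> (g x)))) \<le> k \<nu> * norm (q (g x))"
      using k_nonneg[OF nu] S[OF nu] by (simp add: mult_left_mono)
  qed
  also have "\<dots> = gam * norm (q (g x))" by (simp add: dunkl_gamma_def sum_distrib_right)
  finally have "c * norm (q (g x)) \<le> 0" by (simp add: algebra_simps)
  then have "norm (q (g x)) = 0"
    using c by (simp add: mult_le_0_iff)
  then show ?thesis using le[OF W_id] by simp
qed

section \<open>Homogeneous components of the Dunkl kernel\<close>

text \<open>For \<open>k = 0\<close> only \<open>g = id\<close> has a nonzero weight, and the
  recursion gives \<open>(x \<bullet> y) ^ n / fact n\<close>, the Taylor terms of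
  \<open>exp (x \<bullet> y)\<close>.\<close>

fun dpoly :: "nat \<Rightarrow> real ^ 'n \<Rightarrow> real ^ 'n \<Rightarrow> real" where
  "dpoly 0 x y = 1"
| "dpoly (Suc n) x y = (\<Sum>g\<in>W. resolvent_weight (real (Suc n)) g * ((g x \<bullet> y) * dpoly n (g x) y))"

lemma dpoly_euler:
  "real (Suc n) * dpoly (Suc n) x y
     + (\<Sum>\<nu>\<in>Rp. k \<nu> * (dpoly (Suc n) x y - dpoly (Suc n) (root_reflection \<nu> x) y))
   = (x \<bullet> y) * dpoly n x y"
  using resolvent[of "real (Suc n)" "\<lambda>x. (x \<bullet> y) * dpoly n x y" x] by simp

lemma euler_unique:
  assumes "0 < c"
    and "\<And>x. c * f x + (\<Sum>\<nu>\<in>Rp. k \<nu> * (f x - f (root_reflection \<nu> x))) = h x"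
    and "\<And>x. c * g x + (\<Sum>\<nu>\<in>Rp. k \<nu> * (g x - g (root_reflection \<nu> x))) = h x"
  shows "f x = (g x :: real)"
proof -
  have "(\<lambda>x. f x - g x) x = 0"
  proof (rule orbit_maximum_principle[where S = "\<lambda>_ v. v", OF assms(1)])
    fix x
    have "(\<Sum>\<nu>\<in>Rp. k \<nu> * (f x - g x - (f (root_reflection \<nu> x) - g (root_reflection \<nu> x))))
      = (\<Sum>\<nu>\<in>Rp. k \<nu> * (f x - f (root_reflection \<nu> x)))
        - (\<Sum>\<nu>\<in>Rp. k \<nu> * (g x - g (root_reflection \<nu> x)))"
      unfolding sum_subtractf[symmetric] by (rule sum.cong) (auto simp: algebra_simps)
    then show "c *\<^sub>R (f x - g x) + (\<Sum>\<nu>\<in>Rp. k \<nu> *\<^sub>R (f x - g x -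
        (f (root_reflection \<nu> x) - g (root_reflection \<nu> x)))) = 0"
      using assms(2)[of x] assms(3)[of x] by (simp add: algebra_simps)
  qed simp
  then show ?thesis by simp
qed

text \<open>Both sides solve the same Euler equation in \<open>x\<close>: conjugation by
  \<open>root_reflection \<mu>\<close> permutes the reflections in its sum and preserves
  \<open>k\<close>. Uniqueness concludes.\<close>

lemma dpoly_reflection:
  assumes "\<mu> \<in> R"
  shows "dpoly n (root_reflection \<mu> x) (root_reflection \<mu> y) = dpoly n x y"
proof (induction n arbitrary: x)
  case (Suc n)
  show ?case
  proof (rule euler_unique[where c = "real (Suc n)" and h = "\<lambda>x. (x \<bullet> y) * dpoly n x y"
        and f = "\<lambda>x. dpoly (Suc n) (root_reflection \<mu> x) (root_reflection \<mu> y)"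
        and g = "\<lambda>x. dpoly (Suc n) x y"])
    fix x
    let ?\<phi> = "\<lambda>\<nu>. k \<nu> * (dpoly (Suc n) (root_reflection \<mu> x) (root_reflection \<mu> y)
      - dpoly (Suc n) (root_reflection \<nu> (root_reflection \<mu> x)) (root_reflection \<mu> y))"
    have "(\<Sum>\<nu>\<in>Rp. k \<nu> * (dpoly (Suc n) (root_reflection \<mu> x) (root_reflection \<mu> y)
        - dpoly (Suc n) (root_reflection \<mu> (root_reflection \<nu> x)) (root_reflection \<mu> y)))
      = (\<Sum>\<nu>\<in>Rp. ?\<phi> (root_reflection \<mu> \<nu>))"
      by (intro sum.cong refl) (simp add: k_reflection assms Rp_in_R reflection_conj del: dpoly.simps)
    also have "\<dots> = (\<Sum>\<nu>\<in>Rp. ?\<phi> \<nu>)"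
      by (rule sum_reflection[OF assms]) (simp add: k_minus reflection_minus_root del: dpoly.simps)
    finally show "real (Suc n) * dpoly (Suc n) (root_reflection \<mu> x) (root_reflection \<mu> y)
      + (\<Sum>\<nu>\<in>Rp. k \<nu> * (dpoly (Suc n) (root_reflection \<mu> x) (root_reflection \<mu> y)
        - dpoly (Suc n) (root_reflection \<mu> (root_reflection \<nu> x)) (root_reflection \<mu> y)))
      = (x \<bullet> y) * dpoly n x y"
      using dpoly_euler[of n "root_reflection \<mu> x" "root_reflection \<mu> y"] Suc[of x]
      by (simp add: inner_reflection_left assms reflection_involutive del: dpoly.simps)
  qed (use dpoly_euler in \<open>simp_all del: dpoly.simps\<close>)
qed simp

lemma dpoly_reflection_right:
  assumes "\<mu> \<in> R"
  shows "dpoly n x (root_reflection \<mu> y) = dpoly n (root_reflection \<mu> x) y"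
  using dpoly_reflection[OF assms, of n "root_reflection \<mu> x" y]
  by (simp add: reflection_involutive assms)

text \<open>By \<open>dpoly_reflection_right\<close>, a reflection may be moved from one argument to
  the other. So the Euler equation in the first argument is also one in the second, and uniqueness
  gives the symmetry that the recursion hides.\<close>

lemma dpoly_commute: "dpoly n x y = dpoly n y x"
proof (induction n arbitrary: x y)
  case (Suc n)
  show ?case
  proof (rule euler_unique[where c = "real (Suc n)" and h = "\<lambda>x. (x \<bullet> y) * dpoly n x y"
        and f = "\<lambda>x. dpoly (Suc n) x y" and g = "\<lambda>x. dpoly (Suc n) y x"])
    fix x
    show "real (Suc n) * dpoly (Suc n) y x + (\<Sum>\<nu>\<in>Rp. k \<nu> * (dpoly (Suc n) y x
        - dpoly (Suc n) y (root_reflection \<nu> x))) = (x \<bullet> y) * dpoly n x y"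
      using dpoly_euler[of n y x] Suc[of x y]
      by (simp add: dpoly_reflection_right Rp_in_R inner_commute del: dpoly.simps cong: sum.cong)
  qed (use dpoly_euler in \<open>simp_all del: dpoly.simps\<close>)
qed simp

lemma W_linear: "g \<in> W \<Longrightarrow> linear g"
  using W_orthogonal orthogonal_transformation_linear by blast

lemma dpoly_scale: "dpoly n (c *\<^sub>R x) y = c ^ n * dpoly n x y"
proof (induction n arbitrary: x)
  case (Suc n)
  show ?case unfolding dpoly.simps sum_distrib_left
    by (intro sum.cong refl) (simp add: linear_scale W_linear Suc)
qed simp

lemma dpoly_scale_right: "dpoly n x (c *\<^sub>R y) = c ^ n * dpoly n x y"
  by (metis dpoly_commute dpoly_scale)

lemma dpoly_zero_left: "dpoly (Suc n) 0 y = 0"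
  using dpoly_scale[of "Suc n" 0 0 y] by simp

lemma inner_W_bound: "g \<in> W \<Longrightarrow> \<bar>g x \<bullet> y\<bar> \<le> norm x * norm y"
  using Cauchy_Schwarz_ineq2[of "g x" y] by (simp add: W_norm)

text \<open>The weights in the recursion have sum \<open>1 / (n + 1)\<close> and \<open>W\<close>
  preserves norms, so each degree contributes a factor of at most
  \<open>norm x * norm y / (n + 1)\<close>.\<close>

lemma dpoly_bound: "\<bar>dpoly n x y\<bar> \<le> (norm x * norm y) ^ n / fact n"
proof (induction n arbitrary: x)
  case (Suc n)
  have "\<bar>dpoly (Suc n) x y\<bar> \<le> (\<Sum>g\<in>W. resolvent_weight (real (Suc n)) g *
      (norm x * norm y * ((norm x * norm y) ^ n / fact n)))"
    unfolding dpoly.simps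
  proof (rule order.trans[OF sum_abs sum_mono])
    fix g assume g: "g \<in> W"
    have "\<bar>dpoly n (g x) y\<bar> \<le> (norm x * norm y) ^ n / fact n"
      using Suc[of "g x"] by (simp add: W_norm g)
    then show "\<bar>resolvent_weight (real (Suc n)) g * (g x \<bullet> y * dpoly n (g x) y)\<bar>
        \<le> resolvent_weight (real (Suc n)) g * (norm x * norm y * ((norm x * norm y) ^ n / fact n))"
      using resolvent_weight_nonneg[OF _ g, of "real (Suc n)"] inner_W_bound[OF g, of x y]
      by (simp add: abs_mult mult_left_mono mult_mono del: times_divide_eq_right)
  qed
  also have "\<dots> = (norm x * norm y) ^ Suc n / fact (Suc n)"
    by (simp only: sum_distrib_right[symmetric] sum_resolvent_weight of_nat_0_less_iff zero_less_Suc)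
      (simp add: field_simps)
  finally show ?case .
qed simp

text \<open>The bound is the derivative of \<open>z ^ n / fact n\<close> at
  \<open>z = norm x * norm y\<close>, times \<open>norm \<xi> * norm y\<close>. It propagates
  through the recursion by the product rule.\<close>

lemma has_derivative_dpoly:
  "\<exists>D. ((\<lambda>x. dpoly n x y) has_derivative D) (at x) \<and>
     (\<forall>\<xi>. \<bar>D \<xi>\<bar> \<le> norm \<xi> * norm y * (real n * (norm x * norm y) ^ (n - 1) / fact n))"
proof (induction n arbitrary: x)
  case 0
  show ?case by (intro exI[of _ "\<lambda>_. 0"]) simp
next
  case (Suc n)
  define M where "M = norm x * norm y"
  obtain D where D: "\<And>x. ((\<lambda>x. dpoly n x y) has_derivative D x) (at x)"
    and Db: "\<And>x \<xi>. \<bar>D x \<xi>\<bar> \<le> norm \<xi> * norm y * (real n * (norm x * norm y) ^ (n - 1) / fact n)"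
    using Suc by metis
  let ?D = "\<lambda>\<xi>. \<Sum>g\<in>W. resolvent_weight (real (Suc n)) g *
      ((g x \<bullet> y) * D (g x) (g \<xi>) + (g \<xi> \<bullet> y) * dpoly n (g x) y)"
  have "((\<lambda>x. dpoly (Suc n) x y) has_derivative ?D) (at x)"
    unfolding dpoly.simps
  proof (intro has_derivative_sum has_derivative_mult_right)
    fix g assume g: "g \<in> W"
    have lin: "(g has_derivative g) (at x)"
      using W_linear[OF g] by (simp add: linear_imp_has_derivative)
    have c: "((\<lambda>x. dpoly n (g x) y) has_derivative (\<lambda>\<xi>. D (g x) (g \<xi>))) (at x)"
      by (rule has_derivative_compose[OF lin D])
    show "((\<lambda>x. (g x \<bullet> y) * dpoly n (g x) y) has_derivative
        (\<lambda>\<xi>. (g x \<bullet> y) * D (g x) (g \<xi>) + (g \<xi> \<bullet> y) * dpoly n (g x) y)) (at x)"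
      by (rule has_derivative_mult[OF has_derivative_inner_left[OF lin] c])
  qed
  moreover have "\<bar>?D \<xi>\<bar> \<le> norm \<xi> * norm y *
      (real (Suc n) * (norm x * norm y) ^ (Suc n - 1) / fact (Suc n))" for \<xi>
  proof -
    have "\<bar>?D \<xi>\<bar> \<le> (\<Sum>g\<in>W. resolvent_weight (real (Suc n)) g *
        (norm \<xi> * norm y * (real (Suc n) * M ^ n / fact n)))"
    proof (rule order.trans[OF sum_abs sum_mono])
      fix g assume g: "g \<in> W"
      have 1: "\<bar>(g x \<bullet> y) * D (g x) (g \<xi>)\<bar> \<le> M * (norm \<xi> * norm y * (real n * M ^ (n - 1) / fact n))"
        unfolding abs_mult M_def
        by (rule mult_mono[OF inner_W_bound[OF g]])
          (use Db[of "g x" "g \<xi>"] in \<open>simp_all add: W_norm g\<close>)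
      have 2: "\<bar>(g \<xi> \<bullet> y) * dpoly n (g x) y\<bar> \<le> norm \<xi> * norm y * (M ^ n / fact n)"
        unfolding abs_mult M_def
        by (rule mult_mono[OF inner_W_bound[OF g]])
          (use dpoly_bound[of n "g x" y] in \<open>simp_all add: W_norm g\<close>)
      \<comment> \<open>For \<open>n = 0\<close> the truncated exponent \<open>n - 1\<close> does no
        harm, since the factor \<open>real n\<close> vanishes.\<close>
      have 3: "M * (norm \<xi> * norm y * (real n * M ^ (n - 1) / fact n)) = norm \<xi> * norm y * (real n * M ^ n / fact n)"
        by (cases n) auto
      have "\<bar>(g x \<bullet> y) * D (g x) (g \<xi>) + (g \<xi> \<bullet> y) * dpoly n (g x) y\<bar>
          \<le> norm \<xi> * norm y * (real n * M ^ n / fact n) + norm \<xi> * norm y * (M ^ n / fact n)"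
        using 1 2 3 by linarith
      also have "\<dots> = norm \<xi> * norm y * (real (Suc n) * M ^ n / fact n)"
        by (simp add: algebra_simps add_divide_distrib)
      finally show "\<bar>resolvent_weight (real (Suc n)) g *
          ((g x \<bullet> y) * D (g x) (g \<xi>) + (g \<xi> \<bullet> y) * dpoly n (g x) y)\<bar>
          \<le> resolvent_weight (real (Suc n)) g * (norm \<xi> * norm y * (real (Suc n) * M ^ n / fact n))"
        using resolvent_weight_nonneg[OF _ g, of "real (Suc n)"]
        by (simp add: abs_mult mult_left_mono del: times_divide_eq_right)
    qed
    also have "\<dots> = norm \<xi> * norm y * (real (Suc n) * M ^ (Suc n - 1) / fact (Suc n))"
      by (simp only: sum_distrib_right[symmetric] sum_resolvent_weight of_nat_0_less_iff zero_less_Suc)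
        (simp add: field_simps)
    finally show ?thesis unfolding M_def .
  qed
  ultimately show ?case by blast
qed

text \<open>The polynomial functions, generated by multiplication with linear forms instead of
  general products. An identity for Dunkl operators then only has to be checked on constants and
  carried from \<open>p\<close> to \<open>(x \<bullet> v) * p x\<close>.\<close>

inductive_set P :: "(real ^ 'n \<Rightarrow> real) set" where
  P_const: "(\<lambda>x. c) \<in> P"
| P_add: "p \<in> P \<Longrightarrow> q \<in> P \<Longrightarrow> (\<lambda>x. p x + q x) \<in> P"
| P_lin: "p \<in> P \<Longrightarrow> (\<lambda>x. (x \<bullet> v) * p x) \<in> P"

lemma P_scale: "p \<in> P \<Longrightarrow> (\<lambda>x. c * p x) \<in> P"
proof (induction rule: P.induct)
  case (P_const a) show ?case by (rule P.P_const)
next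
  case (P_add p q) then show ?case by (simp only: distrib_left P.P_add)
next
  case (P_lin p v)
  then show ?case using P.P_lin[of "\<lambda>x. c * p x" v] by (simp add: mult.left_commute)
qed

lemma P_sum: "finite A \<Longrightarrow> (\<And>a. a \<in> A \<Longrightarrow> p a \<in> P) \<Longrightarrow> (\<lambda>x. \<Sum>a\<in>A. p a x) \<in> P"
  by (induction rule: finite_induct) (simp_all add: P_const P_add)

lemma P_diff: "p \<in> P \<Longrightarrow> q \<in> P \<Longrightarrow> (\<lambda>x. p x - q x) \<in> P"
  using P_add[of p "\<lambda>x. -1 * q x"] P_scale[of q "-1"] by simp

lemma orthogonal_adjoint:
  fixes y :: "real ^ 'n" and g :: "real ^ 'n \<Rightarrow> real ^ 'n"
  assumes "orthogonal_transformation g"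
  obtains v where "norm v = norm y" "\<And>x. g x \<bullet> y = x \<bullet> v"
proof -
  obtain v where v: "g v = y"
    using orthogonal_transformation_surj[OF assms] by (metis surj_def)
  show ?thesis
  proof
    show "norm v = norm y" using v assms orthogonal_transformation_norm by metis
    show "g x \<bullet> y = x \<bullet> v" for x
      using v assms unfolding orthogonal_transformation_def by metis
  qed
qed

lemma P_comp: "p \<in> P \<Longrightarrow> orthogonal_transformation g \<Longrightarrow> (\<lambda>x. p (g x)) \<in> P"
proof (induction rule: P.induct)
  case (P_lin p v)
  obtain w where "\<And>x. g x \<bullet> v = x \<bullet> w" using orthogonal_adjoint[OF P_lin(3)] by blast
  then show ?case using P_lin P.P_lin by simp
qed (simp_all add: P_const P_add)

lemma P_comp_reflection: "p \<in> P \<Longrightarrow> \<nu> \<in> R \<Longrightarrow> (\<lambda>x. p (root_reflection \<nu> x)) \<in> P"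
  by (rule P_comp[OF _ reflection_orthogonal])

lemma dpoly_P: "(\<lambda>x. dpoly n x y) \<in> P"
proof (induction n)
  case (Suc n)
  show ?case unfolding dpoly.simps
  proof (intro P_sum finite_W P_scale)
    fix g assume "g \<in> W"
    then show "(\<lambda>x. (g x \<bullet> y) * dpoly n (g x) y) \<in> P"
      using P_comp[OF P_lin[OF Suc, of y]] W_orthogonal by blast
  qed
qed (simp add: P_const)

lemma P_has_derivative: "p \<in> P \<Longrightarrow> \<exists>D. (p has_derivative D) (at x)"
proof (induction rule: P.induct)
  case (P_lin p v)
  then obtain D where "(p has_derivative D) (at x)" by blast
  then show ?case by (intro exI) (rule has_derivative_mult[OF has_derivative_inner_left[OF has_derivative_ident]])
qed (blast intro: has_derivative_const has_derivative_add)+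

lemma P_differentiable: "p \<in> P \<Longrightarrow> p differentiable (at x)"
  using P_has_derivative by (simp add: differentiable_def)

end

section \<open>Dunkl operators\<close>

lemma has_vector_derivative_line:
  fixes f :: "real ^ 'n \<Rightarrow> 'b::real_normed_vector"
  assumes "(f has_derivative D) (at x)"
  shows "((\<lambda>s. f (x + s *\<^sub>R \<xi>)) has_vector_derivative D \<xi>) (at 0)"
proof -
  have "((\<lambda>s. x + s *\<^sub>R \<xi>) has_derivative (\<lambda>s. s *\<^sub>R \<xi>)) (at 0)"
    by (auto intro!: derivative_eq_intros)
  moreover have "(f has_derivative D) (at (x + 0 *\<^sub>R \<xi>))" using assms by simp
  ultimately have "((\<lambda>s. f (x + s *\<^sub>R \<xi>)) has_derivative (\<lambda>s. D (s *\<^sub>R \<xi>))) (at 0)"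
    by (rule has_derivative_compose)
  then show ?thesis
    unfolding has_vector_derivative_def
    using has_derivative_linear[OF assms] by (simp add: linear_scale)
qed

lemma dir_deriv_eq:
  "(f has_derivative D) (at x) \<Longrightarrow> dir_deriv \<xi> f x = D \<xi>"
  unfolding dir_deriv_def by (intro vector_derivative_at has_vector_derivative_line)

lemma line_derivative:
  fixes p :: "real ^ 'n \<Rightarrow> real"
  assumes p: "\<And>x. p differentiable (at x)"
  shows "((\<lambda>s. p (x + s *\<^sub>R \<xi>)) has_real_derivative dir_deriv \<xi> p (x + s *\<^sub>R \<xi>)) (at s)"
proof -
  obtain D where D: "(p has_derivative D) (at (x + s *\<^sub>R \<xi>))"
    using p[of "x + s *\<^sub>R \<xi>"] unfolding differentiable_def by blast
  have "((\<lambda>u. p (x + s *\<^sub>R \<xi> + u *\<^sub>R \<xi>)) has_real_derivative D \<xi>) (at 0)"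
    using has_vector_derivative_line[OF D]
    by (simp add: has_real_derivative_iff_has_vector_derivative)
  then have "((\<lambda>u. p (x + (u + s) *\<^sub>R \<xi>)) has_real_derivative D \<xi>) (at 0)"
    by (simp add: scaleR_add_left add_ac)
  then show ?thesis
    using DERIV_shift[of "\<lambda>s. p (x + s *\<^sub>R \<xi>)" "D \<xi>" 0 s] dir_deriv_eq[OF D] by simp
qed

lemma dir_deriv_const: "dir_deriv \<xi> (\<lambda>x. c) x = 0"
  using dir_deriv_eq[OF has_derivative_const] by blast

lemma dir_deriv_add:
  assumes "f differentiable (at x)" "g differentiable (at x)"
  shows "dir_deriv \<xi> (\<lambda>x. f x + g x) x = dir_deriv \<xi> f x + dir_deriv \<xi> g x"
proof -
  obtain D E where D: "(f has_derivative D) (at x)" "(g has_derivative E) (at x)"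
    using assms by (auto simp: differentiable_def)
  show ?thesis
    unfolding dir_deriv_eq[OF D(1)] dir_deriv_eq[OF D(2)] dir_deriv_eq[OF has_derivative_add[OF D]] ..
qed

lemma dir_deriv_mult:
  fixes f g :: "real ^ 'n \<Rightarrow> real"
  assumes "f differentiable (at x)" "g differentiable (at x)"
  shows "dir_deriv \<xi> (\<lambda>x. f x * g x) x = f x * dir_deriv \<xi> g x + dir_deriv \<xi> f x * g x"
proof -
  obtain D E where D: "(f has_derivative D) (at x)" "(g has_derivative E) (at x)"
    using assms by (auto simp: differentiable_def)
  show ?thesis
    unfolding dir_deriv_eq[OF D(1)] dir_deriv_eq[OF D(2)] dir_deriv_eq[OF has_derivative_mult[OF D]] ..
qed

lemma dir_deriv_linear:
  assumes "linear f" shows "dir_deriv \<xi> f x = f \<xi>"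
  using dir_deriv_eq[OF linear_imp_has_derivative[OF assms]] .

lemma linear_dir_deriv:
  assumes "f differentiable (at x)" shows "linear (\<lambda>\<xi>. dir_deriv \<xi> f x)"
proof -
  obtain D where D: "(f has_derivative D) (at x)" using assms by (auto simp: differentiable_def)
  show ?thesis unfolding dir_deriv_eq[OF D] using has_derivative_linear[OF D] .
qed

lemma dir_deriv_comp_linear:
  fixes f :: "real ^ 'n \<Rightarrow> real"
  assumes "linear g" "f differentiable (at (g x))"
  shows "dir_deriv \<xi> (\<lambda>x. f (g x)) x = dir_deriv (g \<xi>) f (g x)"
proof -
  obtain D where D: "(f has_derivative D) (at (g x))" using assms by (auto simp: differentiable_def)
  have "((\<lambda>x. f (g x)) has_derivative (\<lambda>\<xi>. D (g \<xi>))) (at x)"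
    by (rule has_derivative_compose[OF linear_imp_has_derivative[OF assms(1)] D])
  then show ?thesis using dir_deriv_eq D by metis
qed

lemma linear_inner_left: "linear (\<lambda>x::real ^ 'n. x \<bullet> v)"
  by (simp add: bounded_linear.linear bounded_linear_inner_left)

lemma inner_left_differentiable: "(\<lambda>x::real ^ 'n. x \<bullet> v) differentiable (at x)"
  unfolding differentiable_def using linear_imp_has_derivative[OF linear_inner_left] by blast

lemma dir_deriv_inner_mult:
  fixes p :: "real ^ 'n \<Rightarrow> real"
  assumes "p differentiable (at x)"
  shows "dir_deriv \<xi> (\<lambda>x. (x \<bullet> v) * p x) x = (x \<bullet> v) * dir_deriv \<xi> p x + (\<xi> \<bullet> v) * p x"
  using dir_deriv_mult[OF inner_left_differentiable assms]
  by (simp add: dir_deriv_linear linear_inner_left)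

context dunkl begin

abbreviation T :: "real ^ 'n \<Rightarrow> (real ^ 'n \<Rightarrow> real) \<Rightarrow> real ^ 'n \<Rightarrow> real" where
  "T \<equiv> dunkl_operator Rp k"

lemma quotient_hyperplane:
  "\<nu> \<in> R \<Longrightarrow> \<nu> \<bullet> x = 0 \<Longrightarrow> reflection_quotient \<nu> f x = dir_deriv \<nu> f x"
  by (simp add: reflection_quotient_def norm_root_sq)

lemma quotient_mult:
  "\<nu> \<in> R \<Longrightarrow> (\<nu> \<bullet> x) * reflection_quotient \<nu> f x = f x - f (root_reflection \<nu> x)"
  by (simp add: reflection_quotient_def reflection_fixed)

lemma quotient_const: "\<nu> \<in> R \<Longrightarrow> reflection_quotient \<nu> (\<lambda>x. c) x = 0"
  by (simp add: reflection_quotient_def dir_deriv_const)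

lemma quotient_add:
  assumes "\<nu> \<in> R" "f differentiable (at x)" "g differentiable (at x)"
  shows "reflection_quotient \<nu> (\<lambda>x. f x + g x) x
    = reflection_quotient \<nu> f x + reflection_quotient \<nu> g x"
  using assms by (simp add: reflection_quotient_def dir_deriv_add distrib_left
      add_divide_distrib[symmetric])

text \<open>On the hyperplane of \<open>\<nu>\<close> this is the ordinary product rule, because the
  reflection fixes the point there. The value of \<open>p\<close> at the reflected point is what
  distinguishes Dunkl operators from derivations.\<close>

lemma quotient_inner_mult:
  assumes nu: "\<nu> \<in> R" and p: "p differentiable (at x)"
  shows "reflection_quotient \<nu> (\<lambda>x. (x \<bullet> v) * p x) x
    = (x \<bullet> v) * reflection_quotient \<nu> p x + (\<nu> \<bullet> v) * p (root_reflection \<nu> x)"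
proof (cases "\<nu> \<bullet> x = 0")
  case True
  then show ?thesis
    by (simp add: quotient_hyperplane nu dir_deriv_inner_mult[OF p] reflection_fixed)
next
  case False
  have e: "root_reflection \<nu> x \<bullet> v = x \<bullet> v - (\<nu> \<bullet> x) * (\<nu> \<bullet> v)"
    by (simp add: reflection_eq nu inner_diff_left)
  have "(x \<bullet> v) * p x - (root_reflection \<nu> x \<bullet> v) * p (root_reflection \<nu> x)
    = (x \<bullet> v) * (p x - p (root_reflection \<nu> x)) + (\<nu> \<bullet> x) * ((\<nu> \<bullet> v) * p (root_reflection \<nu> x))"
    unfolding e by (simp add: algebra_simps)
  then show ?thesis using False
    by (simp add: reflection_quotient_def add_divide_distrib)
qed

lemma quotient_minus:
  assumes "\<nu> \<in> R" "f differentiable (at x)"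
  shows "reflection_quotient (- \<nu>) f x = - reflection_quotient \<nu> f x"
  using linear_neg[OF linear_dir_deriv[OF assms(2)], of \<nu>]
  by (simp add: reflection_quotient_def reflection_minus_root)

lemma quotient_comp_reflection:
  assumes "\<mu> \<in> R" "\<nu> \<in> R" "f differentiable (at (root_reflection \<mu> x))"
  shows "reflection_quotient \<nu> (\<lambda>x. f (root_reflection \<mu> x)) x
    = reflection_quotient (root_reflection \<mu> \<nu>) f (root_reflection \<mu> x)"
proof -
  have "root_reflection \<mu> \<nu> \<bullet> root_reflection \<mu> x = \<nu> \<bullet> x"
    using assms by (simp add: inner_reflection_left reflection_involutive)
  then show ?thesis
    using assms unfolding reflection_quotient_def
    by (simp add: dir_deriv_comp_linear linear_reflection reflection_conj norm_reflection)
qed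

lemma dir_deriv_P: "p \<in> P \<Longrightarrow> (\<lambda>x. dir_deriv \<xi> p x) \<in> P"
proof (induction rule: P.induct)
  case (P_const c) then show ?case by (simp add: dir_deriv_const P.P_const)
next
  case (P_add p q) then show ?case by (simp add: dir_deriv_add P_differentiable P.P_add)
next
  case (P_lin p v)
  then show ?case
    by (simp add: dir_deriv_inner_mult P_differentiable P.P_add P.P_lin P_scale)
qed

lemma quotient_P: "p \<in> P \<Longrightarrow> \<nu> \<in> R \<Longrightarrow> (\<lambda>x. reflection_quotient \<nu> p x) \<in> P"
proof (induction rule: P.induct)
  case (P_const c) then show ?case by (simp add: quotient_const P.P_const)
next
  case (P_add p q) then show ?case by (simp add: quotient_add P_differentiable P.P_add)
next
  case (P_lin p v)
  then show ?case
    by (simp add: quotient_inner_mult P_differentiable P.P_add P.P_lin P_scale P_comp_reflection)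
qed

lemma T_P: "p \<in> P \<Longrightarrow> (\<lambda>x. T \<xi> p x) \<in> P"
  unfolding dunkl_operator_def
  by (intro P_add dir_deriv_P P_sum finite_Rp P_scale quotient_P) (simp_all add: Rp_in_R)

lemma T_const: "T \<xi> (\<lambda>x. c) x = 0"
  by (simp add: dunkl_operator_def dir_deriv_const quotient_const Rp_in_R)

lemma T_add:
  assumes "f differentiable (at x)" "g differentiable (at x)"
  shows "T \<xi> (\<lambda>x. f x + g x) x = T \<xi> f x + T \<xi> g x"
  using assms by (simp add: dunkl_operator_def dir_deriv_add quotient_add Rp_in_R
      distrib_left sum.distrib)

text \<open>The commutation relation between a Dunkl operator and multiplication by a linear form;
  the coefficients of the reflection sum are symmetric in \<open>\<xi>\<close> and
  \<open>v\<close>.\<close>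

lemma T_inner_mult:
  assumes "p differentiable (at x)"
  shows "T \<xi> (\<lambda>x. (x \<bullet> v) * p x) x = (x \<bullet> v) * T \<xi> p x + (\<xi> \<bullet> v) * p x
    + (\<Sum>\<nu>\<in>Rp. k \<nu> * (\<nu> \<bullet> \<xi>) * (\<nu> \<bullet> v) * p (root_reflection \<nu> x))"
  using assms
  by (simp add: dunkl_operator_def dir_deriv_inner_mult quotient_inner_mult Rp_in_R)
    (simp add: distrib_left sum.distrib sum_distrib_left mult_ac)

lemma T_scale:
  assumes "p \<in> P" shows "T \<xi> (\<lambda>x. c * p x) x = c * T \<xi> p x"
proof -
  have "dir_deriv \<zeta> (\<lambda>x. c * p x) x = c * dir_deriv \<zeta> p x" for \<zeta>
    using dir_deriv_mult[OF _ P_differentiable[OF assms], of "\<lambda>_. c"] by (simp add: dir_deriv_const)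
  then show ?thesis
    by (simp add: dunkl_operator_def reflection_quotient_def distrib_left sum_distrib_left
        right_diff_distrib[symmetric] mult.left_commute if_distrib cong: if_cong)
qed

lemma T_sum:
  assumes "finite A" "\<And>a. a \<in> A \<Longrightarrow> p a \<in> P"
  shows "T \<xi> (\<lambda>x. \<Sum>a\<in>A. p a x) x = (\<Sum>a\<in>A. T \<xi> (p a) x)"
  using assms
proof (induction rule: finite_induct)
  case empty show ?case using T_const[of \<xi> 0] by simp
next
  case (insert a A)
  then show ?case by (simp add: T_add P_differentiable P_sum)
qed

text \<open>Equivariance comes from reindexing the roots by \<open>\<mu>\<close>. The summand is
  even in \<open>\<nu>\<close>, since both \<open>\<nu> \<bullet> \<xi>\<close> and the quotient
  change sign with \<open>\<nu>\<close>.\<close>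

lemma T_comp_reflection:
  assumes "\<mu> \<in> R" "p \<in> P"
  shows "T \<xi> (\<lambda>x. p (root_reflection \<mu> x)) x = T (root_reflection \<mu> \<xi>) p (root_reflection \<mu> x)"
proof -
  let ?\<phi> = "\<lambda>\<nu>. k \<nu> * (\<nu> \<bullet> root_reflection \<mu> \<xi>) * reflection_quotient \<nu> p (root_reflection \<mu> x)"
  have "(\<Sum>\<nu>\<in>Rp. k \<nu> * (\<nu> \<bullet> \<xi>) * reflection_quotient \<nu> (\<lambda>x. p (root_reflection \<mu> x)) x)
    = (\<Sum>\<nu>\<in>Rp. ?\<phi> (root_reflection \<mu> \<nu>))"
    by (intro sum.cong refl)
      (simp add: quotient_comp_reflection assms P_differentiable Rp_in_R k_reflection
        inner_reflection_left reflection_involutive)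
  also have "\<dots> = (\<Sum>\<nu>\<in>Rp. ?\<phi> \<nu>)"
    by (rule sum_reflection) (simp_all add: assms k_minus quotient_minus P_differentiable)
  finally show ?thesis
    using assms by (simp add: dunkl_operator_def dir_deriv_comp_linear linear_reflection P_differentiable)
qed

lemma linear_T: "p differentiable (at x) \<Longrightarrow> linear (\<lambda>\<xi>. T \<xi> p x)"
  unfolding dunkl_operator_def
  by (intro linear_compose_add linear_dir_deriv linear_compose_sum ballI)
    (auto intro!: linearI simp: inner_add_right algebra_simps)

text \<open>Direction and base point coincide, so the factor \<open>\<nu> \<bullet> x\<close>
  cancels the denominator of the quotient. This links the eigenvalue equation to the recursion for
  \<open>dpoly\<close>.\<close>

lemma T_self:
  "T x f x = dir_deriv x f x + (\<Sum>\<nu>\<in>Rp. k \<nu> * (f x - f (root_reflection \<nu> x)))"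
  by (simp add: dunkl_operator_def quotient_mult[symmetric] Rp_in_R mult.assoc cong: sum.cong)

text \<open>The commutator of two Dunkl operators commutes with multiplication by linear forms and
  annihilates constants.\<close>
lemma T_commute: "p \<in> P \<Longrightarrow> T a (T b p) x = T b (T a p) x"
proof (induction arbitrary: x rule: P.induct)
  case (P_const c)
  have "T b (\<lambda>x. c) = (\<lambda>x. 0)" for b using T_const by blast
  then show ?case using T_const by simp
next
  case (P_add p q)
  have "T b (\<lambda>x. p x + q x) = (\<lambda>x. T b p x + T b q x)" for b
    using P_add by (simp add: T_add P_differentiable fun_eq_iff)
  then show ?case using P_add by (simp add: T_add P_differentiable T_P)
next
  case (P_lin p v)
  define E where "E a b x = (\<Sum>\<nu>\<in>Rp. k \<nu> * (\<nu> \<bullet> a) * (\<nu> \<bullet> v) * T b p (root_reflection \<nu> x))" for a b x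
  define S where "S a b x = (\<Sum>\<nu>\<in>Rp. k \<nu> * (\<nu> \<bullet> a) * (\<nu> \<bullet> b) * (\<nu> \<bullet> v) * T \<nu> p (root_reflection \<nu> x))" for a b x
  have main: "T a (T b (\<lambda>x. (x \<bullet> v) * p x)) x
      = (x \<bullet> v) * T a (T b p) x + (a \<bullet> v) * T b p x + (b \<bullet> v) * T a p x + E a b x + E b a x - S a b x"
    for a b x
  proof -
    have e: "T b (\<lambda>x. (x \<bullet> v) * p x) = (\<lambda>x. ((x \<bullet> v) * T b p x + (b \<bullet> v) * p x)
        + (\<Sum>\<nu>\<in>Rp. k \<nu> * (\<nu> \<bullet> b) * (\<nu> \<bullet> v) * p (root_reflection \<nu> x)))"
      using P_lin by (simp add: T_inner_mult P_differentiable fun_eq_iff)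
    have c: "T a (\<lambda>x. k \<nu> * (\<nu> \<bullet> b) * (\<nu> \<bullet> v) * p (root_reflection \<nu> x)) x
        = k \<nu> * (\<nu> \<bullet> b) * (\<nu> \<bullet> v) * T a p (root_reflection \<nu> x)
          - k \<nu> * (\<nu> \<bullet> a) * (\<nu> \<bullet> b) * (\<nu> \<bullet> v) * T \<nu> p (root_reflection \<nu> x)" if "\<nu> \<in> Rp" for \<nu>
    proof -
      have nu: "\<nu> \<in> R" using that Rp_in_R by blast
      have e: "T (root_reflection \<nu> a) p z = T a p z - (\<nu> \<bullet> a) * T \<nu> p z" for z
        unfolding reflection_eq[OF nu]
        using linear_diff[OF linear_T[OF P_differentiable[OF P_lin(1)], of z]]
          linear_scale[OF linear_T[OF P_differentiable[OF P_lin(1)], of z]] by simp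
      then show ?thesis
        using P_lin nu
        by (subst T_scale)
          (simp_all only: P_comp_reflection T_comp_reflection e right_diff_distrib mult_ac)
    qed
    have "T a (\<lambda>x. \<Sum>\<nu>\<in>Rp. k \<nu> * (\<nu> \<bullet> b) * (\<nu> \<bullet> v) * p (root_reflection \<nu> x)) x = E b a x - S a b x"
      using P_lin
      by (subst T_sum) (simp_all add: finite_Rp P_scale P_comp_reflection Rp_in_R c sum_subtractf E_def S_def)
    moreover have "(\<lambda>x. \<Sum>\<nu>\<in>Rp. k \<nu> * (\<nu> \<bullet> b) * (\<nu> \<bullet> v) * p (root_reflection \<nu> x)) \<in> P"
      using P_lin by (intro P_sum finite_Rp P_scale P_comp_reflection) (simp_all add: Rp_in_R)
    ultimately show ?thesis
      unfolding e using P_lin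
      by (simp add: T_add P_differentiable P.P_add P.P_lin P_scale T_P T_scale T_inner_mult E_def)
  qed
  \<comment> \<open>All other terms of \<open>main\<close> are symmetric under exchange of
    \<open>a\<close> and \<open>b\<close>, the leading one by the induction hypothesis.\<close>
  have "S a b x = S b a x" unfolding S_def by (intro sum.cong refl) simp
  then show ?case unfolding main using P_lin by simp
qed


lemma dir_deriv_homogeneous:
  assumes p: "\<And>x. p differentiable (at x)" and h: "\<And>x. p (c *\<^sub>R x) = c ^ Suc n * p x" and c: "c \<noteq> 0"
  shows "dir_deriv \<xi> p (c *\<^sub>R x) = c ^ n * dir_deriv \<xi> (p :: real ^ 'n \<Rightarrow> real) x"
proof -
  have "c * dir_deriv \<xi> p (c *\<^sub>R x) = dir_deriv (c *\<^sub>R \<xi>) p (c *\<^sub>R x)"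
    using linear_scale[OF linear_dir_deriv[OF p]] by simp
  also have "\<dots> = dir_deriv \<xi> (\<lambda>x. p (c *\<^sub>R x)) x"
    using dir_deriv_comp_linear[of "\<lambda>x. c *\<^sub>R x" p x \<xi>] p by (simp add: linear_scaleR)
  also have "\<dots> = c ^ Suc n * dir_deriv \<xi> p x"
    unfolding h using dir_deriv_mult[of "\<lambda>_. c ^ Suc n" x p \<xi>] p by (simp add: dir_deriv_const)
  finally show ?thesis using c by simp
qed

lemma T_homogeneous:
  assumes p: "p \<in> P" and h: "\<And>x. p (c *\<^sub>R x) = c ^ Suc n * p x" and c: "c \<noteq> 0"
  shows "T \<xi> p (c *\<^sub>R x) = c ^ n * T \<xi> p x"
proof -
  have d: "dir_deriv \<xi> p (c *\<^sub>R x) = c ^ n * dir_deriv \<xi> p x" for \<xi> x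
    by (rule dir_deriv_homogeneous) (use p h c P_differentiable in auto)
  have "reflection_quotient \<nu> p (c *\<^sub>R x) = c ^ n * reflection_quotient \<nu> p x" if "\<nu> \<in> Rp" for \<nu>
  proof (cases "\<nu> \<bullet> x = 0")
    case True
    then show ?thesis using that by (simp add: quotient_hyperplane Rp_in_R d)
  next
    case False
    have "p (root_reflection \<nu> (c *\<^sub>R x)) = c ^ Suc n * p (root_reflection \<nu> x)"
      using that h by (simp add: linear_scale linear_reflection Rp_in_R)
    then show ?thesis using False c h[of x]
      by (simp add: reflection_quotient_def field_simps)
  qed
  then show ?thesis
    by (simp add: dunkl_operator_def d distrib_left sum_distrib_left mult_ac)
qed

lemma dir_deriv_euler:
  assumes p: "p differentiable (at x)" and h: "\<And>c. 0 < c \<Longrightarrow> p (c *\<^sub>R x) = c ^ n * p x"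
  shows "dir_deriv x p x = real n * (p x :: real)"
proof -
  have "((\<lambda>s. (1 + s) ^ n * p x) has_vector_derivative real n * p x) (at 0)"
    by (auto intro!: derivative_eq_intros simp: has_real_derivative_iff_has_vector_derivative[symmetric])
  then have "((\<lambda>s. p (x + s *\<^sub>R x)) has_vector_derivative real n * p x) (at 0)"
  proof (rule has_vector_derivative_transform_within_open[where S = "{-1<..}"])
    fix s :: real assume "s \<in> {-1<..}"
    then show "(1 + s) ^ n * p x = p (x + s *\<^sub>R x)"
      using h[of "1 + s"] by (simp add: scaleR_add_left)
  qed auto
  then show ?thesis unfolding dir_deriv_def by (rule vector_derivative_at)
qed

lemma T_self_dpoly: "T x (\<lambda>x. dpoly (Suc n) x y) x = (x \<bullet> y) * dpoly n x y"
  using dir_deriv_euler[OF P_differentiable[OF dpoly_P] dpoly_scale, where n="Suc n"] dpoly_euler[of n x y]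
  by (simp add: T_self del: dpoly.simps)

lemma T_expand:
  assumes "p differentiable (at x)"
  shows "(\<Sum>b\<in>Basis. (z \<bullet> b) * T b p x) = T z p x"
proof -
  have "T z p x = T (\<Sum>b\<in>Basis. (z \<bullet> b) *\<^sub>R b) p x" by (simp only: euclidean_representation)
  also have "\<dots> = (\<Sum>b\<in>Basis. (z \<bullet> b) * T b p x)"
    by (simp only: linear_sum[OF linear_T[OF assms]] linear_scale[OF linear_T[OF assms]] real_scaleR_def)
  finally show ?thesis by simp
qed

text \<open>The vector field \<open>Q\<close> with \<open>Q x \<bullet> \<xi> = T \<xi> (dpoly (n + 1) \<cdot> y) x - (\<xi> \<bullet> y) dpoly n x y\<close> satisfies
  \<open>(n + 1) Q + (\<Sum>\<nu>. k \<nu> (Q - root_reflection \<nu> \<circ> Q \<circ> root_reflection \<nu>)) = 0\<close>, so it vanishes by the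
  maximum principle on orbits.\<close>
lemma T_dpoly_aux:
  assumes IH: "\<And>\<xi> x. T \<xi> (\<lambda>x. dpoly n x y) x = (\<xi> \<bullet> y) * h x"
  shows "T \<xi> (\<lambda>x. dpoly (Suc n) x y) x = (\<xi> \<bullet> y) * dpoly n x y"
proof -
  define p where "p = (\<lambda>x. dpoly (Suc n) x y)"
  define p' where "p' = (\<lambda>x. dpoly n x y)"
  define q where "q \<xi> x = T \<xi> p x - (\<xi> \<bullet> y) * p' x" for \<xi> x
  have pP: "p \<in> P" "p' \<in> P" unfolding p_def p'_def by (rule dpoly_P)+
  have qP: "q \<xi> \<in> P" for \<xi> unfolding q_def by (intro P_diff T_P P_scale pP)
  have fun_eq: "(\<lambda>x. \<Sum>b\<in>Basis. (x \<bullet> b) * T b p x) = (\<lambda>x. (x \<bullet> y) * p' x)"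
    using T_expand[OF P_differentiable[OF pP(1)]] T_self_dpoly[of _ n y] by (simp add: p_def p'_def)
  have q_fun: "q \<xi> = (\<lambda>x. T \<xi> p x - (\<xi> \<bullet> y) * p' x)" for \<xi>
    by (simp add: q_def fun_eq_iff)
  have T_q: "T a (q \<xi>) x = T a (T \<xi> p) x - (\<xi> \<bullet> y) * T a p' x" for a \<xi> x
    using T_add[of "T \<xi> p" x "\<lambda>x. - (\<xi> \<bullet> y) * p' x" a] pP
      T_scale[OF pP(2), of a "- (\<xi> \<bullet> y)"]
    by (simp add: q_fun P_differentiable T_P P_scale[of _ "- (\<xi> \<bullet> y)", simplified])
  \<comment> \<open>Apply \<open>T \<xi>\<close> to the identity \<open>fun_eq\<close>, exchange
    \<open>T \<xi>\<close> with the operators \<open>T b\<close> by commutativity, and rewrite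
    \<open>(x \<bullet> y) * T \<xi> p' x\<close> as \<open>(\<xi> \<bullet> y) * T x p' x\<close>
    by the hypothesis \<open>IH\<close>.\<close>
  have eq1: "T x (q \<xi>) x + q \<xi> x + (\<Sum>\<nu>\<in>Rp. k \<nu> * (\<nu> \<bullet> \<xi>) * q \<nu> (root_reflection \<nu> x)) = 0" for \<xi> x
  proof -
    have "T \<xi> (\<lambda>x. \<Sum>b\<in>Basis. (x \<bullet> b) * T b p x) x
      = (\<Sum>b\<in>Basis. (x \<bullet> b) * T \<xi> (T b p) x + (\<xi> \<bullet> b) * T b p x
          + (\<Sum>\<nu>\<in>Rp. k \<nu> * (\<nu> \<bullet> \<xi>) * (\<nu> \<bullet> b) * T b p (root_reflection \<nu> x)))"
      using pP by (subst T_sum) (simp_all add: P.P_lin T_P T_inner_mult P_differentiable)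
    also have "\<dots> = (\<Sum>b\<in>Basis. (x \<bullet> b) * T b (T \<xi> p) x) + (\<Sum>b\<in>Basis. (\<xi> \<bullet> b) * T b p x)
          + (\<Sum>\<nu>\<in>Rp. k \<nu> * (\<nu> \<bullet> \<xi>) * (\<Sum>b\<in>Basis. (\<nu> \<bullet> b) * T b p (root_reflection \<nu> x)))"
      using pP unfolding sum.distrib
      by (subst sum.swap[of _ Rp Basis]) (simp add: T_commute[of p \<xi>] sum_distrib_left mult.assoc)
    also have "\<dots> = T x (T \<xi> p) x + T \<xi> p x + (\<Sum>\<nu>\<in>Rp. k \<nu> * (\<nu> \<bullet> \<xi>) * T \<nu> p (root_reflection \<nu> x))"
      using pP by (simp only: T_expand P_differentiable T_P)
    finally have l: "T \<xi> (\<lambda>x. \<Sum>b\<in>Basis. (x \<bullet> b) * T b p x) x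
      = T x (T \<xi> p) x + T \<xi> p x + (\<Sum>\<nu>\<in>Rp. k \<nu> * (\<nu> \<bullet> \<xi>) * T \<nu> p (root_reflection \<nu> x))" .
    have r: "T \<xi> (\<lambda>x. (x \<bullet> y) * p' x) x = (x \<bullet> y) * T \<xi> p' x + (\<xi> \<bullet> y) * p' x
        + (\<Sum>\<nu>\<in>Rp. k \<nu> * (\<nu> \<bullet> \<xi>) * (\<nu> \<bullet> y) * p' (root_reflection \<nu> x))"
      using pP by (simp add: T_inner_mult P_differentiable)
    have i: "(x \<bullet> y) * T \<xi> p' x = (\<xi> \<bullet> y) * T x p' x"
      using IH unfolding p'_def by simp
    have s: "(\<Sum>\<nu>\<in>Rp. k \<nu> * (\<nu> \<bullet> \<xi>) * q \<nu> (root_reflection \<nu> x))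
      = (\<Sum>\<nu>\<in>Rp. k \<nu> * (\<nu> \<bullet> \<xi>) * T \<nu> p (root_reflection \<nu> x))
        - (\<Sum>\<nu>\<in>Rp. k \<nu> * (\<nu> \<bullet> \<xi>) * (\<nu> \<bullet> y) * p' (root_reflection \<nu> x))"
      by (simp add: q_def right_diff_distrib sum_subtractf mult.assoc)
    show ?thesis
      using l r i s T_q[of x \<xi> x] q_def[of \<xi> x] unfolding fun_eq by linarith
  qed
  have hom: "q \<xi> (c *\<^sub>R x) = c ^ n * q \<xi> x" if "0 < c" for c \<xi> x
    using T_homogeneous[OF pP(1), of c n \<xi> x] that
    by (simp add: q_def p_def p'_def dpoly_scale right_diff_distrib del: dpoly.simps)
  \<comment> \<open>\<open>q \<xi>\<close> is homogeneous of degree \<open>n\<close>, so the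
    derivative part of \<open>T x (q \<xi>) x\<close> is \<open>n * q \<xi> x\<close>; the separate
    \<open>q \<xi> x\<close> in \<open>eq1\<close> raises the coefficient to
    \<open>n + 1\<close>.\<close>
  have eq2: "real (Suc n) * q \<xi> x + (\<Sum>\<nu>\<in>Rp. k \<nu> * (q \<xi> x - q \<xi> (root_reflection \<nu> x)
      + (\<nu> \<bullet> \<xi>) * q \<nu> (root_reflection \<nu> x))) = 0" for \<xi> x
  proof -
    have "T x (q \<xi>) x = real n * q \<xi> x + (\<Sum>\<nu>\<in>Rp. k \<nu> * (q \<xi> x - q \<xi> (root_reflection \<nu> x)))"
      using dir_deriv_euler[OF P_differentiable[OF qP] hom] by (simp add: T_self)
    then show ?thesis using eq1[of x \<xi>]
      by (simp add: distrib_left sum.distrib distrib_right mult.assoc)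
  qed
  \<comment> \<open>\<open>q \<xi> x\<close> is linear in \<open>\<xi>\<close>, and
    \<open>Q x\<close> is the vector representing it. The terms
    \<open>(\<nu> \<bullet> \<xi>) * q \<nu>\<close> of \<open>eq2\<close> are exactly what reflects
    the value of \<open>Q\<close>, so \<open>orbit_maximum_principle\<close> applies with
    \<open>S = root_reflection\<close>.\<close>
  define Q where "Q x = (\<Sum>b\<in>Basis. q b x *\<^sub>R b)" for x
  have Q: "Q x \<bullet> \<xi> = q \<xi> x" for x \<xi>
  proof -
    have "Q x \<bullet> \<xi> = (\<Sum>b\<in>Basis. (\<xi> \<bullet> b) * T b p x) - (\<Sum>b\<in>Basis. (\<xi> \<bullet> b) * (y \<bullet> b)) * p' x"
      unfolding Q_def q_def inner_sum_left sum_distrib_right sum_subtractf[symmetric]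
      by (intro sum.cong refl) (simp add: inner_commute algebra_simps)
    then show ?thesis
      using pP by (simp add: q_def T_expand P_differentiable euclidean_inner[symmetric])
  qed
  have "Q x = 0"
  proof (rule orbit_maximum_principle[where S = root_reflection and c = "real (Suc n)" and q = Q])
    show "norm (root_reflection \<nu> v) = norm v" if "\<nu> \<in> Rp" for \<nu> v
      using that by (simp add: norm_reflection Rp_in_R)
    fix x
    let ?V = "real (Suc n) *\<^sub>R Q x + (\<Sum>\<nu>\<in>Rp. k \<nu> *\<^sub>R (Q x - root_reflection \<nu> (Q (root_reflection \<nu> x))))"
    have "?V \<bullet> \<xi> = 0" for \<xi>
    proof -
      have key: "k \<nu> * (q \<xi> x - root_reflection \<nu> (Q (root_reflection \<nu> x)) \<bullet> \<xi>)
        = k \<nu> * (q \<xi> x - q \<xi> (root_reflection \<nu> x) + (\<nu> \<bullet> \<xi>) * q \<nu> (root_reflection \<nu> x))"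
        if "\<nu> \<in> Rp" for \<nu>
      proof -
        have e: "root_reflection \<nu> (Q (root_reflection \<nu> x)) \<bullet> \<xi>
          = q \<xi> (root_reflection \<nu> x) - q \<nu> (root_reflection \<nu> x) * (\<nu> \<bullet> \<xi>)"
          using that Q[of "root_reflection \<nu> x" \<nu>] Q[of "root_reflection \<nu> x" \<xi>]
          by (simp only: reflection_eq[of \<nu> "Q _"] Rp_in_R inner_diff_left inner_scaleR_left
              inner_commute[of \<nu> "Q _"])
        show ?thesis unfolding e by (simp add: algebra_simps)
      qed
      have "?V \<bullet> \<xi> = real (Suc n) * q \<xi> x + (\<Sum>\<nu>\<in>Rp. k \<nu> *
          (q \<xi> x - root_reflection \<nu> (Q (root_reflection \<nu> x)) \<bullet> \<xi>))"
        by (simp add: inner_add_left inner_sum_left inner_diff_left Q)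
      also have "(\<Sum>\<nu>\<in>Rp. k \<nu> * (q \<xi> x - root_reflection \<nu> (Q (root_reflection \<nu> x)) \<bullet> \<xi>))
        = (\<Sum>\<nu>\<in>Rp. k \<nu> * (q \<xi> x - q \<xi> (root_reflection \<nu> x) + (\<nu> \<bullet> \<xi>) * q \<nu> (root_reflection \<nu> x)))"
        by (rule sum.cong[OF refl key])
      also note eq2[of \<xi> x]
      finally show ?thesis .
    qed
    from this[of ?V] show "?V = 0" by (simp only: inner_eq_zero_iff)
  qed simp
  then have "q \<xi> x = 0" using Q[of x \<xi>] by simp
  then show ?thesis by (simp add: q_def p_def p'_def del: dpoly.simps)
qed

lemma T_dpoly: "T \<xi> (\<lambda>x. dpoly (Suc n) x y) x = (\<xi> \<bullet> y) * dpoly n x y"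
proof (induction n arbitrary: \<xi> x)
  case 0
  show ?case by (rule T_dpoly_aux[where h = "\<lambda>_. 0"]) (simp add: T_const)
next
  case (Suc n)
  show ?case by (rule T_dpoly_aux[where h = "\<lambda>x. dpoly n x y"]) (rule Suc)
qed

end

section \<open>Majorized power series\<close>

text \<open>A power series at \<open>a\<close> that represents \<open>f\<close> on a closed cube of
  half side \<open>\<rho>\<close>, with a bound \<open>M\<close> for the absolute sum of its terms
  at the corners. Such a quantitative bound is what allows infinite series of functions to be summed
  coefficientwise.\<close>

definition majorized :: "real ^ 'n \<Rightarrow> real \<Rightarrow> (real ^ 'n \<Rightarrow> real) \<Rightarrow> real \<Rightarrow> bool" where
  "majorized a \<rho> f M \<longleftrightarrow> (\<exists>c.
     (\<forall>x. (\<forall>i. \<bar>x $ i - a $ i\<bar> \<le> \<rho>) \<longrightarrow>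
        ((\<lambda>\<alpha>::'n \<Rightarrow> nat. c \<alpha> * (\<Prod>i\<in>UNIV. (x $ i - a $ i) ^ \<alpha> i)) has_sum f x) UNIV) \<and>
     (\<exists>S\<le>M. ((\<lambda>\<alpha>. \<bar>c \<alpha>\<bar> * \<rho> ^ (\<Sum>i\<in>UNIV. \<alpha> i)) has_sum S) UNIV))"

lemma majorizedI:
  fixes f :: "real ^ 'n \<Rightarrow> real"
  assumes "\<And>x. (\<And>i. \<bar>x $ i - a $ i\<bar> \<le> \<rho>) \<Longrightarrow>
      ((\<lambda>\<alpha>::'n \<Rightarrow> nat. c \<alpha> * (\<Prod>i\<in>UNIV. (x $ i - a $ i) ^ \<alpha> i)) has_sum f x) UNIV"
    and "((\<lambda>\<alpha>. \<bar>c \<alpha>\<bar> * \<rho> ^ (\<Sum>i\<in>UNIV. \<alpha> i)) has_sum S) UNIV" "S \<le> M"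
  shows "majorized a \<rho> f M"
  using assms unfolding majorized_def by blast

lemma majorizedE:
  fixes f :: "real ^ 'n \<Rightarrow> real"
  assumes "majorized a \<rho> f M"
  obtains c S where "\<And>x. (\<And>i. \<bar>x $ i - a $ i\<bar> \<le> \<rho>) \<Longrightarrow>
      ((\<lambda>\<alpha>::'n \<Rightarrow> nat. c \<alpha> * (\<Prod>i\<in>UNIV. (x $ i - a $ i) ^ \<alpha> i)) has_sum f x) UNIV"
    and "((\<lambda>\<alpha>. \<bar>c \<alpha>\<bar> * \<rho> ^ (\<Sum>i\<in>UNIV. \<alpha> i)) has_sum S) UNIV" "S \<le> M"
  using assms unfolding majorized_def by blast

lemma majorized_mono: "majorized a \<rho> f M \<Longrightarrow> M \<le> N \<Longrightarrow> majorized a \<rho> f N"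
  unfolding majorized_def by (meson order_trans)

lemma majorized_const:
  fixes a :: "real ^ 'n"
  shows "majorized a \<rho> (\<lambda>x. C) \<bar>C\<bar>"
proof (rule majorizedI[where c = "\<lambda>\<alpha>. if \<alpha> = (\<lambda>_. 0) then C else 0" and S = "\<bar>C\<bar>"])
  show "((\<lambda>\<alpha>::'n \<Rightarrow> nat. (if \<alpha> = (\<lambda>_. 0) then C else 0) * (\<Prod>i\<in>UNIV. (x $ i - a $ i) ^ \<alpha> i)) has_sum C) UNIV" for x
    by (rule has_sum_finite_neutralI[where B = "{\<lambda>_. 0}"]) auto
  show "((\<lambda>\<alpha>::'n \<Rightarrow> nat. \<bar>if \<alpha> = (\<lambda>_. 0) then C else 0\<bar> * \<rho> ^ (\<Sum>i\<in>UNIV. \<alpha> i)) has_sum \<bar>C\<bar>) UNIV"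
    by (rule has_sum_finite_neutralI[where B = "{\<lambda>_. 0}"]) auto
qed simp

lemma majorized_scale:
  assumes "majorized a \<rho> f M"
  shows "majorized a \<rho> (\<lambda>x. C * f x) (\<bar>C\<bar> * M)"
proof -
  obtain c S where c: "\<And>x. (\<And>i. \<bar>x $ i - a $ i\<bar> \<le> \<rho>) \<Longrightarrow>
      ((\<lambda>\<alpha>. c \<alpha> * (\<Prod>i\<in>UNIV. (x $ i - a $ i) ^ \<alpha> i)) has_sum f x) UNIV"
    and S: "((\<lambda>\<alpha>. \<bar>c \<alpha>\<bar> * \<rho> ^ (\<Sum>i\<in>UNIV. \<alpha> i)) has_sum S) UNIV" "S \<le> M"
    using majorizedE[OF assms] by blast
  show ?thesis
  proof (rule majorizedI[where c = "\<lambda>\<alpha>. C * c \<alpha>" and S = "\<bar>C\<bar> * S"])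
    fix x assume "\<And>i. \<bar>x $ i - a $ i\<bar> \<le> \<rho>"
    from has_sum_cmult_right[OF c[OF this], of C]
    show "((\<lambda>\<alpha>. C * c \<alpha> * (\<Prod>i\<in>UNIV. (x $ i - a $ i) ^ \<alpha> i)) has_sum C * f x) UNIV"
      by (simp add: mult.assoc)
  next
    show "((\<lambda>\<alpha>. \<bar>C * c \<alpha>\<bar> * \<rho> ^ (\<Sum>i\<in>UNIV. \<alpha> i)) has_sum \<bar>C\<bar> * S) UNIV"
      using has_sum_cmult_right[OF S(1), of "\<bar>C\<bar>"] by (simp add: mult.assoc abs_mult)
  qed (simp add: S mult_left_mono)
qed

lemma majorized_add:
  fixes f g :: "real ^ 'n \<Rightarrow> real"
  assumes "majorized a \<rho> f M" "majorized a \<rho> g N" "0 \<le> \<rho>"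
  shows "majorized a \<rho> (\<lambda>x. f x + g x) (M + N)"
proof -
  let ?w = "\<lambda>\<alpha>::'n \<Rightarrow> nat. \<rho> ^ (\<Sum>i\<in>UNIV. \<alpha> i)"
  obtain c S where c: "\<And>x. (\<And>i. \<bar>x $ i - a $ i\<bar> \<le> \<rho>) \<Longrightarrow>
      ((\<lambda>\<alpha>. c \<alpha> * (\<Prod>i\<in>UNIV. (x $ i - a $ i) ^ \<alpha> i)) has_sum f x) UNIV"
    and S: "((\<lambda>\<alpha>. \<bar>c \<alpha>\<bar> * ?w \<alpha>) has_sum S) UNIV" "S \<le> M"
    using majorizedE[OF assms(1)] by blast
  obtain d U where d: "\<And>x. (\<And>i. \<bar>x $ i - a $ i\<bar> \<le> \<rho>) \<Longrightarrow>
      ((\<lambda>\<alpha>. d \<alpha> * (\<Prod>i\<in>UNIV. (x $ i - a $ i) ^ \<alpha> i)) has_sum g x) UNIV"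
    and U: "((\<lambda>\<alpha>. \<bar>d \<alpha>\<bar> * ?w \<alpha>) has_sum U) UNIV" "U \<le> N"
    using majorizedE[OF assms(2)] by blast
  have SU: "((\<lambda>\<alpha>. \<bar>c \<alpha>\<bar> * ?w \<alpha> + \<bar>d \<alpha>\<bar> * ?w \<alpha>) has_sum (S + U)) UNIV"
    by (rule has_sum_add[OF S(1) U(1)])
  have le: "\<bar>c \<alpha> + d \<alpha>\<bar> * ?w \<alpha> \<le> \<bar>c \<alpha>\<bar> * ?w \<alpha> + \<bar>d \<alpha>\<bar> * ?w \<alpha>" for \<alpha>
    unfolding distrib_right[symmetric] by (intro mult_right_mono abs_triangle_ineq) (use assms in simp)
  have "(\<lambda>\<alpha>. \<bar>c \<alpha> + d \<alpha>\<bar> * ?w \<alpha>) summable_on UNIV"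
    by (rule summable_on_comparison_test[OF has_sum_imp_summable[OF SU]]) (use le assms in auto)
  then obtain V where V: "((\<lambda>\<alpha>. \<bar>c \<alpha> + d \<alpha>\<bar> * ?w \<alpha>) has_sum V) UNIV" by (auto simp: summable_on_def)
  show ?thesis
  proof (rule majorizedI[where c = "\<lambda>\<alpha>. c \<alpha> + d \<alpha>" and S = V, OF _ V])
    fix x assume "\<And>i. \<bar>x $ i - a $ i\<bar> \<le> \<rho>"
    from has_sum_add[OF c[OF this] d[OF this]]
    show "((\<lambda>\<alpha>. (c \<alpha> + d \<alpha>) * (\<Prod>i\<in>UNIV. (x $ i - a $ i) ^ \<alpha> i)) has_sum f x + g x) UNIV"
      by (simp add: distrib_right)
  next
    have "V \<le> S + U" by (rule has_sum_mono[OF V SU]) (use le in auto)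
    then show "V \<le> M + N" using S U by simp
  qed
qed

lemma majorized_sum:
  assumes "finite A" "\<And>b. b \<in> A \<Longrightarrow> majorized a \<rho> (f b) (M b)" "0 \<le> \<rho>"
  shows "majorized a \<rho> (\<lambda>x. \<Sum>b\<in>A. f b x) (\<Sum>b\<in>A. M b)"
  using assms
proof (induction rule: finite_induct)
  case empty then show ?case using majorized_const[of a \<rho> 0] by simp
next
  case (insert b A) then show ?case by (simp add: majorized_add)
qed

lemma prod_power_fun_upd_Suc:
  fixes h :: "'n::finite \<Rightarrow> real"
  shows "(\<Prod>i\<in>UNIV. h i ^ (\<alpha>(j := Suc (\<alpha> j))) i) = h j * (\<Prod>i\<in>UNIV. h i ^ \<alpha> i)"
  by (subst (1 2) prod.remove[of UNIV j]) (auto intro!: prod.cong simp: mult.assoc)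

lemma sum_fun_upd_Suc:
  fixes \<alpha> :: "'n::finite \<Rightarrow> nat"
  shows "(\<Sum>i\<in>UNIV. (\<alpha>(j := Suc (\<alpha> j))) i) = Suc (\<Sum>i\<in>UNIV. \<alpha> i)"
  by (subst (1 2) sum.remove[of UNIV j]) (auto intro!: sum.cong)

text \<open>Multiplication by the \<open>j\<close>-th coordinate raises the \<open>j\<close>-th
  exponent. The weight \<open>X\<close> is kept general so as to cover both the monomials and the
  powers of \<open>\<rho>\<close> in the majorant.\<close>

lemma has_sum_shift_index:
  fixes c X :: "('n \<Rightarrow> nat) \<Rightarrow> real"
  assumes "((\<lambda>\<alpha>. c \<alpha> * X (\<alpha>(j := Suc (\<alpha> j)))) has_sum s) UNIV"
  shows "((\<lambda>\<alpha>. (if \<alpha> j = 0 then 0 else c (\<alpha>(j := \<alpha> j - 1))) * X \<alpha>) has_sum s) UNIV"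
proof -
  let ?s = "\<lambda>\<alpha>::'n \<Rightarrow> nat. \<alpha>(j := Suc (\<alpha> j))"
  let ?c = "\<lambda>\<alpha>. if \<alpha> j = 0 then 0 else c (\<alpha>(j := \<alpha> j - 1))"
  have inj: "inj ?s"
    by (rule inj_on_inverseI[where g = "\<lambda>\<alpha>. \<alpha>(j := \<alpha> j - 1)"]) simp
  have ran: "\<alpha> \<in> range ?s" if "\<alpha> j \<noteq> 0" for \<alpha>
    using that by (intro image_eqI[where x = "\<alpha>(j := \<alpha> j - 1)"]) auto
  have "((\<lambda>\<alpha>. ?c \<alpha> * X \<alpha>) \<circ> ?s has_sum s) UNIV" using assms by (simp add: o_def)
  then have "((\<lambda>\<alpha>. ?c \<alpha> * X \<alpha>) has_sum s) (range ?s)"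
    using has_sum_reindex[OF inj] by blast
  then show ?thesis
    by (subst has_sum_cong_neutral[where T = "range ?s" and g = "\<lambda>\<alpha>. ?c \<alpha> * X \<alpha>"])
      (use ran in auto)
qed

lemma majorized_coordinate:
  fixes f :: "real ^ 'n \<Rightarrow> real"
  assumes "majorized a \<rho> f M" "0 \<le> \<rho>"
  shows "majorized a \<rho> (\<lambda>x. (x $ j - a $ j) * f x) (\<rho> * M)"
proof -
  obtain c S where c: "\<And>x. (\<And>i. \<bar>x $ i - a $ i\<bar> \<le> \<rho>) \<Longrightarrow>
      ((\<lambda>\<alpha>. c \<alpha> * (\<Prod>i\<in>UNIV. (x $ i - a $ i) ^ \<alpha> i)) has_sum f x) UNIV"
    and S: "((\<lambda>\<alpha>. \<bar>c \<alpha>\<bar> * \<rho> ^ (\<Sum>i\<in>UNIV. \<alpha> i)) has_sum S) UNIV" "S \<le> M"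
    using majorizedE[OF assms(1)] by blast
  let ?c = "\<lambda>\<alpha>. if \<alpha> j = 0 then 0 else c (\<alpha>(j := \<alpha> j - 1))"
  show ?thesis
  proof (rule majorizedI[where c = ?c and S = "\<rho> * S"])
    fix x assume "\<And>i. \<bar>x $ i - a $ i\<bar> \<le> \<rho>"
    from has_sum_cmult_right[OF c[OF this], of "x $ j - a $ j"]
    show "((\<lambda>\<alpha>. ?c \<alpha> * (\<Prod>i\<in>UNIV. (x $ i - a $ i) ^ \<alpha> i)) has_sum (x $ j - a $ j) * f x) UNIV"
      by (intro has_sum_shift_index) (subst prod_power_fun_upd_Suc, subst mult.left_commute)
  next
    have "((\<lambda>\<alpha>. (if \<alpha> j = 0 then 0 else (\<lambda>\<alpha>. \<bar>c \<alpha>\<bar>) (\<alpha>(j := \<alpha> j - 1))) * \<rho> ^ (\<Sum>i\<in>UNIV. \<alpha> i)) has_sum \<rho> * S) UNIV"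
      using has_sum_cmult_right[OF S(1), of \<rho>]
      by (intro has_sum_shift_index) (subst sum_fun_upd_Suc, subst power_Suc, subst mult.left_commute)
    then show "((\<lambda>\<alpha>. \<bar>?c \<alpha>\<bar> * \<rho> ^ (\<Sum>i\<in>UNIV. \<alpha> i)) has_sum \<rho> * S) UNIV"
      by (rule has_sum_cong[THEN iffD1, rotated]) auto
  qed (simp add: S assms mult_left_mono)
qed

lemma majorized_nonneg: "majorized a \<rho> f M \<Longrightarrow> 0 \<le> \<rho> \<Longrightarrow> 0 \<le> M"
  by (erule majorizedE, erule order_trans[rotated], erule has_sum_nonneg) simp

lemma majorized_inner:
  fixes f :: "real ^ 'n \<Rightarrow> real"
  assumes f: "majorized a \<rho> f M" and \<rho>: "0 \<le> \<rho>"
  shows "majorized a \<rho> (\<lambda>x. (x \<bullet> v) * f x) (norm v * (norm a + real CARD('n) * \<rho>) * M)"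
proof -
  have "majorized a \<rho> (\<lambda>x. (a \<bullet> v) * f x + (\<Sum>i\<in>UNIV. v $ i * ((x $ i - a $ i) * f x)))
      (\<bar>a \<bullet> v\<bar> * M + (\<Sum>i\<in>UNIV. \<bar>v $ i\<bar> * (\<rho> * M)))"
    by (intro majorized_add majorized_sum majorized_scale majorized_coordinate f \<rho> finite_class.finite_UNIV)
  moreover have "(a \<bullet> v) * f x + (\<Sum>i\<in>UNIV. v $ i * ((x $ i - a $ i) * f x)) = (x \<bullet> v) * f x" for x
  proof -
    have "(\<Sum>i\<in>UNIV. v $ i * ((x $ i - a $ i) * f x)) = ((x - a) \<bullet> v) * f x"
      by (simp add: inner_vec_def sum_distrib_right sum_distrib_left mult_ac)
    then show ?thesis by (simp add: inner_diff_left left_diff_distrib)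
  qed
  moreover have "\<bar>a \<bullet> v\<bar> * M + (\<Sum>i\<in>UNIV. \<bar>v $ i\<bar> * (\<rho> * M)) \<le> norm v * (norm a + real CARD('n) * \<rho>) * M"
  proof -
    have "(\<Sum>i\<in>UNIV. \<bar>v $ i\<bar>) \<le> (\<Sum>i\<in>(UNIV::'n set). norm v)"
      by (intro sum_mono component_le_norm_cart)
    then have "\<bar>a \<bullet> v\<bar> + (\<Sum>i\<in>UNIV. \<bar>v $ i\<bar>) * \<rho> \<le> norm a * norm v + (real CARD('n) * norm v) * \<rho>"
      using \<rho> by (intro add_mono Cauchy_Schwarz_ineq2 mult_right_mono) simp_all
    then have "(\<bar>a \<bullet> v\<bar> + (\<Sum>i\<in>UNIV. \<bar>v $ i\<bar>) * \<rho>) * M \<le> (norm a * norm v + (real CARD('n) * norm v) * \<rho>) * M"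
      using majorized_nonneg[OF f \<rho>] by (rule mult_right_mono)
    moreover have "(\<Sum>i\<in>UNIV. \<bar>v $ i\<bar> * (\<rho> * M)) = (\<Sum>i\<in>UNIV. \<bar>v $ i\<bar>) * (\<rho> * M)"
      by (simp only: sum_distrib_right)
    ultimately show ?thesis by (simp add: algebra_simps)
  qed
  ultimately show ?thesis using majorized_mono by auto
qed

text \<open>The double family of coefficients is absolutely summable: summed over
  \<open>\<alpha>\<close> it is bounded by \<open>M n\<close>, which is summable. Exchanging the
  summations gives the coefficient of \<open>F\<close> at \<open>\<alpha>\<close> as the sum over
  \<open>n\<close>.\<close>

lemma majorized_suminf:
  fixes f :: "nat \<Rightarrow> real ^ 'n \<Rightarrow> real"
  assumes f: "\<And>n. majorized a \<rho> (f n) (M n)" and M: "summable M" and \<rho>: "0 < \<rho>"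
    and F: "\<And>x. (\<And>i. \<bar>x $ i - a $ i\<bar> \<le> \<rho>) \<Longrightarrow> (\<lambda>n. f n x) sums F x"
  shows "majorized a \<rho> F (suminf M)"
proof -
  let ?w = "\<lambda>\<alpha>::'n \<Rightarrow> nat. \<rho> ^ (\<Sum>i\<in>UNIV. \<alpha> i)"
  let ?m = "\<lambda>x \<alpha>. \<Prod>i\<in>UNIV. (x $ i - a $ i) ^ \<alpha> i"
  have "\<forall>n. \<exists>c S. (\<forall>x. (\<forall>i. \<bar>x $ i - a $ i\<bar> \<le> \<rho>) \<longrightarrow> ((\<lambda>\<alpha>. c \<alpha> * ?m x \<alpha>) has_sum f n x) UNIV)
      \<and> ((\<lambda>\<alpha>. \<bar>c \<alpha>\<bar> * ?w \<alpha>) has_sum S) UNIV \<and> S \<le> M n"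
    using f unfolding majorized_def by blast
  from choice[OF this] obtain c where
    "\<forall>n. \<exists>S. (\<forall>x. (\<forall>i. \<bar>x $ i - a $ i\<bar> \<le> \<rho>) \<longrightarrow> ((\<lambda>\<alpha>. c n \<alpha> * ?m x \<alpha>) has_sum f n x) UNIV)
      \<and> ((\<lambda>\<alpha>. \<bar>c n \<alpha>\<bar> * ?w \<alpha>) has_sum S) UNIV \<and> S \<le> M n" ..
  from choice[OF this] obtain S where
    cS: "\<forall>n. (\<forall>x. (\<forall>i. \<bar>x $ i - a $ i\<bar> \<le> \<rho>) \<longrightarrow> ((\<lambda>\<alpha>. c n \<alpha> * ?m x \<alpha>) has_sum f n x) UNIV)
      \<and> ((\<lambda>\<alpha>. \<bar>c n \<alpha>\<bar> * ?w \<alpha>) has_sum S n) UNIV \<and> S n \<le> M n" ..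
  then have c: "\<And>n x. (\<And>i. \<bar>x $ i - a $ i\<bar> \<le> \<rho>) \<Longrightarrow> ((\<lambda>\<alpha>. c n \<alpha> * ?m x \<alpha>) has_sum f n x) UNIV"
    and S: "\<And>n. ((\<lambda>\<alpha>. \<bar>c n \<alpha>\<bar> * ?w \<alpha>) has_sum S n) UNIV" "\<And>n. S n \<le> M n"
    by simp_all
  have w: "0 < ?w \<alpha>" for \<alpha> using \<rho> by simp
  have S0: "0 \<le> S n" for n by (rule has_sum_nonneg[OF S(1)]) (use w \<rho> in simp)
  have sumS: "summable S"
    by (rule summable_comparison_test[OF _ M]) (use S0 S(2) in auto)
  define u where "u = (\<lambda>(n, \<alpha>). \<bar>c n \<alpha>\<bar> * ?w \<alpha>)"
  have usum: "u summable_on (UNIV \<times> UNIV)"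
    unfolding u_def
    by (rule summable_on_SigmaI[where g = S])
      (use S(1) sumS S0 \<rho> in \<open>auto simp: summable_on_UNIV_nonneg_real_iff\<close>)
  then obtain U where U: "(u has_sum U) (UNIV \<times> UNIV)" by (auto simp: summable_on_def)
  have "(S has_sum U) UNIV"
    by (rule has_sum_SigmaD[OF U]) (use S(1) in \<open>simp add: u_def\<close>)
  then have US: "U = suminf S" using has_sum_imp_sums sums_unique by blast
  have U': "((\<lambda>(\<alpha>, n). u (n, \<alpha>)) has_sum U) (UNIV \<times> UNIV)" using U has_sum_swap by blast
  have su: "(\<lambda>n. \<bar>c n \<alpha>\<bar> * ?w \<alpha>) summable_on UNIV" for \<alpha>
    using summable_on_SigmaD1[of "\<lambda>\<alpha> n. u (n, \<alpha>)" UNIV "\<lambda>_. UNIV" \<alpha>] has_sum_imp_summable[OF U']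
    by (simp add: u_def)
  have sc: "(\<lambda>n. \<bar>c n \<alpha>\<bar>) summable_on UNIV" for \<alpha>
    using summable_on_cmult_left[OF su[of \<alpha>], where c = "1 / ?w \<alpha>"] w[of \<alpha>] \<rho> by simp
  have hc: "((\<lambda>n. c n \<alpha>) has_sum (\<Sum>\<^sub>\<infinity>n. c n \<alpha>)) UNIV" for \<alpha>
    using sc[of \<alpha>] abs_summable_summable[of "\<lambda>n. c n \<alpha>" UNIV] by simp
  let ?C = "\<lambda>\<alpha>. \<Sum>\<^sub>\<infinity>n. c n \<alpha>"
  have hU: "((\<lambda>\<alpha>. \<Sum>\<^sub>\<infinity>n. \<bar>c n \<alpha>\<bar> * ?w \<alpha>) has_sum U) UNIV"
    by (rule has_sum_SigmaD[OF U']) (use su in \<open>simp add: u_def\<close>)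
  have le: "\<bar>?C \<alpha>\<bar> * ?w \<alpha> \<le> (\<Sum>\<^sub>\<infinity>n. \<bar>c n \<alpha>\<bar> * ?w \<alpha>)" for \<alpha>
  proof -
    have "\<bar>?C \<alpha>\<bar> \<le> (\<Sum>\<^sub>\<infinity>n. \<bar>c n \<alpha>\<bar>)"
      using norm_infsum_bound[of "\<lambda>n. c n \<alpha>" UNIV] sc by simp
    then show ?thesis using w[of \<alpha>] sc by (simp add: infsum_cmult_left mult_right_mono)
  qed
  have "(\<lambda>\<alpha>. \<bar>?C \<alpha>\<bar> * ?w \<alpha>) summable_on UNIV"
    by (rule summable_on_comparison_test[OF has_sum_imp_summable[OF hU]]) (use le \<rho> in auto)
  then obtain V where V: "((\<lambda>\<alpha>. \<bar>?C \<alpha>\<bar> * ?w \<alpha>) has_sum V) UNIV" by (auto simp: summable_on_def)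
  show ?thesis
  proof (rule majorizedI[where c = ?C, OF _ V])
    have "V \<le> U" by (rule has_sum_mono[OF V hU]) (use le in auto)
    also have "U \<le> suminf M" unfolding US by (intro suminf_le S sumS M)
    finally show "V \<le> suminf M" .
  next
    fix x assume x: "\<And>i. \<bar>x $ i - a $ i\<bar> \<le> \<rho>"
    have m: "\<bar>?m x \<alpha>\<bar> \<le> ?w \<alpha>" for \<alpha>
      unfolding abs_prod power_sum power_abs
      by (intro prod_mono conjI power_mono x) auto
    let ?v = "\<lambda>(n, \<alpha>). c n \<alpha> * ?m x \<alpha>"
    have "(\<lambda>p. norm (?v p)) summable_on (UNIV \<times> UNIV)"
      by (rule summable_on_comparison_test[OF usum])
        (auto simp: u_def abs_mult intro!: mult_left_mono m)
    then have "?v summable_on (UNIV \<times> UNIV)" by (rule abs_summable_summable)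
    then obtain X where X: "(?v has_sum X) (UNIV \<times> UNIV)" by (auto simp: summable_on_def)
    have "((\<lambda>n. f n x) has_sum X) UNIV"
      by (rule has_sum_SigmaD[OF X]) (use c[OF x] in simp)
    then have "X = F x" using has_sum_imp_sums F[OF x] sums_unique2 by blast
    moreover have "((\<lambda>(\<alpha>, n). ?v (n, \<alpha>)) has_sum X) (UNIV \<times> UNIV)" using X has_sum_swap by blast
    then have "((\<lambda>\<alpha>. ?C \<alpha> * ?m x \<alpha>) has_sum X) UNIV"
      by (rule has_sum_SigmaD) (use has_sum_cmult_left[OF hc] in simp)
    ultimately show "((\<lambda>\<alpha>. ?C \<alpha> * ?m x \<alpha>) has_sum F x) UNIV" by simp
  qed
qed

lemma majorized_imp_real_analytic:
  fixes f :: "real ^ 'n \<Rightarrow> real"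
  assumes "\<And>a. majorized a 1 f (M a)" shows "real_analytic f"
  unfolding real_analytic_def
proof
  fix a
  obtain c S where c: "\<And>x. (\<And>i. \<bar>x $ i - a $ i\<bar> \<le> 1) \<Longrightarrow>
      ((\<lambda>\<alpha>. c \<alpha> * (\<Prod>i\<in>UNIV. (x $ i - a $ i) ^ \<alpha> i)) has_sum f x) UNIV"
    using majorizedE[OF assms[of a]] by blast
  have "\<bar>x $ i - a $ i\<bar> \<le> 1" if "x \<in> ball a 1" for x i
    using component_le_norm_cart[of "x - a" i] that by (simp add: dist_norm norm_minus_commute)
  then show "\<exists>c. \<exists>\<rho>>0. \<forall>x\<in>ball a \<rho>.
      ((\<lambda>\<alpha>. c \<alpha> * (\<Prod>i\<in>UNIV. (x $ i - a $ i) ^ \<alpha> i)) has_sum f x) UNIV"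
    using c by (intro exI[of _ c] exI[of _ 1]) auto
qed

text \<open>The terms of degree 0 and 1 give the value and the derivative; those of degree at least
  2 are bounded by a multiple of \<open>(norm h)\<^sup>2\<close>.\<close>

lemma real_analytic_differentiable:
  fixes f :: "real ^ 'n \<Rightarrow> real"
  assumes "real_analytic f"
  shows "f differentiable (at a)"
proof -
  let ?d = "\<lambda>\<alpha>::'n \<Rightarrow> nat. \<Sum>i\<in>UNIV. \<alpha> i"
  let ?m = "\<lambda>h \<alpha>. \<Prod>i\<in>(UNIV::'n set). (h $ i) ^ \<alpha> i"
  obtain c \<rho> where \<rho>: "0 < \<rho>"
    and c0: "\<And>x. x \<in> ball a \<rho> \<Longrightarrow> ((\<lambda>\<alpha>. c \<alpha> * (\<Prod>i\<in>UNIV. (x $ i - a $ i) ^ \<alpha> i)) has_sum f x) UNIV"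
    using assms unfolding real_analytic_def by metis
  have c: "((\<lambda>\<alpha>. c \<alpha> * ?m h \<alpha>) has_sum f (a + h)) UNIV" if "norm h < \<rho>" for h
    using c0[of "a + h"] that by (simp add: dist_norm)
  \<comment> \<open>The corner with all coordinates \<open>\<delta>\<close> has l1 norm
    \<open>\<rho> / 2\<close>, so the series converges there. Unconditional summability of reals is
    absolute, and this one convergent series dominates the remainder for
    \<open>norm h \<le> \<delta>\<close>.\<close>
  define \<delta> where "\<delta> = \<rho> / (2 * real CARD('n))"
  have \<delta>: "0 < \<delta>" unfolding \<delta>_def using \<rho> by simp
  have "norm ((\<chi> i. \<delta>) :: real ^ 'n) \<le> (\<Sum>i\<in>UNIV. \<bar>((\<chi> i. \<delta>) :: real ^ 'n) $ i\<bar>)"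
    by (rule norm_le_l1_cart)
  also have "\<dots> < \<rho>" using \<rho> \<delta> unfolding \<delta>_def by simp
  finally have "((\<lambda>\<alpha>. c \<alpha> * ?m (\<chi> i. \<delta>) \<alpha>) has_sum f (a + (\<chi> i. \<delta>))) UNIV" by (rule c)
  then have "(\<lambda>\<alpha>. c \<alpha> * \<delta> ^ ?d \<alpha>) summable_on UNIV"
    by (auto simp: summable_on_def power_sum)
  then have sd: "(\<lambda>\<alpha>. \<bar>c \<alpha>\<bar> * \<delta> ^ ?d \<alpha>) summable_on UNIV"
    using \<delta> by (subst (asm) summable_on_iff_abs_summable_on_real) (simp add: abs_mult)
  define S where "S = (\<Sum>\<^sub>\<infinity>\<alpha>. \<bar>c \<alpha>\<bar> * \<delta> ^ ?d \<alpha>)"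
  define e :: "'n \<Rightarrow> 'n \<Rightarrow> nat" where "e i = (\<lambda>j. if j = i then 1 else 0)" for i
  define z :: "'n \<Rightarrow> nat" where "z = (\<lambda>_. 0)"
  have inj_e: "inj e"
  proof (rule injI)
    fix i j assume "e i = e j"
    then have "e i i = e j i" by simp
    then show "i = j" by (simp add: e_def split: if_splits)
  qed
  have z_e: "z \<notin> range e"
  proof
    assume "z \<in> range e"
    then obtain i where "z i = e i i" by auto
    then show False by (simp add: e_def z_def)
  qed
  let ?A = "insert z (range e)"
  have deg2: "2 \<le> ?d \<alpha>" if "\<alpha> \<notin> ?A" for \<alpha>
  proof (rule ccontr)
    assume "\<not> 2 \<le> ?d \<alpha>"
    then consider "?d \<alpha> = 0" | "?d \<alpha> = 1" by linarith
    then show False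
    proof cases
      case 1 then have "\<alpha> = z" by (auto simp: z_def)
      then show False using that by simp
    next
      case 2
      then obtain i where i: "\<alpha> i = 1" "\<forall>j. j \<noteq> i \<longrightarrow> \<alpha> j = 0"
        using sum_eq_1_iff[of UNIV \<alpha>] by auto
      then have "\<alpha> = e i" by (auto simp: e_def)
      then show False using that by simp
    qed
  qed
  have m_e: "?m h (e i) = h $ i" for h i
    by (subst prod.remove[of UNIV i]) (auto simp: e_def intro!: prod.neutral)
  have m_z: "?m h z = 1" for h by (simp add: z_def)
  define L where "L h = (\<Sum>i\<in>UNIV. c (e i) * h $ i)" for h
  have bl: "bounded_linear L"
    unfolding L_def
    by (intro bounded_linear_sum bounded_linear_const_mult bounded_linear_vec_nth)
  have sumA: "(\<Sum>\<alpha>\<in>?A. c \<alpha> * ?m h \<alpha>) = c z + L h" for h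
    using z_e by (simp add: sum.reindex[OF inj_e] m_e m_z L_def)
  have rem: "((\<lambda>\<alpha>. c \<alpha> * ?m h \<alpha>) has_sum (f (a + h) - c z - L h)) (- ?A)" if h: "norm h < \<rho>" for h
  proof -
    have "(\<lambda>\<alpha>. c \<alpha> * ?m h \<alpha>) summable_on (- ?A)"
      by (rule summable_on_subset[OF has_sum_imp_summable[OF c[OF h]]]) simp
    then obtain r where r: "((\<lambda>\<alpha>. c \<alpha> * ?m h \<alpha>) has_sum r) (- ?A)" by (auto simp: summable_on_def)
    have "((\<lambda>\<alpha>. c \<alpha> * ?m h \<alpha>) has_sum (c z + L h)) ?A"
      unfolding sumA[symmetric] by (rule has_sum_finite) simp
    from has_sum_Un_disjoint[OF this r] have "((\<lambda>\<alpha>. c \<alpha> * ?m h \<alpha>) has_sum (c z + L h + r)) UNIV"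
      by (simp add: Un_commute)
    then have "f (a + h) = c z + L h + r" using c[OF h] has_sum_unique by blast
    then show ?thesis using r by simp
  qed
  have bnd: "\<bar>f (a + h) - c z - L h\<bar> \<le> S / \<delta>\<^sup>2 * (norm h)\<^sup>2" if h: "norm h < \<rho>" "norm h \<le> \<delta>" for h
  proof -
    have t: "\<bar>c \<alpha> * ?m h \<alpha>\<bar> \<le> (\<bar>c \<alpha>\<bar> * \<delta> ^ ?d \<alpha>) * ((norm h)\<^sup>2 / \<delta>\<^sup>2)" if "\<alpha> \<in> - ?A" for \<alpha>
    proof -
      have "\<bar>?m h \<alpha>\<bar> \<le> norm h ^ ?d \<alpha>"
        unfolding abs_prod power_sum power_abs
        by (intro prod_mono conjI power_mono component_le_norm_cart) auto
      also have "\<dots> = \<delta> ^ ?d \<alpha> * (norm h / \<delta>) ^ ?d \<alpha>" using \<delta> by (simp add: power_divide)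
      also have "\<dots> \<le> \<delta> ^ ?d \<alpha> * (norm h / \<delta>) ^ 2"
        using deg2[of \<alpha>] that h \<delta> by (intro mult_left_mono power_decreasing) auto
      finally show ?thesis
        using mult_left_mono[of _ _ "\<bar>c \<alpha>\<bar>"] by (fastforce simp: abs_mult power_divide mult.assoc)
    qed
    have sb: "(\<lambda>\<alpha>. (\<bar>c \<alpha>\<bar> * \<delta> ^ ?d \<alpha>) * ((norm h)\<^sup>2 / \<delta>\<^sup>2)) summable_on (- ?A)"
      by (intro summable_on_cmult_left summable_on_subset[OF sd]) simp
    have "(\<lambda>\<alpha>. \<bar>c \<alpha> * ?m h \<alpha>\<bar>) summable_on (- ?A)"
      by (rule summable_on_comparison_test[OF sb]) (use t in auto)
    then obtain r where r: "((\<lambda>\<alpha>. \<bar>c \<alpha> * ?m h \<alpha>\<bar>) has_sum r) (- ?A)" by (auto simp: summable_on_def)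
    have "\<bar>f (a + h) - c z - L h\<bar> \<le> r"
      using norm_has_sum_bound[OF _ rem[OF h(1)]] r by simp
    also have "r \<le> (\<Sum>\<^sub>\<infinity>\<alpha>\<in>- ?A. (\<bar>c \<alpha>\<bar> * \<delta> ^ ?d \<alpha>) * ((norm h)\<^sup>2 / \<delta>\<^sup>2))"
      by (rule has_sum_mono[OF r has_sum_infsum[OF sb]]) (use t in auto)
    also have "\<dots> \<le> (\<Sum>\<^sub>\<infinity>\<alpha>. (\<bar>c \<alpha>\<bar> * \<delta> ^ ?d \<alpha>) * ((norm h)\<^sup>2 / \<delta>\<^sup>2))"
      by (rule infsum_mono2[OF sb summable_on_cmult_left[OF sd]]) (use \<delta> in auto)
    also have "\<dots> = S * ((norm h)\<^sup>2 / \<delta>\<^sup>2)"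
      unfolding S_def by (rule infsum_cmult_left) (use sd in simp)
    finally show ?thesis by simp
  qed
  have fa: "f a = c z" using bnd[of 0] \<delta> \<rho> bl by (simp add: bounded_linear.linear linear_0)
  have "((\<lambda>h. norm (f (a + h) - f a - L h) / norm h) \<longlongrightarrow> 0) (at 0)"
  proof (rule Lim_null_comparison)
    have "\<forall>\<^sub>F h in at (0::real ^ 'n). norm h < min \<rho> \<delta>"
      using \<delta> \<rho> by (simp add: eventually_at dist_norm) (metis min_less_iff_conj)
    then show "\<forall>\<^sub>F h in at 0. norm (norm (f (a + h) - f a - L h) / norm h) \<le> \<bar>S / \<delta>\<^sup>2\<bar> * norm h"
    proof (rule eventually_mono)
      fix h :: "real ^ 'n" assume "norm h < min \<rho> \<delta>"
      then have "\<bar>f (a + h) - f a - L h\<bar> \<le> S / \<delta>\<^sup>2 * (norm h)\<^sup>2" using bnd[of h] fa by simp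
      also have "\<dots> \<le> \<bar>S / \<delta>\<^sup>2\<bar> * (norm h)\<^sup>2" by (intro mult_right_mono abs_ge_self) simp
      finally show "norm (norm (f (a + h) - f a - L h) / norm h) \<le> \<bar>S / \<delta>\<^sup>2\<bar> * norm h"
        by (cases "h = 0") (use \<delta> in \<open>simp_all add: divide_le_eq power2_eq_square mult.assoc\<close>)
    qed
    show "((\<lambda>h::real ^ 'n. \<bar>S / \<delta>\<^sup>2\<bar> * norm h) \<longlongrightarrow> 0) (at 0)"
      by (intro tendsto_mult_right_zero tendsto_norm_zero tendsto_ident_at)
  qed
  then have "(f has_derivative L) (at a)" using bl by (simp add: has_derivative_at)
  then show ?thesis by (auto simp: differentiable_def)
qed

section \<open>The Dunkl kernel\<close>

lemma summable_exp_derivative: "summable (\<lambda>n. real n * z ^ (n - 1) / fact n :: real)"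
proof -
  have "(\<lambda>n. real (Suc n) * z ^ (Suc n - 1) / fact (Suc n)) = (\<lambda>n. z ^ n /\<^sub>R fact n)"
    by (rule ext) (simp add: divide_inverse mult.commute)
  then have "summable (\<lambda>n. real (Suc n) * z ^ (Suc n - 1) / fact (Suc n))"
    using summable_exp_generic[of z] by simp
  then show ?thesis by (subst (asm) summable_Suc_iff)
qed

lemma summable_exp_series: "summable (\<lambda>n. z ^ n / fact n :: real)"
  using summable_exp_generic[of z] by (simp add: divide_inverse mult.commute)

lemma exp_series_suminf: "(\<Sum>n. z ^ n / fact n :: real) = exp z"
  by (simp add: exp_def divide_inverse mult.commute)

context dunkl begin

definition dker :: "real ^ 'n \<Rightarrow> real ^ 'n \<Rightarrow> real" where
  "dker x y = (\<Sum>n. dpoly n x y)"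

lemma summable_dpoly: "summable (\<lambda>n. dpoly n x y)"
  by (rule summable_comparison_test[OF _ summable_exp_series[of "norm x * norm y"]])
    (use dpoly_bound in auto)

lemma dpoly_sums: "(\<lambda>n. dpoly n x y) sums dker x y"
  unfolding dker_def by (rule summable_sums[OF summable_dpoly])

lemma dker_commute: "dker x y = dker y x"
  unfolding dker_def by (subst dpoly_commute) simp

lemma dker_scale: "dker (c *\<^sub>R x) y = dker x (c *\<^sub>R y)"
  unfolding dker_def by (simp add: dpoly_scale dpoly_scale_right)

lemma dker_zero: "dker 0 y = 1"
proof -
  have "(\<lambda>n. dpoly n 0 y) sums (\<Sum>n\<in>{0}. dpoly n 0 y)"
    by (rule sums_finite) (metis dpoly_zero_left finite.emptyI finite_insert insertI1 not0_implies_Suc)+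
  then show ?thesis using dpoly_sums sums_unique2 by fastforce
qed

text \<open>The recursion evaluates the previous component at \<open>g x\<close>, so the induction
  has to run over all precompositions with orthogonal maps.\<close>

lemma majorized_dpoly:
  fixes h :: "real ^ 'n \<Rightarrow> real ^ 'n"
  assumes "orthogonal_transformation h"
  shows "majorized a 1 (\<lambda>x. dpoly n (h x) y) ((norm y * (norm a + real CARD('n))) ^ n / fact n)"
  using assms
proof (induction n arbitrary: h)
  case 0
  then show ?case using majorized_const[of a 1 1] by simp
next
  case (Suc n)
  define K where "K = norm y * (norm a + real CARD('n))"
  have "majorized a 1 (\<lambda>x. \<Sum>g\<in>W. resolvent_weight (real (Suc n)) g * ((g (h x) \<bullet> y) * dpoly n (g (h x)) y))
      (\<Sum>g\<in>W. \<bar>resolvent_weight (real (Suc n)) g\<bar> * (K * (K ^ n / fact n)))"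
  proof (intro majorized_sum finite_W majorized_scale)
    fix g assume g: "g \<in> W"
    have o: "orthogonal_transformation (g \<circ> h)"
      using W_orthogonal[OF g] Suc.prems by (rule orthogonal_transformation_compose)
    obtain v where v: "norm v = norm y" "\<And>x. (g \<circ> h) x \<bullet> y = x \<bullet> v"
      using orthogonal_adjoint[OF o] by blast
    have "majorized a 1 (\<lambda>x. (x \<bullet> v) * dpoly n ((g \<circ> h) x) y)
        (norm v * (norm a + real CARD('n) * 1) * ((norm y * (norm a + real CARD('n))) ^ n / fact n))"
      by (intro majorized_inner Suc.IH o) simp
    then show "majorized a 1 (\<lambda>x. (g (h x) \<bullet> y) * dpoly n (g (h x)) y) (K * (K ^ n / fact n))"
      using v by (simp add: K_def)
  qed simp
  moreover have "(\<Sum>g\<in>W. \<bar>resolvent_weight (real (Suc n)) g\<bar> * (K * (K ^ n / fact n))) = K ^ Suc n / fact (Suc n)"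
  proof -
    have "(\<Sum>g\<in>W. \<bar>resolvent_weight (real (Suc n)) g\<bar> * (K * (K ^ n / fact n)))
      = (\<Sum>g\<in>W. resolvent_weight (real (Suc n)) g) * (K * (K ^ n / fact n))"
      unfolding sum_distrib_right by (intro sum.cong refl) (simp add: resolvent_weight_nonneg)
    then show ?thesis
      by (simp only: sum_resolvent_weight of_nat_0_less_iff zero_less_Suc) (simp add: field_simps)
  qed
  ultimately show ?case by (simp add: K_def)
qed

lemma dker_analytic: "real_analytic (\<lambda>x. dker x y)"
proof (rule majorized_imp_real_analytic)
  fix a
  show "majorized a 1 (\<lambda>x. dker x y) (\<Sum>n. (norm y * (norm a + real CARD('n))) ^ n / fact n)"
  proof (rule majorized_suminf[where f = "\<lambda>n x. dpoly n x y"])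
    show "majorized a 1 (\<lambda>x. dpoly n x y) ((norm y * (norm a + real CARD('n))) ^ n / fact n)" for n
      using majorized_dpoly[OF orthogonal_transformation_id] by simp
  qed (use summable_exp_series dpoly_sums in auto)
qed

lemma dker_differentiable: "(\<lambda>x. dker x y) differentiable (at x)"
  by (rule real_analytic_differentiable[OF dker_analytic])

lemma dker_continuous: "continuous_on S (\<lambda>x. dker x y)"
  by (intro continuous_at_imp_continuous_on ballI differentiable_imp_continuous_within dker_differentiable)

lemma dir_deriv_dpoly_bound:
  "\<bar>dir_deriv \<xi> (\<lambda>x. dpoly n x y) x\<bar> \<le> norm \<xi> * norm y * (real n * (norm x * norm y) ^ (n - 1) / fact n)"
proof -
  obtain D where "((\<lambda>x. dpoly n x y) has_derivative D) (at x)"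
    "\<forall>\<xi>. \<bar>D \<xi>\<bar> \<le> norm \<xi> * norm y * (real n * (norm x * norm y) ^ (n - 1) / fact n)"
    using has_derivative_dpoly by blast
  then show ?thesis using dir_deriv_eq by metis
qed

text \<open>Termwise differentiation along a segment. For parameters in \<open>[-1, 1]\<close> the
  points have norm at most \<open>norm x + norm \<xi>\<close>, which turns the bound on each
  derivative into a summable majorant.\<close>

lemma dir_deriv_dpoly_sums:
  "(\<lambda>n. dir_deriv \<xi> (\<lambda>x. dpoly n x y) x) sums dir_deriv \<xi> (\<lambda>x. dker x y) x"
proof -
  define B where "B = norm \<xi> * norm y"
  define M where "M n = B * (real n * ((norm x + norm \<xi>) * norm y) ^ (n - 1) / fact n)" for n
  let ?f = "\<lambda>n s. dpoly n (x + s *\<^sub>R \<xi>) y"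
  let ?f' = "\<lambda>n s. dir_deriv \<xi> (\<lambda>x. dpoly n x y) (x + s *\<^sub>R \<xi>)"
  have der: "(?f n has_field_derivative ?f' n s) (at s within {-1..1})" for n s
    by (rule has_field_derivative_at_within[OF line_derivative]) (rule P_differentiable[OF dpoly_P])
  have bound: "norm (?f' n s) \<le> M n" if "s \<in> {-1..1}" for n s
  proof -
    have "norm (x + s *\<^sub>R \<xi>) \<le> norm x + \<bar>s\<bar> * norm \<xi>" by (metis norm_scaleR norm_triangle_ineq)
    also have "\<dots> \<le> norm x + norm \<xi>"
      using that mult_right_mono[of "\<bar>s\<bar>" 1 "norm \<xi>"] by (simp add: abs_le_iff)
    finally have "(norm (x + s *\<^sub>R \<xi>) * norm y) ^ (n - 1) \<le> ((norm x + norm \<xi>) * norm y) ^ (n - 1)"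
      by (intro power_mono mult_right_mono) auto
    then have "norm \<xi> * norm y * (real n * (norm (x + s *\<^sub>R \<xi>) * norm y) ^ (n - 1) / fact n) \<le> M n"
      unfolding M_def B_def by (intro mult_left_mono divide_right_mono) auto
    then show ?thesis using dir_deriv_dpoly_bound[of \<xi> n y "x + s *\<^sub>R \<xi>"] by simp
  qed
  have sM: "summable M" unfolding M_def by (intro summable_mult summable_exp_derivative)
  have uc: "uniformly_convergent_on {-1..1} (\<lambda>n s. \<Sum>i<n. ?f' i s)"
    by (rule Weierstrass_m_test'[OF bound sM])
  have "((\<lambda>s. \<Sum>n. ?f n s) has_field_derivative (\<Sum>n. ?f' n 0)) (at 0)"
    by (rule has_field_derivative_series'(2)[OF _ der uc, where ?x0.0 = 0]) (auto intro: summable_dpoly)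
  then have "((\<lambda>s. dker (x + s *\<^sub>R \<xi>) y) has_real_derivative (\<Sum>n. ?f' n 0)) (at 0)"
    by (simp add: dker_def)
  moreover have "((\<lambda>s. dker (x + s *\<^sub>R \<xi>) y) has_real_derivative dir_deriv \<xi> (\<lambda>x. dker x y) x) (at 0)"
    using line_derivative[of "\<lambda>x. dker x y" x \<xi> 0] dker_differentiable by simp
  ultimately have "dir_deriv \<xi> (\<lambda>x. dker x y) x = (\<Sum>n. ?f' n 0)" using DERIV_unique by blast
  moreover have "summable (\<lambda>n. ?f' n 0)"
    by (rule summable_comparison_test[OF _ sM]) (use bound[of 0] in auto)
  ultimately show ?thesis using summable_sums by simp
qed

lemma quotient_dpoly_sums:
  assumes "\<nu> \<in> R"
  shows "(\<lambda>n. reflection_quotient \<nu> (\<lambda>x. dpoly n x y) x) sums reflection_quotient \<nu> (\<lambda>x. dker x y) x"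
proof (cases "\<nu> \<bullet> x = 0")
  case True
  then show ?thesis using assms dir_deriv_dpoly_sums by (simp add: quotient_hyperplane)
next
  case False
  then show ?thesis using sums_divide[OF sums_diff[OF dpoly_sums dpoly_sums]]
    by (simp add: reflection_quotient_def)
qed

lemma T_dker: "T \<xi> (\<lambda>x. dker x y) x = (\<xi> \<bullet> y) * dker x y"
proof -
  have "(\<lambda>n. T \<xi> (\<lambda>x. dpoly n x y) x) sums T \<xi> (\<lambda>x. dker x y) x"
    unfolding dunkl_operator_def
    by (intro sums_add dir_deriv_dpoly_sums sums_sum sums_mult quotient_dpoly_sums Rp_in_R)
  \<comment> \<open>The constant component is annihilated by \<open>T \<xi>\<close>, so the series
    starts at degree 1; there \<open>T_dpoly\<close> lowers every degree by one.\<close>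
  then have "(\<lambda>n. T \<xi> (\<lambda>x. dpoly (Suc n) x y) x) sums T \<xi> (\<lambda>x. dker x y) x"
    by (subst sums_Suc_iff) (simp add: T_const)
  then have "(\<lambda>n. (\<xi> \<bullet> y) * dpoly n x y) sums T \<xi> (\<lambda>x. dker x y) x"
    by (simp only: T_dpoly)
  then show ?thesis using sums_mult[OF dpoly_sums] sums_unique2 by blast
qed

section \<open>Uniqueness and positivity of the Dunkl kernel\<close>

definition euler_solution :: "(real ^ 'n \<Rightarrow> real) \<Rightarrow> real ^ 'n \<Rightarrow> bool" where
  "euler_solution f y \<longleftrightarrow> (\<forall>x. f differentiable (at x)) \<and>
     (\<forall>x. dir_deriv x f x = (x \<bullet> y) * f x - (\<Sum>\<nu>\<in>Rp. k \<nu> * (f x - f (root_reflection \<nu> x))))"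

text \<open>The eigenvalue equation is used only in the radial direction \<open>\<xi> = x\<close>,
  in which it is transported along the flow below.\<close>

lemma dker_euler: "euler_solution (\<lambda>x. dker x y) y"
  using T_self[of _ "\<lambda>x. dker x y"] T_dker[of _ y]
  by (auto simp: euler_solution_def dker_differentiable algebra_simps)

text \<open>The function \<open>u (x, z) = (\<Sum>j. c j * f j x * exp (z \<bullet> y j))\<close> satisfies
  \<open>x \<bullet> \<nabla>\<^sub>x u - x \<bullet> \<nabla>\<^sub>z u = - (\<Sum>\<nu>. k \<nu> * (u (x, z) - u (root_reflection \<nu> x, z)))\<close>, and both the
  reflections of \<open>x\<close> and the backward flow of \<open>x \<bullet> \<nabla>\<^sub>x - x \<bullet> \<nabla>\<^sub>z\<close> preserve the set
  \<open>norm x + norm z \<le> \<rho>\<close>. Hence its minimum there is attained at \<open>x = 0\<close>, up to a perturbation.\<close>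
theorem euler_positivity:
  assumes J: "finite J" and f: "\<And>j. j \<in> J \<Longrightarrow> euler_solution (f j) (y j)"
    and pos: "\<And>z. norm z \<le> \<rho> \<Longrightarrow> 0 \<le> (\<Sum>j\<in>J. c j * f j 0 * exp (z \<bullet> y j))"
    and x: "norm x \<le> \<rho>"
  shows "0 \<le> (\<Sum>j\<in>J. c j * f j x)"
proof -
  define u where "u = (\<lambda>(x, z). \<Sum>j\<in>J. c j * f j x * exp (z \<bullet> y j))"
  define K where "K = {p :: (real ^ 'n) \<times> (real ^ 'n). norm (fst p) + norm (snd p) \<le> \<rho>}"
  have "\<rho> \<ge> 0" using x norm_ge_zero order_trans by blast
  then have K0: "(0, 0) \<in> K" by (simp add: K_def)
  have "closed K" unfolding K_def by (intro closed_Collect_le continuous_intros)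
  moreover have "bounded K"
  proof (rule boundedI)
    fix p assume "p \<in> K"
    then show "norm p \<le> \<rho>"
      using norm_Pair_le[of "fst p" "snd p"] by (simp add: K_def)
  qed
  ultimately have compact: "compact K" by (simp add: compact_eq_bounded_closed)
  have cont_f: "continuous_on UNIV (f j)" if "j \<in> J" for j
    using f[OF that] unfolding euler_solution_def
    by (intro continuous_at_imp_continuous_on ballI differentiable_imp_continuous_within) simp
  have cont_u: "continuous_on K u"
    unfolding u_def case_prod_beta
    by (intro continuous_intros continuous_on_compose2[OF cont_f]) auto
  have main: "- \<epsilon> * (norm x)\<^sup>2 \<le> u (x, 0)" if \<epsilon>: "0 < \<epsilon>" for \<epsilon>
  proof -
    \<comment> \<open>The perturbation makes the derivative along the flow strictly negative at a
      minimum with first component different from 0.\<close>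
    define v where "v p = u p + \<epsilon> * (norm (fst p))\<^sup>2" for p
    have "continuous_on K v" unfolding v_def by (intro continuous_intros cont_u)
    then obtain p where p: "p \<in> K" "\<And>q. q \<in> K \<Longrightarrow> v p \<le> v q"
      using continuous_attains_inf[OF compact] K0 by blast
    obtain a b where ab: "p = (a, b)" by (cases p)
    have nab: "norm a + norm b \<le> \<rho>" using p(1) by (simp add: K_def ab)
    have a0: "a = 0"
    proof (rule ccontr)
      assume a: "a \<noteq> 0"
      \<comment> \<open>Norm is moved from the first component to the second: \<open>norm a\<close>
        drops by \<open>s * norm a\<close> while \<open>norm b\<close> grows by at most that much,
        so the path stays in \<open>K\<close> for \<open>0 \<le> s \<le> 1\<close>.\<close>
      define \<psi> where "\<psi> s = v (a + (- s) *\<^sub>R a, b + s *\<^sub>R a)" for s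
      have \<psi>_min: "\<psi> 0 \<le> \<psi> s" if "0 \<le> s" "s \<le> 1" for s
      proof -
        have "norm (a + (- s) *\<^sub>R a) = (1 - s) * norm a"
          using that by (metis (no_types, lifting) abs_of_nonneg diff_ge_0_iff_ge diff_conv_add_uminus
              norm_scaleR scaleR_add_left scaleR_one)
        moreover have "norm (b + s *\<^sub>R a) \<le> norm b + s * norm a"
          using that norm_triangle_ineq[of b "s *\<^sub>R a"] by simp
        ultimately have "(a + (- s) *\<^sub>R a, b + s *\<^sub>R a) \<in> K"
          using nab by (simp add: K_def algebra_simps)
        then show ?thesis using p(2) by (simp add: \<psi>_def ab)
      qed
      define E where "E j = exp (b \<bullet> y j)" for j
      have df: "((\<lambda>s. f j (a + (- s) *\<^sub>R a)) has_real_derivative - dir_deriv a (f j) a) (at 0)" if j: "j \<in> J" for j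
      proof -
        obtain D where D: "(f j has_derivative D) (at a)"
          using f[OF j] by (auto simp: euler_solution_def differentiable_def)
        have "((\<lambda>s. f j (a + s *\<^sub>R (- a))) has_real_derivative D (- a)) (at 0)"
          using has_vector_derivative_line[OF D, of "- a"]
          by (simp only: has_real_derivative_iff_has_vector_derivative)
        moreover have "D (- a) = - dir_deriv a (f j) a"
          using dir_deriv_eq[OF D] linear_neg[OF has_derivative_linear[OF D]] by simp
        ultimately show ?thesis by simp
      qed
      have de: "((\<lambda>s. exp ((b + s *\<^sub>R a) \<bullet> y j)) has_real_derivative E j * (a \<bullet> y j)) (at 0)" for j
        unfolding E_def inner_add_left inner_scaleR_left
        by (auto intro!: derivative_eq_intros)
      have dn: "((\<lambda>s. \<epsilon> * (norm (a + (- s) *\<^sub>R a))\<^sup>2) has_real_derivative - 2 * \<epsilon> * (norm a)\<^sup>2) (at 0)"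
      proof -
        have "(\<lambda>s. \<epsilon> * (norm (a + (- s) *\<^sub>R a))\<^sup>2) = (\<lambda>s. \<epsilon> * ((1 - s)\<^sup>2 * (norm a)\<^sup>2))"
        proof
          fix s
          have "a + (- s) *\<^sub>R a = (1 - s) *\<^sub>R a" by (simp add: scaleR_diff_left)
          then show "\<epsilon> * (norm (a + (- s) *\<^sub>R a))\<^sup>2 = \<epsilon> * ((1 - s)\<^sup>2 * (norm a)\<^sup>2)"
            by (simp only: norm_scaleR power_mult_distrib power2_abs)
        qed
        then show ?thesis by (auto intro!: derivative_eq_intros)
      qed
      have "(\<psi> has_real_derivative (\<Sum>j\<in>J. c j * (- dir_deriv a (f j) a) * E j + E j * (a \<bullet> y j) * (c j * f j a))
          + (- 2 * \<epsilon> * (norm a)\<^sup>2)) (at 0)"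
      proof -
        have "((\<lambda>s. (\<Sum>j\<in>J. c j * f j (a + (- s) *\<^sub>R a) * exp ((b + s *\<^sub>R a) \<bullet> y j))
            + \<epsilon> * (norm (a + (- s) *\<^sub>R a))\<^sup>2) has_real_derivative
            (\<Sum>j\<in>J. c j * (- dir_deriv a (f j) a) * E j + E j * (a \<bullet> y j) * (c j * f j a))
            + (- 2 * \<epsilon> * (norm a)\<^sup>2)) (at 0)"
        proof (intro DERIV_add DERIV_sum dn)
          fix j assume j: "j \<in> J"
          from DERIV_mult[OF DERIV_cmult[OF df[OF j], of "c j"] de[of j]]
          show "((\<lambda>s. c j * f j (a + (- s) *\<^sub>R a) * exp ((b + s *\<^sub>R a) \<bullet> y j)) has_real_derivative
              c j * (- dir_deriv a (f j) a) * E j + E j * (a \<bullet> y j) * (c j * f j a)) (at 0)"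
            by (simp add: E_def)
        qed
        then show ?thesis by (simp add: \<psi>_def[abs_def] v_def u_def)
      qed
      moreover have "(\<Sum>j\<in>J. c j * (- dir_deriv a (f j) a) * E j + E j * (a \<bullet> y j) * (c j * f j a))
          = (\<Sum>\<nu>\<in>Rp. k \<nu> * (u (a, b) - u (root_reflection \<nu> a, b)))"
      proof -
        have "(\<Sum>j\<in>J. c j * (- dir_deriv a (f j) a) * E j + E j * (a \<bullet> y j) * (c j * f j a))
          = (\<Sum>j\<in>J. \<Sum>\<nu>\<in>Rp. k \<nu> * (c j * f j a * E j - c j * f j (root_reflection \<nu> a) * E j))"
        proof (rule sum.cong[OF refl])
          fix j assume j: "j \<in> J"
          define S where "S = (\<Sum>\<nu>\<in>Rp. k \<nu> * (f j a - f j (root_reflection \<nu> a)))"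
          have dd: "dir_deriv a (f j) a = (a \<bullet> y j) * f j a - S"
            using f[OF j] by (simp add: euler_solution_def S_def)
          have "c j * (- dir_deriv a (f j) a) * E j + E j * (a \<bullet> y j) * (c j * f j a) = c j * E j * S"
            unfolding dd by (simp add: algebra_simps)
          also have "\<dots> = (\<Sum>\<nu>\<in>Rp. k \<nu> * (c j * f j a * E j - c j * f j (root_reflection \<nu> a) * E j))"
            unfolding sum_distrib_left S_def by (intro sum.cong refl) (simp only: algebra_simps)
          finally show "c j * (- dir_deriv a (f j) a) * E j + E j * (a \<bullet> y j) * (c j * f j a)
            = (\<Sum>\<nu>\<in>Rp. k \<nu> * (c j * f j a * E j - c j * f j (root_reflection \<nu> a) * E j))" .
        qed
        also have "\<dots> = (\<Sum>\<nu>\<in>Rp. k \<nu> * (u (a, b) - u (root_reflection \<nu> a, b)))"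
          by (subst sum.swap) (simp add: u_def E_def sum_subtractf[symmetric] sum_distrib_left)
        finally show ?thesis .
      qed
      \<comment> \<open>The reflected point lies in \<open>K\<close> and has the same perturbation
        term, so minimality of \<open>v\<close> passes to \<open>u\<close>.\<close>
      moreover have "(\<Sum>\<nu>\<in>Rp. k \<nu> * (u (a, b) - u (root_reflection \<nu> a, b))) \<le> 0"
      proof (rule sum_nonpos)
        fix \<nu> assume nu: "\<nu> \<in> Rp"
        have "(root_reflection \<nu> a, b) \<in> K" using nab nu by (simp add: K_def norm_reflection Rp_in_R)
        then have "u (a, b) \<le> u (root_reflection \<nu> a, b)"
          using p(2) nu by (fastforce simp: v_def ab norm_reflection Rp_in_R)
        then show "k \<nu> * (u (a, b) - u (root_reflection \<nu> a, b)) \<le> 0"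
          using k_nonneg[OF nu] by (simp add: mult_nonneg_nonpos)
      qed
      moreover have "0 < \<epsilon> * (norm a)\<^sup>2" using a \<epsilon> by simp
      ultimately obtain m where m: "(\<psi> has_real_derivative m) (at 0)" "m < 0" by fastforce
      obtain d where d: "0 < d" "\<And>h. 0 < h \<Longrightarrow> h < d \<Longrightarrow> \<psi> (0 + h) < \<psi> 0"
        using DERIV_neg_dec_right[OF m] by auto
      have "min 1 (d / 2) < d" using d(1) by (simp add: min_def)
      then show False using d(2)[of "min 1 (d / 2)"] d(1) \<psi>_min[of "min 1 (d / 2)"] by auto
    qed
    have "norm b \<le> \<rho>" using nab a0 by simp
    then have "0 \<le> v p" using pos[of b] by (simp add: v_def ab a0 u_def)
    also have "v p \<le> v (x, 0)" using p(2)[of "(x, 0)"] x by (simp add: K_def)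
    finally show ?thesis by (simp add: v_def)
  qed
  have "0 \<le> u (x, 0)"
  proof (rule ccontr)
    assume neg: "\<not> 0 \<le> u (x, 0)"
    \<comment> \<open>Chosen so that \<open>\<epsilon> * ((norm x)\<^sup>2 + 1)\<close> is half of
      the supposed defect \<open>- u (x, 0)\<close>.\<close>
    define \<epsilon> where "\<epsilon> = - u (x, 0) / (2 * ((norm x)\<^sup>2 + 1))"
    have p: "0 < 2 * ((norm x)\<^sup>2 + 1)" by (simp add: add_nonneg_pos)
    have "0 < \<epsilon>" unfolding \<epsilon>_def using neg p by (intro divide_pos_pos) auto
    then have "- u (x, 0) \<le> \<epsilon> * (norm x)\<^sup>2" using main by fastforce
    also have "\<dots> \<le> \<epsilon> * ((norm x)\<^sup>2 + 1)" using \<open>0 < \<epsilon>\<close> by simp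
    also have "\<dots> = - u (x, 0) / 2" unfolding \<epsilon>_def using p by (simp add: field_simps)
    finally show False using neg by simp
  qed
  then show ?thesis by (simp add: u_def)
qed

text \<open>For two solutions with the same \<open>y\<close>, the exponential sum belonging to
  \<open>g - f\<close> is \<open>(g 0 - f 0) * exp (z \<bullet> y) = 0\<close>. So positivity
  applies to \<open>g - f\<close>, and by symmetry to \<open>f - g\<close>.\<close>

lemma euler_solution_unique:
  assumes "euler_solution f y" "euler_solution g y" "f 0 = g 0"
  shows "f x = g x"
proof -
  have le: "f x \<le> g x" if fg: "euler_solution f y" "euler_solution g y" "f 0 = g 0" for f g
    using euler_positivity[of "{0, 1::nat}" "\<lambda>j. if j = 0 then f else g" "\<lambda>_. y" "norm x"
        "\<lambda>j. if j = 0 then -1 else 1" x] fg by simp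
  show ?thesis using le[OF assms] le[OF assms(2,1) assms(3)[symmetric]] by simp
qed

text \<open>Any candidate in the definite description is differentiable by analyticity and satisfies
  the Euler equation by \<open>T_self\<close>, so uniqueness identifies it with the series.\<close>

lemma dunkl_kernel_eq: "dunkl_kernel Rp k x y = dker x y"
proof -
  let ?Q = "\<lambda>f. real_analytic f \<and> (\<forall>\<xi> z. T \<xi> f z = (\<xi> \<bullet> y) * f z) \<and> f 0 = 1"
  have "(THE f. ?Q f) = (\<lambda>x. dker x y)"
  proof (rule the_equality)
    show "?Q (\<lambda>x. dker x y)" using dker_analytic T_dker dker_zero by auto
  next
    fix f assume f: "?Q f"
    have "euler_solution f y"
      using f T_self[of _ f] by (auto simp: euler_solution_def real_analytic_differentiable algebra_simps)
    then show "f = (\<lambda>x. dker x y)"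
      using euler_solution_unique[OF _ dker_euler] f dker_zero by (intro ext) auto
  qed
  then show ?thesis unfolding dunkl_kernel_def by simp
qed

text \<open>The roles are exchanged: \<open>euler_positivity\<close> is evaluated at the point
  \<open>y\<close>, for the solutions with parameters \<open>x j\<close>, and
  \<open>dker_commute\<close> restores the order. The statement says what a representation of
  \<open>dker x y\<close> as an average of \<open>exp (x \<bullet> z)\<close> over
  \<open>norm z \<le> norm y\<close> would give.\<close>

lemma dker_positivity:
  assumes "finite J" "\<And>z. norm z \<le> norm y \<Longrightarrow> 0 \<le> (\<Sum>j\<in>J. c j * exp (z \<bullet> x j))"
  shows "0 \<le> (\<Sum>j\<in>J. c j * dker (x j) y)"
  using euler_positivity[of J "\<lambda>j z. dker z (x j)" x "norm y" c y] assms dker_euler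
  by (simp add: dker_zero dker_commute[of y])

lemma dker_nonneg: "0 \<le> dker x y"
  using dker_positivity[of "{0::nat}" y "\<lambda>_. 1" "\<lambda>_. x"] by simp

text \<open>The constant on the right is written as a multiple of \<open>dker 0 y = 1\<close>; the
  inequality required for exponentials is then Cauchy-Schwarz.\<close>

lemma dker_le_exp: "dker x y \<le> exp (norm x * norm y)"
proof -
  have "z \<bullet> x \<le> norm x * norm y" if "norm z \<le> norm y" for z
  proof -
    have "z \<bullet> x \<le> norm z * norm x" by (rule norm_cauchy_schwarz)
    also have "\<dots> \<le> norm x * norm y" using that by (simp add: mult.commute mult_left_mono)
    finally show ?thesis .
  qed
  then show ?thesis
    using dker_positivity[of "{0, 1::nat}" y "\<lambda>j. if j = 0 then exp (norm x * norm y) else -1"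
        "\<lambda>j. if j = 0 then 0 else x"] by (simp add: dker_zero)
qed

end

section \<open>Gaussian integrals\<close>

lemma AE_hyperplane:
  fixes v :: "'a::euclidean_space"
  assumes "v \<noteq> 0" shows "AE y in lborel. v \<bullet> y \<noteq> 0"
proof -
  have "closed {y. v \<bullet> y = 0}" by (intro closed_Collect_eq continuous_intros)
  then have "{y. v \<bullet> y = 0} \<in> sets lborel" by simp
  moreover have "{y. v \<bullet> y = 0} \<in> null_sets lebesgue"
    using negligible_hyperplane[of v 0] assms by (simp add: negligible_iff_null_sets)
  ultimately have "{y. v \<bullet> y = 0} \<in> null_sets lborel"
    by (simp add: null_sets_completion_iff)
  then show ?thesis by (rule AE_I') auto
qed

text \<open>Weil's uniqueness argument for translation invariant measures, applied to the image of
  Lebesgue measure under \<open>g\<close>: both sides are compared after convolution with the unit ball.\<close>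
lemma nn_integral_lborel_orthogonal:
  fixes g :: "'a::euclidean_space \<Rightarrow> 'a" and f :: "'a \<Rightarrow> ennreal"
  assumes g: "orthogonal_transformation g" and f[measurable]: "f \<in> borel_measurable borel"
  shows "(\<integral>\<^sup>+x. f (g x) \<partial>lborel) = (\<integral>\<^sup>+x. f x \<partial>lborel)"
proof -
  have lin: "linear g" using g orthogonal_transformation_linear by blast
  have [measurable]: "g \<in> borel_measurable borel"
    using linear_continuous_on linear_linear lin borel_measurable_continuous_onI by blast
  define B where "B = ball (0::'a) 1"
  have [measurable]: "B \<in> sets borel" by (simp add: B_def)
  define b where "b = emeasure lborel B"
  have b: "b \<noteq> 0" "b \<noteq> \<infinity>"
    using emeasure_lborel_ball_finite[of "0::'a" 1] unfolding b_def B_def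
    by (auto simp: emeasure_ball ennreal_eq_0_iff unit_ball_vol_pos not_le)
  have plus: "(\<integral>\<^sup>+y. F (c + y) \<partial>lborel) = (\<integral>\<^sup>+y. F y \<partial>lborel)"
    if [measurable]: "F \<in> borel_measurable borel" for F :: "'a \<Rightarrow> ennreal" and c
    using nn_integral_distr[of "(+) c" lborel borel F] by (simp add: lborel_distr_plus)
  have minus: "(\<integral>\<^sup>+y. F (c - y) \<partial>lborel) = (\<integral>\<^sup>+y. F y \<partial>lborel)"
    if [measurable]: "F \<in> borel_measurable borel" for F :: "'a \<Rightarrow> ennreal" and c
  proof -
    have "lborel = distr lborel borel (\<lambda>x::'a. c + (- 1) *\<^sub>R x)"
      using lborel_affine[of "- 1" c] by (simp add: density_1)
    then have "(\<integral>\<^sup>+y. F y \<partial>lborel) = (\<integral>\<^sup>+y. F y \<partial>distr lborel borel (\<lambda>x::'a. c + (- 1) *\<^sub>R x))"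
      by simp
    also have "\<dots> = (\<integral>\<^sup>+y. F (c - y) \<partial>lborel)" by (subst nn_integral_distr) auto
    finally show ?thesis by simp
  qed
  have "(\<integral>\<^sup>+x. f (g x) \<partial>lborel) * b = (\<integral>\<^sup>+x. \<integral>\<^sup>+y. f (g x) * indicator B (g x + y) \<partial>lborel \<partial>lborel)"
    by (simp add: nn_integral_cmult nn_integral_multc plus b_def)
  also have "\<dots> = (\<integral>\<^sup>+y. \<integral>\<^sup>+x. f (g x) * indicator B (g x + y) \<partial>lborel \<partial>lborel)"
    by (rule lborel_pair.Fubini'[symmetric]) measurable
  also have "\<dots> = (\<integral>\<^sup>+y. \<integral>\<^sup>+x. f (g x - y) * indicator B (g x) \<partial>lborel \<partial>lborel)"
  proof (rule nn_integral_cong)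
    fix y
    obtain z where z: "g z = y" using orthogonal_transformation_surj[OF g] by (metis surj_def)
    have "(\<integral>\<^sup>+x. f (g x - y) * indicator B (g x) \<partial>lborel) = (\<integral>\<^sup>+x. f (g (z + x) - y) * indicator B (g (z + x)) \<partial>lborel)"
      by (rule plus[symmetric]) measurable
    then show "(\<integral>\<^sup>+x. f (g x) * indicator B (g x + y) \<partial>lborel) = (\<integral>\<^sup>+x. f (g x - y) * indicator B (g x) \<partial>lborel)"
      by (simp add: linear_add[OF lin] z add.commute)
  qed
  also have "\<dots> = (\<integral>\<^sup>+x. \<integral>\<^sup>+y. f (g x - y) * indicator B (g x) \<partial>lborel \<partial>lborel)"
    by (rule lborel_pair.Fubini') measurable
  also have "\<dots> = (\<integral>\<^sup>+x. (\<integral>\<^sup>+y. f y \<partial>lborel) * indicator B (g x) \<partial>lborel)"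
    by (simp add: nn_integral_multc minus)
  also have "\<dots> = (\<integral>\<^sup>+x. (\<integral>\<^sup>+y. f y \<partial>lborel) * indicator B x \<partial>lborel)"
    using orthogonal_transformation_norm[OF g] by (intro nn_integral_cong) (simp add: B_def indicator_def)
  also have "\<dots> = (\<integral>\<^sup>+y. f y \<partial>lborel) * b" by (simp add: nn_integral_cmult b_def)
  finally show ?thesis using b by (simp add: ennreal_mult_cancel_left mult.commute[of _ b])
qed

lemma lborel_distr_orthogonal:
  fixes g :: "'a::euclidean_space \<Rightarrow> 'a"
  assumes "orthogonal_transformation g" shows "distr lborel borel g = lborel"
proof (rule measure_eqI)
  have g[measurable]: "g \<in> borel_measurable borel"
    using assms orthogonal_transformation_linear linear_continuous_on linear_linear
      borel_measurable_continuous_onI by metis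
  fix A assume "A \<in> sets (distr lborel borel g)"
  then have [measurable]: "A \<in> sets borel" by simp
  have "emeasure (distr lborel borel g) A = (\<integral>\<^sup>+x. indicator A x \<partial>distr lborel borel g)" by simp
  also have "\<dots> = (\<integral>\<^sup>+x. indicator A (g x) \<partial>lborel)" by (rule nn_integral_distr) auto
  also have "\<dots> = emeasure lborel A"
    using nn_integral_lborel_orthogonal[OF assms, of "indicator A"] by simp
  finally show "emeasure (distr lborel borel g) A = emeasure lborel A" .
qed simp

lemma integral_lborel_orthogonal:
  fixes g :: "'a::euclidean_space \<Rightarrow> 'a" and f :: "'a \<Rightarrow> real"
  assumes g: "orthogonal_transformation g" and f: "f \<in> borel_measurable borel"
  shows "(LINT x|lborel. f (g x)) = (LINT x|lborel. f x)"
proof -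
  have "g \<in> borel_measurable borel"
    using g orthogonal_transformation_linear linear_continuous_on linear_linear
      borel_measurable_continuous_onI by metis
  then show ?thesis
    using integral_distr[of g lborel borel f] f lborel_distr_orthogonal[OF g] by simp
qed

text \<open>Difference quotients of \<open>g\<close> in the direction \<open>\<xi>\<close> have
  integral 0 by translation invariance. By the mean value theorem they are values of
  \<open>g'\<close> on the segment, hence dominated by \<open>B\<close>.\<close>

lemma integral_lborel_derivative_zero:
  fixes g g' :: "'a::euclidean_space \<Rightarrow> real"
  assumes d: "\<And>y s. ((\<lambda>s. g (y + s *\<^sub>R \<xi>)) has_real_derivative g' (y + s *\<^sub>R \<xi>)) (at s)"
    and g: "integrable lborel g" and B: "integrable lborel B"
    and bnd: "\<And>y s. 0 \<le> s \<Longrightarrow> s \<le> 1 \<Longrightarrow> \<bar>g' (y + s *\<^sub>R \<xi>)\<bar> \<le> B y"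
  shows "(LINT y|lborel. g' y) = 0"
proof -
  define h where "h n = 1 / real (Suc n)" for n
  have h: "0 < h n" "h n \<le> 1" for n by (simp_all add: h_def)
  define u where "u n y = (g (y + h n *\<^sub>R \<xi>) - g y) / h n" for n y
  have [measurable]: "g \<in> borel_measurable borel" using borel_measurable_integrable[OF g] by simp
  have um[measurable]: "u n \<in> borel_measurable borel" for n unfolding u_def by measurable
  have lim: "(\<lambda>n. u n y) \<longlonglongrightarrow> g' y" for y
  proof -
    have "((\<lambda>s. (g (y + s *\<^sub>R \<xi>) - g y) / s) \<longlongrightarrow> g' y) (at 0)"
      using d[of y 0] by (simp add: has_field_derivative_iff)
    moreover have "filterlim h (at 0) sequentially"
      unfolding filterlim_at h_def using LIMSEQ_inverse_real_of_nat by (simp add: inverse_eq_divide)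
    ultimately show ?thesis unfolding u_def by (rule filterlim_compose)
  qed
  have g'm: "g' \<in> borel_measurable lborel"
    by (rule borel_measurable_LIMSEQ_real[OF lim]) measurable
  have ub: "\<bar>u n y\<bar> \<le> B y" for n y
  proof -
    obtain z where z: "0 < z" "z < h n"
      "g (y + h n *\<^sub>R \<xi>) - g (y + 0 *\<^sub>R \<xi>) = (h n - 0) * g' (y + z *\<^sub>R \<xi>)"
      using MVT2[OF h(1)[of n], of "\<lambda>s. g (y + s *\<^sub>R \<xi>)" "\<lambda>s. g' (y + s *\<^sub>R \<xi>)"] d by blast
    then have "u n y = g' (y + z *\<^sub>R \<xi>)" using h(1)[of n] by (simp add: u_def)
    then show ?thesis using bnd[of z y] z h(2)[of n] by simp
  qed
  have sh: "integrable lborel (\<lambda>y. g (y + c))" "(LINT y|lborel. g (y + c)) = (LINT y|lborel. g y)" for c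
  proof -
    show "(LINT y|lborel. g (y + c)) = (LINT y|lborel. g y)"
      using integral_distr[of "(+) c" lborel borel g] by (simp add: lborel_distr_plus add.commute)
    show "integrable lborel (\<lambda>y. g (y + c))"
      using integrable_distr[of "(+) c" lborel borel g] g by (simp add: lborel_distr_plus add.commute)
  qed
  have "(LINT y|lborel. u n y) = 0" for n
    unfolding u_def using sh g by simp
  moreover have "(\<lambda>n. LINT y|lborel. u n y) \<longlonglongrightarrow> (LINT y|lborel. g' y)"
    by (rule integral_dominated_convergence[OF g'm _ B]) (use lim ub in auto)
  ultimately show ?thesis by (simp add: LIMSEQ_const_iff)
qed

lemma integrable_gauss_real:
  assumes "0 < c" shows "integrable lborel (\<lambda>u::real. exp (- c * u\<^sup>2))"
proof -
  define \<sigma> where "\<sigma> = sqrt (1 / (2 * c))"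
  have \<sigma>: "0 < \<sigma>" "\<sigma>\<^sup>2 = 1 / (2 * c)" unfolding \<sigma>_def using assms by simp_all
  have "integrable lborel (\<lambda>u. sqrt (2 * pi * \<sigma>\<^sup>2) * normal_density 0 \<sigma> u)"
    using \<sigma> by (intro integrable_mult_right integrable_normal_density)
  moreover have "sqrt (2 * pi * \<sigma>\<^sup>2) * normal_density 0 \<sigma> u = exp (- c * u\<^sup>2)" for u
    unfolding normal_density_def using \<sigma> assms by (simp add: field_simps)
  ultimately show ?thesis by simp
qed

lemma integrable_powr_gauss_real:
  assumes a: "0 \<le> a" "a < 1" and c: "0 < c"
  shows "integrable lborel (\<lambda>u::real. \<bar>u\<bar> powr (- a) * exp (- c * u\<^sup>2))"
proof -
  define G where "G u = indicator {0..1} u * u powr (- a)" for u :: real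
  have Gm[measurable]: "G \<in> borel_measurable borel" unfolding G_def by measurable
  have "(\<lambda>u::real. u powr (- a)) absolutely_integrable_on {0..1}"
    using a by (intro nonnegative_absolutely_integrable_1 integrable_on_powr_from_0) auto
  then have "integrable lebesgue G"
    unfolding set_integrable_def G_def by simp
  then have G: "integrable lborel G" by (subst (asm) integrable_completion) simp_all
  have G': "integrable lborel (\<lambda>u. G (- u))"
    using lborel_integrable_real_affine[OF G, of "-1" 0] by simp
  have "integrable lborel (\<lambda>u. G u + G (- u) + exp (- c * u\<^sup>2))"
    by (intro Bochner_Integration.integrable_add G G' integrable_gauss_real c)
  then show ?thesis
  proof (rule Bochner_Integration.integrable_bound)
    have "\<bar>u\<bar> powr (- a) * exp (- c * u\<^sup>2) \<le> G u + G (- u) + exp (- c * u\<^sup>2)" for u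
    proof (cases "\<bar>u\<bar> \<le> 1")
      case True
      have "\<bar>u\<bar> powr (- a) * exp (- c * u\<^sup>2) \<le> \<bar>u\<bar> powr (- a) * 1"
        using c by (intro mult_left_mono) auto
      also have "\<dots> \<le> G u + G (- u)"
        using True by (cases "0 \<le> u") (auto simp: G_def indicator_def)
      finally show ?thesis by (simp add: add_increasing2)
    next
      case False
      have "\<bar>u\<bar> powr (- a) \<le> \<bar>u\<bar> powr 0" using False a by (intro powr_mono) auto
      then have "\<bar>u\<bar> powr (- a) * exp (- c * u\<^sup>2) \<le> 1 * exp (- c * u\<^sup>2)"
        using False by (intro mult_right_mono) (auto split: if_splits)
      moreover have "0 \<le> G u + G (- u)" by (simp add: G_def)
      ultimately show ?thesis by linarith
    qed
    then show "AE u in lborel. norm (\<bar>u\<bar> powr (- a) * exp (- c * u\<^sup>2)) \<le> norm (G u + G (- u) + exp (- c * u\<^sup>2))"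
      by (intro AE_I2) (simp add: order_trans[OF _ abs_ge_self])
  qed measurable
qed

text \<open>The singularity is shared evenly among the coordinates:
  \<open>norm y powr (- \<sigma>)\<close> is at most the product of the
  \<open>\<bar>y \<bullet> b\<bar> powr (- a)\<close> with
  \<open>a = \<sigma> / DIM('a) < 1\<close>, which splits the integral into one-dimensional
  ones.\<close>

lemma integrable_powr_gauss:
  assumes \<sigma>: "0 \<le> \<sigma>" "\<sigma> < real DIM('a)" and c: "0 < c"
  shows "integrable lborel (\<lambda>y::'a::euclidean_space. norm y powr (- \<sigma>) * exp (- c * (norm y)\<^sup>2))"
proof (rule integrableI_nonneg)
  define a where "a = \<sigma> / real DIM('a)"
  have a: "0 \<le> a" "a < 1" using \<sigma> by (simp_all add: a_def divide_less_eq)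
  define f where "f u = \<bar>u\<bar> powr (- a) * exp (- c * u\<^sup>2)" for u :: real
  have [measurable]: "f \<in> borel_measurable borel" unfolding f_def by measurable
  have f0: "0 \<le> f u" for u by (simp add: f_def)
  \<comment> \<open>On a coordinate hyperplane the product on the right is 0, because
    \<open>0 powr (- a) = 0\<close>; the comparison therefore holds only almost everywhere.\<close>
  have "AE y::'a in lborel. \<forall>b\<in>Basis. b \<bullet> y \<noteq> 0"
    by (intro AE_ball_countable[THEN iffD2] ballI AE_hyperplane) (auto intro: countable_finite)
  then have "AE y::'a in lborel. ennreal (norm y powr (- \<sigma>) * exp (- c * (norm y)\<^sup>2)) \<le> (\<Prod>b\<in>Basis. ennreal (f (y \<bullet> b)))"
  proof eventually_elim
    case (elim y)
    have "y \<noteq> 0"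
    proof
      assume "y = 0"
      then show False using elim nonempty_Basis by (metis ex_in_conv inner_zero_right)
    qed
    have "norm y powr (- \<sigma>) = (\<Prod>b\<in>(Basis::'a set). norm y powr (- a))"
      using \<open>y \<noteq> 0\<close> by (simp add: powr_realpow[symmetric] powr_powr a_def)
    also have "\<dots> \<le> (\<Prod>b\<in>Basis. \<bar>y \<bullet> b\<bar> powr (- a))"
      using elim a by (intro prod_mono conjI powr_mono2' Basis_le_norm) (auto simp: inner_commute)
    finally have 1: "norm y powr (- \<sigma>) \<le> (\<Prod>b\<in>Basis. \<bar>y \<bullet> b\<bar> powr (- a))" .
    have "(norm y)\<^sup>2 = (\<Sum>b\<in>Basis. (y \<bullet> b)\<^sup>2)"
      unfolding power2_norm_eq_inner by (subst euclidean_inner) (simp add: power2_eq_square)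
    then have 2: "exp (- c * (norm y)\<^sup>2) = (\<Prod>b\<in>Basis. exp (- c * (y \<bullet> b)\<^sup>2))"
      by (simp add: exp_sum[symmetric] sum_distrib_left sum_negf)
    have "norm y powr (- \<sigma>) * exp (- c * (norm y)\<^sup>2) \<le> (\<Prod>b\<in>Basis. f (y \<bullet> b))"
      unfolding f_def prod.distrib 2[symmetric] by (rule mult_right_mono[OF 1]) simp
    then show ?case using f0 by (simp add: prod_ennreal ennreal_leI)
  qed
  then have "(\<integral>\<^sup>+y. ennreal (norm (y::'a) powr (- \<sigma>) * exp (- c * (norm y)\<^sup>2)) \<partial>lborel)
      \<le> (\<integral>\<^sup>+y. (\<Prod>b\<in>(Basis::'a set). ennreal (f (y \<bullet> b))) \<partial>lborel)"
    by (rule nn_integral_mono_AE)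
  also have "\<dots> = (\<Prod>b\<in>(Basis::'a set). (\<integral>\<^sup>+u. ennreal (f u) \<partial>lborel))"
    by (rule nn_integral_lborel_prod) simp_all
  also have "\<dots> < \<infinity>"
  proof -
    have "(\<integral>\<^sup>+u. ennreal (f u) \<partial>lborel) < \<infinity>"
      using integrable_powr_gauss_real[OF a c] f0 unfolding f_def[symmetric]
      by (simp add: integrable_iff_bounded)
    then show ?thesis by (simp add: power_less_top_ennreal)
  qed
  finally show "(\<integral>\<^sup>+y. ennreal (norm (y::'a) powr (- \<sigma>) * exp (- c * (norm y)\<^sup>2)) \<partial>lborel) < \<infinity>" .
qed auto

lemma integrable_gauss:
  assumes "0 < c" shows "integrable lborel (\<lambda>y::'a::euclidean_space. exp (- c * (norm y)\<^sup>2))"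
proof -
  obtain b :: 'a where "b \<in> Basis" using nonempty_Basis by blast
  then have "AE y in lborel. b \<bullet> y \<noteq> 0" by (intro AE_hyperplane) auto
  then have "AE y::'a in lborel. norm y powr (- 0) * exp (- c * (norm y)\<^sup>2) = exp (- c * (norm y)\<^sup>2)"
    by (rule eventually_mono) auto
  then show ?thesis
    using integrable_powr_gauss[of 0 c, where 'a = 'a] assms
    by (subst (asm) integrable_cong_AE) (auto intro: DIM_positive)
qed

text \<open>Completing the square, but with only half of the quadratic term, so that a Gaussian is
  left over.\<close>

lemma linear_minus_square_le:
  fixes u :: real
  assumes "0 < s" shows "a * u - s * u\<^sup>2 \<le> a\<^sup>2 / (2 * s) - s / 2 * u\<^sup>2"
proof -
  have "0 \<le> (s * u - a)\<^sup>2 / (2 * s)" using assms by simp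
  also have "\<dots> = s / 2 * u\<^sup>2 - a * u + a\<^sup>2 / (2 * s)"
    using assms by (simp add: power2_eq_square field_simps)
  finally show ?thesis by simp
qed

lemma exp_linear_minus_square_le:
  fixes u :: real
  assumes "0 < s"
  shows "exp (a * u) * exp (- s * u\<^sup>2) \<le> exp (a\<^sup>2 / (2 * s)) * exp (- (s / 2) * u\<^sup>2)"
  unfolding exp_add[symmetric] using linear_minus_square_le[OF assms, of a u] by simp

lemma integrable_exp_growth_gauss:
  fixes f :: "'a::euclidean_space \<Rightarrow> real"
  assumes [measurable]: "f \<in> borel_measurable borel" and f: "\<And>y. \<bar>f y\<bar> \<le> C * exp (a * norm y)" and s: "0 < s"
  shows "integrable lborel (\<lambda>y. f y * exp (- s * (norm y)\<^sup>2))"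
proof -
  have "integrable lborel (\<lambda>y::'a. C * exp (a\<^sup>2 / (2 * s)) * exp (- (s / 2) * (norm y)\<^sup>2))"
    using s by (intro integrable_mult_right integrable_gauss) simp
  then show ?thesis
  proof (rule Bochner_Integration.integrable_bound)
    have C: "0 \<le> C" using f[of 0] by simp
    have "norm (f y * exp (- s * (norm y)\<^sup>2)) \<le> norm (C * exp (a\<^sup>2 / (2 * s)) * exp (- (s / 2) * (norm y)\<^sup>2))" for y
    proof -
      have "norm (f y * exp (- s * (norm y)\<^sup>2)) \<le> C * (exp (a * norm y) * exp (- s * (norm y)\<^sup>2))"
        using mult_right_mono[OF f[of y], of "exp (- s * (norm y)\<^sup>2)"] by (simp add: abs_mult mult.assoc)
      also have "\<dots> \<le> C * (exp (a\<^sup>2 / (2 * s)) * exp (- (s / 2) * (norm y)\<^sup>2))"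
        by (intro mult_left_mono exp_linear_minus_square_le s C)
      finally show ?thesis using C by (simp add: abs_mult mult.assoc)
    qed
    then show "AE y in lborel. norm (f y * exp (- s * (norm y)\<^sup>2)) \<le> norm (C * exp (a\<^sup>2 / (2 * s)) * exp (- (s / 2) * (norm y)\<^sup>2))"
      by simp
  qed measurable
qed

section \<open>Integration against the Dunkl weight\<close>

text \<open>A class closed under sums and products, integrable against every Gaussian, and
  containing polynomials, the weight and the Dunkl kernel.\<close>

definition exp_growth :: "('a::real_normed_vector \<Rightarrow> real) \<Rightarrow> bool" where
  "exp_growth f \<longleftrightarrow> (\<exists>C a. \<forall>y. \<bar>f y\<bar> \<le> C * exp (a * norm y))"

lemma exp_growthI: "(\<And>y. \<bar>f y\<bar> \<le> C * exp (a * norm y)) \<Longrightarrow> exp_growth f"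
  unfolding exp_growth_def by blast

lemma exp_growth_const: "exp_growth (\<lambda>y. c)"
  by (rule exp_growthI[of _ "\<bar>c\<bar>" 0]) simp

lemma exp_growth_mono:
  fixes f g :: "'a::real_normed_vector \<Rightarrow> real"
  assumes "exp_growth g" "\<And>y. \<bar>f y\<bar> \<le> \<bar>g y\<bar>" shows "exp_growth f"
  using assms unfolding exp_growth_def by (meson order_trans)

lemma exp_growth_add:
  fixes f g :: "'a::real_normed_vector \<Rightarrow> real"
  assumes "exp_growth f" "exp_growth g" shows "exp_growth (\<lambda>y. f y + g y)"
proof -
  obtain C a where f: "\<And>y. \<bar>f y\<bar> \<le> C * exp (a * norm y)" using assms by (auto simp: exp_growth_def)
  obtain D b where g: "\<And>y. \<bar>g y\<bar> \<le> D * exp (b * norm y)" using assms by (auto simp: exp_growth_def)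
  have CD: "0 \<le> C" "0 \<le> D" using f[of 0] g[of 0] by auto
  show ?thesis
  proof (rule exp_growthI[of _ "C + D" "max a b"])
    fix y :: 'a
    have "C * exp (a * norm y) \<le> C * exp (max a b * norm y)" "D * exp (b * norm y) \<le> D * exp (max a b * norm y)"
      using CD by (auto intro!: mult_left_mono mult_right_mono)
    then show "\<bar>f y + g y\<bar> \<le> (C + D) * exp (max a b * norm y)"
      using f[of y] g[of y] unfolding distrib_right by linarith
  qed
qed

lemma exp_growth_mult:
  fixes f g :: "'a::real_normed_vector \<Rightarrow> real"
  assumes "exp_growth f" "exp_growth g" shows "exp_growth (\<lambda>y. f y * g y)"
proof -
  obtain C a where f: "\<And>y. \<bar>f y\<bar> \<le> C * exp (a * norm y)" using assms by (auto simp: exp_growth_def)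
  obtain D b where g: "\<And>y. \<bar>g y\<bar> \<le> D * exp (b * norm y)" using assms by (auto simp: exp_growth_def)
  show ?thesis
  proof (rule exp_growthI[of _ "C * D" "a + b"])
    fix y
    have "\<bar>f y\<bar> * \<bar>g y\<bar> \<le> (C * exp (a * norm y)) * (D * exp (b * norm y))"
      by (rule mult_mono[OF f g]) (use order_trans[OF abs_ge_zero f] in auto)
    then show "\<bar>f y * g y\<bar> \<le> C * D * exp ((a + b) * norm y)"
      by (simp only: abs_mult distrib_right exp_add) (simp only: mult_ac)
  qed
qed

lemma exp_growth_sum: "finite A \<Longrightarrow> (\<And>a. a \<in> A \<Longrightarrow> exp_growth (f a)) \<Longrightarrow> exp_growth (\<lambda>y. \<Sum>a\<in>A. f a y)"
  by (induction rule: finite_induct) (simp_all add: exp_growth_const exp_growth_add)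

lemma exp_growth_minus: "exp_growth f \<Longrightarrow> exp_growth (\<lambda>y. - f y)"
  by (erule exp_growth_mono) simp

lemma exp_growth_diff: "exp_growth f \<Longrightarrow> exp_growth g \<Longrightarrow> exp_growth (\<lambda>y. f y - g y)"
  using exp_growth_add[of f "\<lambda>y. - g y"] exp_growth_minus[of g] by simp

lemma exp_growth_abs: "exp_growth f \<Longrightarrow> exp_growth (\<lambda>y. \<bar>f y\<bar>)"
  by (erule exp_growth_mono) simp

lemma le_exp_self: "(u::real) \<le> exp u"
  using exp_ge_add_one_self[of u] by linarith

lemma exp_growth_inner: "exp_growth (\<lambda>y::'a::real_inner. y \<bullet> v)"
proof (rule exp_growthI[of _ "norm v" 1])
  fix y :: 'a
  have "\<bar>y \<bullet> v\<bar> \<le> norm v * norm y" using Cauchy_Schwarz_ineq2[of y v] by (simp add: mult.commute)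
  also have "\<dots> \<le> norm v * exp (1 * norm y)" using le_exp_self by (intro mult_left_mono) auto
  finally show "\<bar>y \<bullet> v\<bar> \<le> norm v * exp (1 * norm y)" .
qed

lemma exp_growth_ratio:
  fixes v :: "'a::real_inner"
  assumes "0 < \<epsilon>" shows "exp_growth (\<lambda>y. (v \<bullet> y) / ((v \<bullet> y)\<^sup>2 + \<epsilon>))"
proof -
  have "exp_growth (\<lambda>y. (y \<bullet> v) * (1 / \<epsilon>))"
    by (intro exp_growth_mult exp_growth_const exp_growth_inner)
  then show ?thesis
  proof (rule exp_growth_mono)
    fix y
    have "\<bar>v \<bullet> y\<bar> * (1 / ((v \<bullet> y)\<^sup>2 + \<epsilon>)) \<le> \<bar>v \<bullet> y\<bar> * (1 / \<epsilon>)"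
      using assms by (intro mult_left_mono frac_le) auto
    moreover have "\<bar>(v \<bullet> y)\<^sup>2 + \<epsilon>\<bar> = (v \<bullet> y)\<^sup>2 + \<epsilon>" using assms by (simp add: add_nonneg_pos)
    ultimately show "\<bar>(v \<bullet> y) / ((v \<bullet> y)\<^sup>2 + \<epsilon>)\<bar> \<le> \<bar>(y \<bullet> v) * (1 / \<epsilon>)\<bar>"
      using assms by (simp add: abs_mult inner_commute)
  qed
qed

lemma ratio_sq_bounds:
  fixes u :: real
  assumes "0 < \<epsilon>" shows "0 \<le> u\<^sup>2 / (u\<^sup>2 + \<epsilon>)" "u\<^sup>2 / (u\<^sup>2 + \<epsilon>) \<le> 1"
  using assms by (auto simp: divide_le_eq add_nonneg_pos)

lemma exp_growth_ratio_sq: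
  fixes v :: "'a::real_inner"
  assumes "0 < \<epsilon>" shows "exp_growth (\<lambda>y. (v \<bullet> y)\<^sup>2 / ((v \<bullet> y)\<^sup>2 + \<epsilon>))"
proof (rule exp_growth_mono[OF exp_growth_const[of 1]])
  fix y
  show "\<bar>(v \<bullet> y)\<^sup>2 / ((v \<bullet> y)\<^sup>2 + \<epsilon>)\<bar> \<le> \<bar>1\<bar>"
    using ratio_sq_bounds[OF assms, of "v \<bullet> y"] by (simp only: abs_of_nonneg abs_one)
qed

lemma integrable_exp_growth:
  fixes f :: "'a::euclidean_space \<Rightarrow> real"
  assumes "exp_growth f" "f \<in> borel_measurable borel" "0 < s"
  shows "integrable lborel (\<lambda>y. f y * exp (- s * (norm y)\<^sup>2))"
proof -
  obtain C a where "\<And>y. \<bar>f y\<bar> \<le> C * exp (a * norm y)" using assms by (auto simp: exp_growth_def)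
  then show ?thesis using integrable_exp_growth_gauss assms by blast
qed

context dunkl begin

abbreviation w :: "real ^ 'n \<Rightarrow> real" where "w \<equiv> dunkl_weight Rp k"

lemma w_nonneg: "0 \<le> w y"
  unfolding dunkl_weight_def by (intro prod_nonneg) auto

lemma w_measurable [measurable]: "w \<in> borel_measurable borel"
proof -
  have "(\<lambda>x. if k \<nu> = 0 then 1 else \<bar>\<nu> \<bullet> x\<bar> powr (2 * k \<nu>)) \<in> borel_measurable borel" for \<nu> :: "real ^ 'n"
    by (cases "k \<nu> = 0") simp_all
  then show ?thesis unfolding dunkl_weight_def by (intro borel_measurable_prod)
qed

lemma inner_reflection_eq: "\<mu> \<in> R \<Longrightarrow> \<nu> \<bullet> root_reflection \<mu> y = root_reflection \<mu> \<nu> \<bullet> y"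
  by (simp add: inner_reflection_left)

lemma w_reflection: "\<mu> \<in> R \<Longrightarrow> w (root_reflection \<mu> y) = w y"
proof -
  assume mu: "\<mu> \<in> R"
  let ?\<phi> = "\<lambda>\<nu>. if k \<nu> = 0 then 1 else \<bar>\<nu> \<bullet> y\<bar> powr (2 * k \<nu>)"
  have "w (root_reflection \<mu> y) = (\<Prod>\<nu>\<in>Rp. ?\<phi> (root_reflection \<mu> \<nu>))"
    unfolding dunkl_weight_def
    by (intro prod.cong refl) (simp only: inner_reflection_eq[OF mu] k_reflection[OF mu Rp_in_R])
  also have "\<dots> = w y"
    unfolding dunkl_weight_def by (rule prod_reflection[OF mu]) (simp add: k_minus)
  finally show ?thesis .
qed

lemma norm_root: "\<nu> \<in> R \<Longrightarrow> norm \<nu> = sqrt 2"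
  by (metis norm_root_sq norm_ge_zero real_sqrt_unique)

lemma inner_root_le: "\<nu> \<in> R \<Longrightarrow> \<bar>\<nu> \<bullet> y\<bar> \<le> sqrt 2 * norm y"
  using Cauchy_Schwarz_ineq2[of \<nu> y] by (simp add: norm_root)

text \<open>Each root has norm \<open>sqrt 2\<close>, and the exponents add up to
  \<open>2 * gam\<close>. At \<open>y = 0\<close> with all multiplicities 0 the weight is 1, but
  \<open>0 powr 0 = 0\<close>; hence the assumption on \<open>y\<close>.\<close>

lemma w_le_powr:
  assumes "y \<noteq> 0" shows "w y \<le> (sqrt 2 * norm y) powr (2 * gam)"
proof -
  have "w y \<le> (\<Prod>\<nu>\<in>Rp. (sqrt 2 * norm y) powr (2 * k \<nu>))"
    unfolding dunkl_weight_def using assms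
    by (intro prod_mono) (auto intro!: powr_mono2 inner_root_le simp: Rp_in_R k_nonneg)
  also have "\<dots> = (sqrt 2 * norm y) powr (2 * gam)"
    using assms finite_Rp by (simp add: powr_sum[symmetric] dunkl_gamma_def sum_distrib_left)
  finally show ?thesis .
qed

lemma w_exp_growth: "exp_growth w"
proof (rule exp_growthI[of _ 1 "2 * gam * sqrt 2"])
  fix y
  have f: "\<bar>\<nu> \<bullet> y\<bar> powr (2 * k \<nu>) \<le> exp (2 * k \<nu> * (sqrt 2 * norm y))" if "\<nu> \<in> Rp" for \<nu>
  proof (cases "\<nu> \<bullet> y = 0")
    case False
    have "ln \<bar>\<nu> \<bullet> y\<bar> \<le> \<bar>\<nu> \<bullet> y\<bar>" using False ln_le_minus_one[of "\<bar>\<nu> \<bullet> y\<bar>"] by simp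
    then have "ln \<bar>\<nu> \<bullet> y\<bar> \<le> sqrt 2 * norm y" using inner_root_le[OF Rp_in_R[OF that], of y] by linarith
    then show ?thesis using False k_nonneg[OF that] by (simp add: powr_def mult_left_mono)
  qed simp
  have "w y \<le> (\<Prod>\<nu>\<in>Rp. exp (2 * k \<nu> * (sqrt 2 * norm y)))"
    unfolding dunkl_weight_def using f
    by (intro prod_mono) (auto simp: k_nonneg)
  also have "\<dots> = exp (2 * gam * sqrt 2 * norm y)"
    using finite_Rp by (simp add: exp_sum[symmetric] dunkl_gamma_def sum_distrib_left sum_distrib_right mult.assoc)
  finally show "\<bar>w y\<bar> \<le> 1 * exp (2 * gam * sqrt 2 * norm y)" using w_nonneg[of y] by simp
qed

text \<open>A smooth approximation of the weight, whose own derivative is unbounded near the hyperplane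
  of \<open>\<nu>\<close> if \<open>0 < k \<nu> < 1/2\<close>.\<close>
definition weps :: "real \<Rightarrow> real ^ 'n \<Rightarrow> real" where
  "weps \<epsilon> y = exp (\<Sum>\<nu>\<in>Rp. k \<nu> * ln ((\<nu> \<bullet> y)\<^sup>2 + \<epsilon>))"

lemma weps_measurable [measurable]: "weps \<epsilon> \<in> borel_measurable borel"
  unfolding weps_def by measurable

lemma weps_reflection: "\<mu> \<in> R \<Longrightarrow> weps \<epsilon> (root_reflection \<mu> y) = weps \<epsilon> y"
proof -
  assume mu: "\<mu> \<in> R"
  let ?\<phi> = "\<lambda>\<nu>. k \<nu> * ln ((\<nu> \<bullet> y)\<^sup>2 + \<epsilon>)"
  have "(\<Sum>\<nu>\<in>Rp. k \<nu> * ln ((\<nu> \<bullet> root_reflection \<mu> y)\<^sup>2 + \<epsilon>)) = (\<Sum>\<nu>\<in>Rp. ?\<phi> (root_reflection \<mu> \<nu>))"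
    by (intro sum.cong refl) (simp only: inner_reflection_eq[OF mu] k_reflection[OF mu Rp_in_R])
  also have "\<dots> = (\<Sum>\<nu>\<in>Rp. ?\<phi> \<nu>)"
    by (rule sum_reflection[OF mu]) (simp add: k_minus)
  finally show ?thesis by (simp add: weps_def)
qed

text \<open>The bound is uniform in \<open>\<epsilon>\<close>, so it provides the dominating
  function for the limit \<open>\<epsilon>\<close> to 0.\<close>

lemma weps_le:
  assumes "0 < \<epsilon>" "\<epsilon> \<le> 1" shows "\<bar>weps \<epsilon> y\<bar> \<le> exp (2 * gam * norm y)"
proof -
  have "ln ((\<nu> \<bullet> y)\<^sup>2 + \<epsilon>) \<le> 2 * norm y" if "\<nu> \<in> Rp" for \<nu>
  proof -
    have "(\<nu> \<bullet> y)\<^sup>2 \<le> (sqrt 2 * norm y)\<^sup>2"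
      using inner_root_le[OF Rp_in_R[OF that], of y] by (metis abs_ge_zero power2_abs power_mono)
    then have "(\<nu> \<bullet> y)\<^sup>2 \<le> (2 * norm y)\<^sup>2 / 2" by (simp add: power_mult_distrib)
    then have "(\<nu> \<bullet> y)\<^sup>2 + \<epsilon> \<le> 1 + 2 * norm y + (2 * norm y)\<^sup>2 / 2"
      using assms norm_ge_zero[of y] by linarith
    also have "\<dots> \<le> exp (2 * norm y)" by (rule exp_lower_Taylor_quadratic) simp
    finally have "ln ((\<nu> \<bullet> y)\<^sup>2 + \<epsilon>) \<le> ln (exp (2 * norm y))"
      using assms by (subst ln_le_cancel_iff) (auto simp: add_nonneg_pos)
    then show ?thesis by simp
  qed
  then have "(\<Sum>\<nu>\<in>Rp. k \<nu> * ln ((\<nu> \<bullet> y)\<^sup>2 + \<epsilon>)) \<le> (\<Sum>\<nu>\<in>Rp. k \<nu> * (2 * norm y))"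
    by (intro sum_mono mult_left_mono k_nonneg) auto
  also have "\<dots> = 2 * gam * norm y" by (simp add: dunkl_gamma_def sum_distrib_right sum_distrib_left mult_ac)
  finally show ?thesis by (simp add: weps_def)
qed

lemma weps_exp_growth: "0 < \<epsilon> \<Longrightarrow> \<epsilon> \<le> 1 \<Longrightarrow> exp_growth (weps \<epsilon>)"
  by (rule exp_growthI[of _ 1 "2 * gam"]) (use weps_le in auto)

lemma AE_roots: "AE y in lborel. \<forall>\<nu>\<in>Rp. \<nu> \<bullet> y \<noteq> 0"
proof (intro AE_ball_countable[THEN iffD2] ballI AE_hyperplane)
  show "countable Rp" using finite_Rp by (rule countable_finite)
  fix \<nu> assume "\<nu> \<in> Rp"
  then show "\<nu> \<noteq> 0" using inner_root_self[OF Rp_in_R] by fastforce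
qed

lemma weps_tendsto:
  assumes y: "\<forall>\<nu>\<in>Rp. \<nu> \<bullet> y \<noteq> 0" and e: "e \<longlonglongrightarrow> 0"
  shows "(\<lambda>n. weps (e n) y) \<longlonglongrightarrow> w y"
proof -
  have "(\<lambda>n. weps (e n) y) \<longlonglongrightarrow> exp (\<Sum>\<nu>\<in>Rp. k \<nu> * ln ((\<nu> \<bullet> y)\<^sup>2 + 0))"
    unfolding weps_def using y by (intro tendsto_intros e) auto
  also have "exp (\<Sum>\<nu>\<in>Rp. k \<nu> * ln ((\<nu> \<bullet> y)\<^sup>2 + 0)) = w y"
    unfolding dunkl_weight_def exp_sum[OF finite_Rp]
  proof (rule prod.cong[OF refl])
    fix \<nu> assume "\<nu> \<in> Rp"
    then have n: "\<bar>\<nu> \<bullet> y\<bar> > 0" using y by simp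
    have "ln ((\<nu> \<bullet> y)\<^sup>2) = 2 * ln \<bar>\<nu> \<bullet> y\<bar>"
      using ln_realpow[of "\<bar>\<nu> \<bullet> y\<bar>" 2] by simp
    then show "exp (k \<nu> * ln ((\<nu> \<bullet> y)\<^sup>2 + 0)) = (if k \<nu> = 0 then 1 else \<bar>\<nu> \<bullet> y\<bar> powr (2 * k \<nu>))"
      using n by (simp add: powr_def)
  qed
  finally show ?thesis .
qed

lemma P_exp_growth: "p \<in> P \<Longrightarrow> exp_growth p"
  by (induction rule: P.induct) (simp_all add: exp_growth_const exp_growth_add exp_growth_mult exp_growth_inner)

lemma P_measurable: "p \<in> P \<Longrightarrow> p \<in> borel_measurable borel"
  by (intro borel_measurable_continuous_onI continuous_at_imp_continuous_on ballI
      differentiable_imp_continuous_within P_differentiable)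

section \<open>Integration by parts for Dunkl operators\<close>

lemma integral_reflection:
  fixes f :: "real ^ 'n \<Rightarrow> real"
  assumes "\<mu> \<in> R" "f \<in> borel_measurable borel"
  shows "(LINT y|lborel. f (root_reflection \<mu> y)) = (LINT y|lborel. f y)"
  by (rule integral_lborel_orthogonal[OF reflection_orthogonal[OF assms(1)] assms(2)])

lemma weps_derivative:
  assumes "0 < \<epsilon>"
  shows "((\<lambda>s. weps \<epsilon> (y + s *\<^sub>R \<xi>)) has_real_derivative weps \<epsilon> (y + s *\<^sub>R \<xi>) *
    (\<Sum>\<nu>\<in>Rp. k \<nu> * (2 * (\<nu> \<bullet> \<xi>) * (\<nu> \<bullet> (y + s *\<^sub>R \<xi>)) / ((\<nu> \<bullet> (y + s *\<^sub>R \<xi>))\<^sup>2 + \<epsilon>)))) (at s)"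
proof -
  have "((\<lambda>s. k \<nu> * ln ((\<nu> \<bullet> (y + s *\<^sub>R \<xi>))\<^sup>2 + \<epsilon>)) has_real_derivative
      k \<nu> * (2 * (\<nu> \<bullet> \<xi>) * (\<nu> \<bullet> (y + s *\<^sub>R \<xi>)) / ((\<nu> \<bullet> (y + s *\<^sub>R \<xi>))\<^sup>2 + \<epsilon>))) (at s)" for \<nu>
    unfolding inner_add_right inner_scaleR_right
    by (rule derivative_eq_intros refl | use assms in \<open>simp add: add_nonneg_pos\<close>)+
  then show ?thesis unfolding weps_def by (intro DERIV_fun_exp DERIV_sum)
qed

lemma gauss_derivative:
  fixes y \<xi> :: "real ^ 'n"
  shows "((\<lambda>u. exp (- s * (norm (y + u *\<^sub>R \<xi>))\<^sup>2)) has_real_derivative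
    exp (- s * (norm (y + u *\<^sub>R \<xi>))\<^sup>2) * (- (2 * s * ((y + u *\<^sub>R \<xi>) \<bullet> \<xi>)))) (at u)"
  unfolding power2_norm_eq_inner inner_add_left inner_add_right inner_scaleR_left inner_scaleR_right
  by (rule derivative_eq_intros refl)+ (simp add: inner_commute algebra_simps)

text \<open>Up to arrangement the integrand is the \<open>\<xi>\<close>-derivative of
  \<open>p y * weps \<epsilon> y * exp (- s * (norm y)\<^sup>2)\<close>; the sum over
  \<open>Rp\<close> is the logarithmic derivative of \<open>weps\<close>.\<close>

lemma integral_derivative_weps:
  assumes p: "p \<in> P" and e: "0 < \<epsilon>" "\<epsilon> \<le> 1" and s: "0 < s"
  shows "(LINT y|lborel. (dir_deriv \<xi> p y + p y * (\<Sum>\<nu>\<in>Rp. k \<nu> * (2 * (\<nu> \<bullet> \<xi>) * (\<nu> \<bullet> y) / ((\<nu> \<bullet> y)\<^sup>2 + \<epsilon>)))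
      - 2 * s * (y \<bullet> \<xi>) * p y) * weps \<epsilon> y * exp (- s * (norm y)\<^sup>2)) = 0"
proof -
  let ?D = "\<lambda>y. \<Sum>\<nu>\<in>Rp. k \<nu> * (2 * (\<nu> \<bullet> \<xi>) * (\<nu> \<bullet> y) / ((\<nu> \<bullet> y)\<^sup>2 + \<epsilon>))"
  let ?G = "\<lambda>y. (dir_deriv \<xi> p y + p y * ?D y - 2 * s * (y \<bullet> \<xi>) * p y) * weps \<epsilon> y"
  let ?g = "\<lambda>y. (p y * weps \<epsilon> y) * exp (- s * (norm y)\<^sup>2)"
  have pm[measurable]: "p \<in> borel_measurable borel" using p P_measurable by blast
  have growth_D: "exp_growth ?D"
  proof (intro exp_growth_sum finite_Rp)
    fix \<nu> :: "real ^ 'n"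
    have "exp_growth (\<lambda>y. (k \<nu> * (2 * (\<nu> \<bullet> \<xi>))) * ((\<nu> \<bullet> y) / ((\<nu> \<bullet> y)\<^sup>2 + \<epsilon>)))"
      by (intro exp_growth_mult[OF exp_growth_const] exp_growth_ratio e)
    then show "exp_growth (\<lambda>y. k \<nu> * (2 * (\<nu> \<bullet> \<xi>) * (\<nu> \<bullet> y) / ((\<nu> \<bullet> y)\<^sup>2 + \<epsilon>)))"
      by (simp add: mult.assoc)
  qed
  have "exp_growth ?G"
    by (intro exp_growth_mult exp_growth_diff exp_growth_add exp_growth_const exp_growth_inner growth_D
        weps_exp_growth P_exp_growth[OF p] P_exp_growth[OF dir_deriv_P[OF p]] e)
  then obtain C a where G: "\<And>y. \<bar>?G y\<bar> \<le> C * exp (a * norm y)" by (auto simp: exp_growth_def)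
  have C: "0 \<le> C" using G[of 0] by auto
  \<comment> \<open>The factor with \<open>a\<close> comes from absorbing the growth of
    \<open>?G\<close> into half of the Gaussian. The factor with \<open>\<xi>\<close> comes from
    comparing \<open>y\<close> with the shifted point by \<open>(norm y)\<^sup>2 \<le> 2 * (norm
    ?z)\<^sup>2 + 2 * (norm \<xi>)\<^sup>2\<close>, which leaves the rate
    \<open>s / 4\<close>.\<close>
  define K where "K = C * exp (a\<^sup>2 / (2 * s)) * exp (s / 2 * (norm \<xi>)\<^sup>2)"
  have "(LINT y|lborel. ?G y * exp (- s * (norm y)\<^sup>2)) = 0"
  proof (rule integral_lborel_derivative_zero[where g = ?g and \<xi> = \<xi> and B = "\<lambda>y. K * exp (- (s / 4) * (norm y)\<^sup>2)"])
    fix y u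
    have "((\<lambda>u. (p (y + u *\<^sub>R \<xi>) * weps \<epsilon> (y + u *\<^sub>R \<xi>)) * exp (- s * (norm (y + u *\<^sub>R \<xi>))\<^sup>2)) has_real_derivative
      (dir_deriv \<xi> p (y + u *\<^sub>R \<xi>) * weps \<epsilon> (y + u *\<^sub>R \<xi>) + weps \<epsilon> (y + u *\<^sub>R \<xi>) * ?D (y + u *\<^sub>R \<xi>) * p (y + u *\<^sub>R \<xi>))
        * exp (- s * (norm (y + u *\<^sub>R \<xi>))\<^sup>2)
      + exp (- s * (norm (y + u *\<^sub>R \<xi>))\<^sup>2) * (- (2 * s * ((y + u *\<^sub>R \<xi>) \<bullet> \<xi>))) * (p (y + u *\<^sub>R \<xi>) * weps \<epsilon> (y + u *\<^sub>R \<xi>))) (at u)"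
      by (intro DERIV_mult line_derivative P_differentiable p weps_derivative e gauss_derivative)
    then show "((\<lambda>u. ?g (y + u *\<^sub>R \<xi>)) has_real_derivative ?G (y + u *\<^sub>R \<xi>) * exp (- s * (norm (y + u *\<^sub>R \<xi>))\<^sup>2)) (at u)"
    proof (rule DERIV_cong)
      have "(d * W + W * D * q) * e + e * (- (2 * s * i)) * (q * W) = (d + q * D - 2 * s * i * q) * W * e"
        for d W D q e i :: real
        by (simp add: algebra_simps)
      then show "(dir_deriv \<xi> p (y + u *\<^sub>R \<xi>) * weps \<epsilon> (y + u *\<^sub>R \<xi>) + weps \<epsilon> (y + u *\<^sub>R \<xi>) * ?D (y + u *\<^sub>R \<xi>) * p (y + u *\<^sub>R \<xi>))
        * exp (- s * (norm (y + u *\<^sub>R \<xi>))\<^sup>2)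
        + exp (- s * (norm (y + u *\<^sub>R \<xi>))\<^sup>2) * (- (2 * s * ((y + u *\<^sub>R \<xi>) \<bullet> \<xi>))) * (p (y + u *\<^sub>R \<xi>) * weps \<epsilon> (y + u *\<^sub>R \<xi>))
        = ?G (y + u *\<^sub>R \<xi>) * exp (- s * (norm (y + u *\<^sub>R \<xi>))\<^sup>2)" .
    qed
  next
    show "integrable lborel ?g"
      by (rule integrable_exp_growth) (auto intro!: exp_growth_mult weps_exp_growth P_exp_growth[OF p] e s)
    show "integrable lborel (\<lambda>y::real ^ 'n. K * exp (- (s / 4) * (norm y)\<^sup>2))"
      using s by (intro integrable_mult_right integrable_gauss) simp
  next
    fix y u assume u: "0 \<le> u" "u \<le> (1::real)"
    let ?z = "y + u *\<^sub>R \<xi>"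
    have "norm y \<le> norm ?z + norm (u *\<^sub>R \<xi>)" by (metis add_diff_cancel_right' norm_triangle_ineq4)
    also have "\<dots> \<le> norm ?z + norm \<xi>" using u by (simp add: mult_left_le_one_le)
    finally have "(norm y)\<^sup>2 \<le> (norm ?z + norm \<xi>)\<^sup>2" by (intro power_mono) auto
    also have "\<dots> \<le> 2 * (norm ?z)\<^sup>2 + 2 * (norm \<xi>)\<^sup>2"
      using sum_squares_bound[of "norm ?z" "norm \<xi>"] by (simp add: power2_sum)
    finally have "s / 4 * (norm y)\<^sup>2 \<le> s / 4 * (2 * (norm ?z)\<^sup>2 + 2 * (norm \<xi>)\<^sup>2)"
      using s by (intro mult_left_mono) auto
    then have ex: "exp (- (s / 2) * (norm ?z)\<^sup>2) \<le> exp (s / 2 * (norm \<xi>)\<^sup>2) * exp (- (s / 4) * (norm y)\<^sup>2)"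
      unfolding exp_add[symmetric] by (simp add: algebra_simps)
    have "\<bar>?G ?z * exp (- s * (norm ?z)\<^sup>2)\<bar> \<le> C * (exp (a * norm ?z) * exp (- s * (norm ?z)\<^sup>2))"
      using mult_right_mono[OF G[of ?z], of "exp (- s * (norm ?z)\<^sup>2)"] by (simp add: abs_mult mult.assoc)
    also have "\<dots> \<le> C * (exp (a\<^sup>2 / (2 * s)) * exp (- (s / 2) * (norm ?z)\<^sup>2))"
      by (intro mult_left_mono exp_linear_minus_square_le s C)
    also have "\<dots> \<le> C * (exp (a\<^sup>2 / (2 * s)) * (exp (s / 2 * (norm \<xi>)\<^sup>2) * exp (- (s / 4) * (norm y)\<^sup>2)))"
      by (intro mult_left_mono ex C) simp
    finally show "\<bar>?G ?z * exp (- s * (norm ?z)\<^sup>2)\<bar> \<le> K * exp (- (s / 4) * (norm y)\<^sup>2)"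
      by (simp add: K_def mult.assoc)
  qed
  then show ?thesis .
qed

text \<open>The factor next to \<open>p\<close> is odd under the reflection in \<open>\<nu>\<close>,
  so only the odd part of \<open>p\<close> contributes, and that is half of
  \<open>(\<nu> \<bullet> y) * reflection_quotient \<nu> p y\<close>. The ratio that blows up near
  the hyperplane as \<open>\<epsilon>\<close> tends to 0 becomes one bounded by 1.\<close>

lemma integral_antisymmetrize:
  assumes p: "p \<in> P" and nu: "\<nu> \<in> R" and e: "0 < \<epsilon>" "\<epsilon> \<le> 1" and s: "0 < s"
  shows "(LINT y|lborel. p y * (2 * (\<nu> \<bullet> y) / ((\<nu> \<bullet> y)\<^sup>2 + \<epsilon>)) * weps \<epsilon> y * exp (- s * (norm y)\<^sup>2))
    = (LINT y|lborel. reflection_quotient \<nu> p y * ((\<nu> \<bullet> y)\<^sup>2 / ((\<nu> \<bullet> y)\<^sup>2 + \<epsilon>)) * weps \<epsilon> y * exp (- s * (norm y)\<^sup>2))"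
proof -
  define \<psi> where "\<psi> y = (\<nu> \<bullet> y) / ((\<nu> \<bullet> y)\<^sup>2 + \<epsilon>) * weps \<epsilon> y" for y
  have [measurable]: "p \<in> borel_measurable borel" "\<psi> \<in> borel_measurable borel"
    "(\<lambda>y. p (root_reflection \<nu> y)) \<in> borel_measurable borel"
    using p P_measurable P_comp_reflection[OF p nu] unfolding \<psi>_def by auto
  have \<psi>_growth: "exp_growth \<psi>"
    unfolding \<psi>_def by (intro exp_growth_mult exp_growth_ratio weps_exp_growth e)
  have \<psi>_odd: "\<psi> (root_reflection \<nu> y) = - \<psi> y" for y
    by (simp add: \<psi>_def inner_root_reflection nu weps_reflection)
  let ?e = "\<lambda>y. exp (- s * (norm y)\<^sup>2)"
  have i1: "integrable lborel (\<lambda>y. (p y * \<psi> y) * ?e y)"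
    by (rule integrable_exp_growth) (auto intro!: exp_growth_mult \<psi>_growth P_exp_growth[OF p] s)
  have i2: "integrable lborel (\<lambda>y. (p (root_reflection \<nu> y) * \<psi> y) * ?e y)"
    by (rule integrable_exp_growth)
      (auto intro!: exp_growth_mult \<psi>_growth P_exp_growth[OF P_comp_reflection[OF p nu]] s)
  have "(LINT y|lborel. (p y * \<psi> y) * ?e y) = (LINT y|lborel. (p (root_reflection \<nu> y) * \<psi> (root_reflection \<nu> y)) * ?e (root_reflection \<nu> y))"
    by (rule integral_reflection[OF nu, symmetric]) measurable
  also have "\<dots> = - (LINT y|lborel. (p (root_reflection \<nu> y) * \<psi> y) * ?e y)"
    by (simp add: \<psi>_odd norm_reflection nu)
  finally have "2 * (LINT y|lborel. (p y * \<psi> y) * ?e y)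
      = (LINT y|lborel. (p y * \<psi> y) * ?e y) - (LINT y|lborel. (p (root_reflection \<nu> y) * \<psi> y) * ?e y)"
    by simp
  also have "\<dots> = (LINT y|lborel. (p y * \<psi> y) * ?e y - (p (root_reflection \<nu> y) * \<psi> y) * ?e y)"
    by (rule Bochner_Integration.integral_diff[OF i1 i2, symmetric])
  also have "\<dots> = (LINT y|lborel. reflection_quotient \<nu> p y * ((\<nu> \<bullet> y)\<^sup>2 / ((\<nu> \<bullet> y)\<^sup>2 + \<epsilon>)) * weps \<epsilon> y * ?e y)"
  proof (rule Bochner_Integration.integral_cong[OF refl])
    fix y
    have "(p y * \<psi> y) * ?e y - (p (root_reflection \<nu> y) * \<psi> y) * ?e y = (p y - p (root_reflection \<nu> y)) * \<psi> y * ?e y"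
      by (simp only: left_diff_distrib)
    also have "\<dots> = (\<nu> \<bullet> y) * reflection_quotient \<nu> p y * \<psi> y * ?e y" by (simp only: quotient_mult[OF nu])
    finally show "(p y * \<psi> y) * ?e y - (p (root_reflection \<nu> y) * \<psi> y) * ?e y
      = reflection_quotient \<nu> p y * ((\<nu> \<bullet> y)\<^sup>2 / ((\<nu> \<bullet> y)\<^sup>2 + \<epsilon>)) * weps \<epsilon> y * ?e y"
      by (simp add: \<psi>_def power2_eq_square mult_ac)
  qed
  finally show ?thesis
    by (simp add: \<psi>_def mult_ac flip: integral_mult_right_zero)
qed

definition Lw :: "real \<Rightarrow> (real ^ 'n \<Rightarrow> real) \<Rightarrow> real" where
  "Lw s f = (LINT y|lborel. f y * w y * exp (- s * (norm y)\<^sup>2))"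

lemma Lw_integrable:
  assumes "exp_growth f" "f \<in> borel_measurable borel" "0 < s"
  shows "integrable lborel (\<lambda>y. f y * w y * exp (- s * (norm y)\<^sup>2))"
  by (rule integrable_exp_growth) (use assms in \<open>auto intro!: exp_growth_mult w_exp_growth\<close>)

text \<open>The logarithmic derivative of the weight supplies precisely the reflection part of
  \<open>T \<xi>\<close>. The identity is obtained for \<open>weps\<close> and passes to the limit
  by dominated convergence.\<close>

lemma Lw_T:
  assumes p: "p \<in> P" and s: "0 < s"
  shows "Lw s (T \<xi> p) = 2 * s * Lw s (\<lambda>y. (y \<bullet> \<xi>) * p y)"
proof -
  let ?e = "\<lambda>y. exp (- s * (norm y)\<^sup>2)"
  let ?q = "\<lambda>\<nu>. reflection_quotient \<nu> p"
  let ?\<theta> = "\<lambda>\<epsilon> \<nu> y. (\<nu> \<bullet> y)\<^sup>2 / ((\<nu> \<bullet> y)\<^sup>2 + \<epsilon>)"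
  \<comment> \<open>The integrand after antisymmetrization. Off the hyperplanes
    \<open>?\<theta>\<close> tends to 1, so \<open>H\<close> tends to
    \<open>T \<xi> p y - 2 * s * (y \<bullet> \<xi>) * p y\<close>; the function \<open>B\<close>
    dominates it for every positive \<open>\<epsilon>\<close>.\<close>
  define H where "H \<epsilon> y = (dir_deriv \<xi> p y + (\<Sum>\<nu>\<in>Rp. k \<nu> * (\<nu> \<bullet> \<xi>) * (?q \<nu> y * ?\<theta> \<epsilon> \<nu> y)) - 2 * s * (y \<bullet> \<xi>) * p y)" for \<epsilon> y
  define B where "B y = \<bar>dir_deriv \<xi> p y\<bar> + (\<Sum>\<nu>\<in>Rp. \<bar>k \<nu> * (\<nu> \<bullet> \<xi>)\<bar> * \<bar>?q \<nu> y\<bar>) + \<bar>2 * s * (y \<bullet> \<xi>) * p y\<bar>" for y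
  have dP: "dir_deriv \<xi> p \<in> P" using dir_deriv_P[OF p] by simp
  have qP: "?q \<nu> \<in> P" if "\<nu> \<in> Rp" for \<nu> using quotient_P[OF p Rp_in_R[OF that]] by simp
  have [measurable]: "p \<in> borel_measurable borel" "dir_deriv \<xi> p \<in> borel_measurable borel"
    using p dP P_measurable by auto
  have qm[measurable]: "?q \<nu> \<in> borel_measurable borel" if "\<nu> \<in> Rp" for \<nu> using qP[OF that] P_measurable by blast
  have Hm[measurable]: "H \<epsilon> \<in> borel_measurable borel" for \<epsilon>
  proof -
    have "(\<lambda>y. \<Sum>\<nu>\<in>Rp. k \<nu> * (\<nu> \<bullet> \<xi>) * (?q \<nu> y * ?\<theta> \<epsilon> \<nu> y)) \<in> borel_measurable borel"
    proof (rule borel_measurable_sum)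
      fix \<nu> assume "\<nu> \<in> Rp"
      note [measurable] = qm[OF this]
      show "(\<lambda>y. k \<nu> * (\<nu> \<bullet> \<xi>) * (?q \<nu> y * ?\<theta> \<epsilon> \<nu> y)) \<in> borel_measurable borel" by measurable
    qed
    note [measurable] = this
    show ?thesis unfolding H_def by measurable
  qed
  have Bm[measurable]: "B \<in> borel_measurable borel"
  proof -
    have "(\<lambda>y. \<Sum>\<nu>\<in>Rp. \<bar>k \<nu> * (\<nu> \<bullet> \<xi>)\<bar> * \<bar>?q \<nu> y\<bar>) \<in> borel_measurable borel"
    proof (rule borel_measurable_sum)
      fix \<nu> assume "\<nu> \<in> Rp"
      note [measurable] = qm[OF this]
      show "(\<lambda>y. \<bar>k \<nu> * (\<nu> \<bullet> \<xi>)\<bar> * \<bar>?q \<nu> y\<bar>) \<in> borel_measurable borel" by measurable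
    qed
    note [measurable] = this
    show ?thesis unfolding B_def by measurable
  qed
  have B_growth: "exp_growth B" unfolding B_def
    by (intro exp_growth_add exp_growth_sum exp_growth_mult exp_growth_abs exp_growth_const exp_growth_inner
        finite_Rp P_exp_growth p dP qP)
  have B0: "0 \<le> B y" for y unfolding B_def by (intro add_nonneg_nonneg sum_nonneg) auto
  have \<theta>: "0 \<le> ?\<theta> \<epsilon> \<nu> y" "?\<theta> \<epsilon> \<nu> y \<le> 1" if "0 < \<epsilon>" for \<epsilon> \<nu> y
    using ratio_sq_bounds[OF that] by auto
  have HB: "\<bar>H \<epsilon> y\<bar> \<le> B y" if "0 < \<epsilon>" for \<epsilon> y
  proof -
    have "\<bar>\<Sum>\<nu>\<in>Rp. k \<nu> * (\<nu> \<bullet> \<xi>) * (?q \<nu> y * ?\<theta> \<epsilon> \<nu> y)\<bar> \<le> (\<Sum>\<nu>\<in>Rp. \<bar>k \<nu> * (\<nu> \<bullet> \<xi>)\<bar> * \<bar>?q \<nu> y\<bar>)"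
    proof (rule order.trans[OF sum_abs sum_mono])
      fix \<nu> assume "\<nu> \<in> Rp"
      have "\<bar>?q \<nu> y\<bar> * ?\<theta> \<epsilon> \<nu> y \<le> \<bar>?q \<nu> y\<bar> * 1" by (intro mult_left_mono \<theta> that) auto
      then have "\<bar>k \<nu> * (\<nu> \<bullet> \<xi>)\<bar> * (\<bar>?q \<nu> y\<bar> * ?\<theta> \<epsilon> \<nu> y) \<le> \<bar>k \<nu> * (\<nu> \<bullet> \<xi>)\<bar> * \<bar>?q \<nu> y\<bar>"
        by (intro mult_left_mono) auto
      then show "\<bar>k \<nu> * (\<nu> \<bullet> \<xi>) * (?q \<nu> y * ?\<theta> \<epsilon> \<nu> y)\<bar> \<le> \<bar>k \<nu> * (\<nu> \<bullet> \<xi>)\<bar> * \<bar>?q \<nu> y\<bar>"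
        using \<theta>(1)[OF that, of \<nu> y] by (simp only: abs_mult abs_of_nonneg)
    qed
    then show ?thesis unfolding H_def B_def by linarith
  qed
  have zero: "(LINT y|lborel. H \<epsilon> y * weps \<epsilon> y * ?e y) = 0" if e: "0 < \<epsilon>" "\<epsilon> \<le> 1" for \<epsilon>
  proof -
    let ?E = "\<lambda>y. weps \<epsilon> y * ?e y"
    let ?A = "\<lambda>y. dir_deriv \<xi> p y - 2 * s * (y \<bullet> \<xi>) * p y"
    let ?X = "\<lambda>\<nu> y. p y * (2 * (\<nu> \<bullet> y) / ((\<nu> \<bullet> y)\<^sup>2 + \<epsilon>))"
    let ?Y = "\<lambda>\<nu> y. ?q \<nu> y * ?\<theta> \<epsilon> \<nu> y"
    have iA: "integrable lborel (\<lambda>y. ?A y * weps \<epsilon> y * ?e y)"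
      by (rule integrable_exp_growth) (auto intro!: exp_growth_mult exp_growth_diff exp_growth_const exp_growth_inner
          weps_exp_growth P_exp_growth[OF p] P_exp_growth[OF dP] e s)
    have iY: "integrable lborel (\<lambda>y. ?Y \<nu> y * weps \<epsilon> y * ?e y)" if nu: "\<nu> \<in> Rp" for \<nu>
    proof (rule integrable_exp_growth)
      note [measurable] = qm[OF nu]
      show "(\<lambda>y. ?Y \<nu> y * weps \<epsilon> y) \<in> borel_measurable borel" by measurable
      have "exp_growth (?Y \<nu>)" by (intro exp_growth_mult P_exp_growth qP nu exp_growth_ratio_sq e)
      from exp_growth_mult[OF this weps_exp_growth[OF e]]
      show "exp_growth (\<lambda>y. ?Y \<nu> y * weps \<epsilon> y)" .
    qed (rule s)
    have iX: "integrable lborel (\<lambda>y. ?X \<nu> y * weps \<epsilon> y * ?e y)" for \<nu>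
    proof (rule integrable_exp_growth)
      show "(\<lambda>y. ?X \<nu> y * weps \<epsilon> y) \<in> borel_measurable borel" by measurable
      have "exp_growth (\<lambda>y. p y * (2 * ((\<nu> \<bullet> y) / ((\<nu> \<bullet> y)\<^sup>2 + \<epsilon>))))"
        by (intro exp_growth_mult[OF P_exp_growth[OF p]] exp_growth_mult[OF exp_growth_const] exp_growth_ratio e)
      then have "exp_growth (?X \<nu>)" by simp
      from exp_growth_mult[OF this weps_exp_growth[OF e]]
      show "exp_growth (\<lambda>y. ?X \<nu> y * weps \<epsilon> y)" .
    qed (rule s)
    have lin: "(LINT y|lborel. A y + (\<Sum>\<nu>\<in>Rp. c \<nu> * X \<nu> y)) = (LINT y|lborel. A y) + (\<Sum>\<nu>\<in>Rp. c \<nu> * (LINT y|lborel. X \<nu> y))"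
      if "integrable lborel A" "\<And>\<nu>. \<nu> \<in> Rp \<Longrightarrow> integrable lborel (X \<nu>)"
      for A :: "real ^ 'n \<Rightarrow> real" and X c
      using that by (simp add: Bochner_Integration.integral_sum)
    have "0 = (LINT y|lborel. ?A y * weps \<epsilon> y * ?e y + (\<Sum>\<nu>\<in>Rp. (k \<nu> * (\<nu> \<bullet> \<xi>)) * (?X \<nu> y * weps \<epsilon> y * ?e y)))"
      unfolding integral_derivative_weps[OF p e s, of \<xi>, symmetric]
      by (rule Bochner_Integration.integral_cong[OF refl])
        (simp add: sum_distrib_left sum_distrib_right algebra_simps)
    also have "\<dots> = (LINT y|lborel. ?A y * weps \<epsilon> y * ?e y)
        + (\<Sum>\<nu>\<in>Rp. (k \<nu> * (\<nu> \<bullet> \<xi>)) * (LINT y|lborel. ?X \<nu> y * weps \<epsilon> y * ?e y))"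
      by (rule lin[OF iA iX])
    also have "\<dots> = (LINT y|lborel. ?A y * weps \<epsilon> y * ?e y)
        + (\<Sum>\<nu>\<in>Rp. (k \<nu> * (\<nu> \<bullet> \<xi>)) * (LINT y|lborel. ?Y \<nu> y * weps \<epsilon> y * ?e y))"
      using integral_antisymmetrize[OF p Rp_in_R e s] by simp
    also have "\<dots> = (LINT y|lborel. ?A y * weps \<epsilon> y * ?e y + (\<Sum>\<nu>\<in>Rp. (k \<nu> * (\<nu> \<bullet> \<xi>)) * (?Y \<nu> y * weps \<epsilon> y * ?e y)))"
      by (rule lin[OF iA iY, symmetric])
    also have "\<dots> = (LINT y|lborel. H \<epsilon> y * weps \<epsilon> y * ?e y)"
      by (rule Bochner_Integration.integral_cong[OF refl])
        (simp add: H_def sum_distrib_left sum_distrib_right algebra_simps)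
    finally show ?thesis by simp
  qed
  define \<epsilon> where "\<epsilon> n = 1 / real (Suc n)" for n
  have e: "0 < \<epsilon> n" "\<epsilon> n \<le> 1" for n by (simp_all add: \<epsilon>_def)
  have e0: "\<epsilon> \<longlonglongrightarrow> 0" unfolding \<epsilon>_def using LIMSEQ_inverse_real_of_nat by (simp add: inverse_eq_divide)
  have Tm[measurable]: "T \<xi> p \<in> borel_measurable borel" using T_P[OF p] P_measurable by blast
  have "(\<lambda>n. LINT y|lborel. H (\<epsilon> n) y * weps (\<epsilon> n) y * ?e y)
      \<longlonglongrightarrow> (LINT y|lborel. (T \<xi> p y - 2 * s * (y \<bullet> \<xi>) * p y) * w y * ?e y)"
  proof (rule integral_dominated_convergence[where w = "\<lambda>y. B y * exp (2 * gam * norm y) * ?e y"])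
    show "integrable lborel (\<lambda>y. B y * exp (2 * gam * norm y) * ?e y)"
      by (rule integrable_exp_growth)
        (auto intro!: exp_growth_mult B_growth s exp_growthI[of "\<lambda>y. exp (2 * gam * norm y)" 1 "2 * gam"])
    show "AE y in lborel. norm (H (\<epsilon> n) y * weps (\<epsilon> n) y * ?e y) \<le> B y * exp (2 * gam * norm y) * ?e y" for n
    proof (rule AE_I2)
      fix y
      have "\<bar>H (\<epsilon> n) y\<bar> * \<bar>weps (\<epsilon> n) y\<bar> \<le> B y * exp (2 * gam * norm y)"
        by (intro mult_mono HB weps_le e B0) auto
      then show "norm (H (\<epsilon> n) y * weps (\<epsilon> n) y * ?e y) \<le> B y * exp (2 * gam * norm y) * ?e y"
        by (simp add: abs_mult)
    qed
    show "AE y in lborel. (\<lambda>n. H (\<epsilon> n) y * weps (\<epsilon> n) y * ?e y) \<longlonglongrightarrow> (T \<xi> p y - 2 * s * (y \<bullet> \<xi>) * p y) * w y * ?e y"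
      using AE_roots
    proof eventually_elim
      case (elim y)
      have th: "(\<lambda>n. ?\<theta> (\<epsilon> n) \<nu> y) \<longlonglongrightarrow> 1" if "\<nu> \<in> Rp" for \<nu>
      proof -
        have "(\<lambda>n. ?\<theta> (\<epsilon> n) \<nu> y) \<longlonglongrightarrow> (\<nu> \<bullet> y)\<^sup>2 / ((\<nu> \<bullet> y)\<^sup>2 + 0)"
          using elim that by (intro tendsto_intros e0) auto
        then show ?thesis using elim that by simp
      qed
      have "(\<lambda>n. H (\<epsilon> n) y) \<longlonglongrightarrow> dir_deriv \<xi> p y + (\<Sum>\<nu>\<in>Rp. k \<nu> * (\<nu> \<bullet> \<xi>) * (?q \<nu> y * 1)) - 2 * s * (y \<bullet> \<xi>) * p y"
        unfolding H_def by (intro tendsto_intros th)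
      then have "(\<lambda>n. H (\<epsilon> n) y) \<longlonglongrightarrow> T \<xi> p y - 2 * s * (y \<bullet> \<xi>) * p y"
        by (simp add: dunkl_operator_def mult.assoc)
      then show ?case by (intro tendsto_mult weps_tendsto elim e0 tendsto_const)
    qed
  qed measurable
  then have "(LINT y|lborel. (T \<xi> p y - 2 * s * (y \<bullet> \<xi>) * p y) * w y * ?e y) = 0"
    using zero[OF e] by (simp add: LIMSEQ_const_iff)
  moreover have "(LINT y|lborel. (T \<xi> p y - 2 * s * (y \<bullet> \<xi>) * p y) * w y * ?e y)
      = Lw s (T \<xi> p) - 2 * s * Lw s (\<lambda>y. (y \<bullet> \<xi>) * p y)"
  proof -
    have i1: "integrable lborel (\<lambda>y. T \<xi> p y * w y * ?e y)"
      by (rule Lw_integrable) (auto intro!: P_exp_growth s simp: T_P[OF p, of \<xi>, simplified])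
    have i2: "integrable lborel (\<lambda>y. ((y \<bullet> \<xi>) * p y) * w y * ?e y)"
      by (rule Lw_integrable) (auto intro!: exp_growth_mult exp_growth_inner P_exp_growth[OF p] s)
    have "(LINT y|lborel. (T \<xi> p y - 2 * s * (y \<bullet> \<xi>) * p y) * w y * ?e y)
      = (LINT y|lborel. T \<xi> p y * w y * ?e y - 2 * s * (((y \<bullet> \<xi>) * p y) * w y * ?e y))"
      by (rule Bochner_Integration.integral_cong[OF refl]) (simp add: algebra_simps)
    also have "\<dots> = Lw s (T \<xi> p) - 2 * s * Lw s (\<lambda>y. (y \<bullet> \<xi>) * p y)"
      unfolding Lw_def using i1 i2 by simp
    finally show ?thesis .
  qed
  ultimately show ?thesis by simp
qed

section \<open>Gaussian integrals of the homogeneous components\<close>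

lemma Lw_reflection:
  assumes "p \<in> P" "\<mu> \<in> R"
  shows "Lw s (\<lambda>y. p (root_reflection \<mu> y)) = Lw s p"
proof -
  have [measurable]: "p \<in> borel_measurable borel" using assms P_measurable by blast
  have "Lw s p = (LINT y|lborel. p (root_reflection \<mu> y) * w (root_reflection \<mu> y) * exp (- s * (norm (root_reflection \<mu> y))\<^sup>2))"
    unfolding Lw_def by (rule integral_reflection[OF assms(2), symmetric]) measurable
  then show ?thesis by (simp add: Lw_def w_reflection assms norm_reflection)
qed

lemma P_Lw_integrable: "p \<in> P \<Longrightarrow> 0 < s \<Longrightarrow> integrable lborel (\<lambda>y. p y * w y * exp (- s * (norm y)\<^sup>2))"
  by (intro Lw_integrable P_exp_growth P_measurable)

text \<open>Integrate the Euler equation: the difference terms vanish because \<open>Lw\<close> is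
  invariant under reflections.\<close>

lemma Lw_dpoly_Suc:
  assumes s: "0 < s"
  shows "real (Suc n) * Lw s (\<lambda>y. dpoly (Suc n) y z) = Lw s (\<lambda>y. (y \<bullet> z) * dpoly n y z)"
proof -
  let ?p = "\<lambda>y. dpoly (Suc n) y z"
  let ?e = "\<lambda>y. w y * exp (- s * (norm y)\<^sup>2)"
  have i: "integrable lborel (\<lambda>y. ?p y * ?e y)" using P_Lw_integrable[OF dpoly_P s] by (simp add: mult.assoc del: dpoly.simps)
  have ir: "integrable lborel (\<lambda>y. ?p (root_reflection \<nu> y) * ?e y)" if "\<nu> \<in> Rp" for \<nu>
    using P_Lw_integrable[OF P_comp_reflection[OF dpoly_P Rp_in_R[OF that]] s] by (simp add: mult.assoc del: dpoly.simps)
  have "Lw s (\<lambda>y. (y \<bullet> z) * dpoly n y z)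
      = (LINT y|lborel. real (Suc n) * (?p y * ?e y)
          + (\<Sum>\<nu>\<in>Rp. k \<nu> * (?p y * ?e y - ?p (root_reflection \<nu> y) * ?e y)))"
    unfolding Lw_def dpoly_euler[symmetric]
    by (rule Bochner_Integration.integral_cong[OF refl])
      (simp add: distrib_right sum_distrib_right left_diff_distrib right_diff_distrib mult.assoc del: dpoly.simps)
  also have "\<dots> = real (Suc n) * (LINT y|lborel. ?p y * ?e y)
          + (\<Sum>\<nu>\<in>Rp. k \<nu> * ((LINT y|lborel. ?p y * ?e y) - (LINT y|lborel. ?p (root_reflection \<nu> y) * ?e y)))"
    using i ir by (simp add: Bochner_Integration.integral_add Bochner_Integration.integral_sum
        Bochner_Integration.integral_diff del: dpoly.simps of_nat_Suc)
  also have "(\<Sum>\<nu>\<in>Rp. k \<nu> * ((LINT y|lborel. ?p y * ?e y) - (LINT y|lborel. ?p (root_reflection \<nu> y) * ?e y))) = 0"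
  proof (rule sum.neutral, rule ballI)
    fix \<nu> assume "\<nu> \<in> Rp"
    then show "k \<nu> * ((LINT y|lborel. ?p y * ?e y) - (LINT y|lborel. ?p (root_reflection \<nu> y) * ?e y)) = 0"
      using Lw_reflection[OF dpoly_P, of \<nu> s "Suc n" z] by (simp add: Lw_def Rp_in_R mult.assoc del: dpoly.simps)
  qed
  finally show ?thesis by (simp add: Lw_def mult.assoc del: dpoly.simps)
qed

lemma Lw_dpoly_one: assumes "0 < s" shows "Lw s (\<lambda>y. dpoly (Suc 0) y z) = 0"
proof -
  have "T z (\<lambda>y. dpoly 0 y z) = (\<lambda>y. 0)" using T_const[of z 1] by (simp add: fun_eq_iff)
  then have "2 * s * Lw s (\<lambda>y. (y \<bullet> z) * dpoly 0 y z) = 0"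
    using Lw_T[OF dpoly_P assms, of z 0 z] by (simp add: Lw_def)
  then show ?thesis using Lw_dpoly_Suc[OF assms, of 0 z] assms by (simp del: dpoly.simps)
qed

text \<open>With \<open>\<xi> = z\<close>, integration by parts trades the factor
  \<open>y \<bullet> z\<close> for \<open>z \<bullet> z\<close> and lowers the degree, while
  \<open>Lw_dpoly_Suc\<close> introduces that factor. Together the two give a recursion in steps of
  2.\<close>

lemma Lw_dpoly_step:
  assumes s: "0 < s"
  shows "Lw s (\<lambda>y. dpoly (Suc (Suc n)) y z) = (norm z)\<^sup>2 / (2 * s * real (n + 2)) * Lw s (\<lambda>y. dpoly n y z)"
proof -
  have "T z (\<lambda>y. dpoly (Suc n) y z) = (\<lambda>y. (z \<bullet> z) * dpoly n y z)" using T_dpoly by (simp add: fun_eq_iff del: dpoly.simps)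
  then have "2 * s * Lw s (\<lambda>y. (y \<bullet> z) * dpoly (Suc n) y z) = (z \<bullet> z) * Lw s (\<lambda>y. dpoly n y z)"
    using Lw_T[OF dpoly_P s, of z "Suc n" z] by (simp add: Lw_def mult.assoc del: dpoly.simps)
  then have h: "2 * s * (real (n + 2) * Lw s (\<lambda>y. dpoly (Suc (Suc n)) y z)) = (norm z)\<^sup>2 * Lw s (\<lambda>y. dpoly n y z)"
    using Lw_dpoly_Suc[OF s, of "Suc n" z] by (simp add: power2_norm_eq_inner del: dpoly.simps)
  have nz: "2 * s * real (n + 2) \<noteq> 0" using s by simp
  show ?thesis
    unfolding times_divide_eq_left nonzero_eq_divide_eq[OF nz] using h by (simp only: mult_ac)
qed

lemma Lw_dpoly_even:
  assumes s: "0 < s"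
  shows "Lw s (\<lambda>y. dpoly (2 * n) y z) = ((norm z)\<^sup>2 / (4 * s)) ^ n / fact n * Lw s (\<lambda>y. 1)"
proof (induction n)
  case (Suc n)
  have "Lw s (\<lambda>y. dpoly (2 * Suc n) y z) = (norm z)\<^sup>2 / (2 * s * real (2 * n + 2)) * Lw s (\<lambda>y. dpoly (2 * n) y z)"
    using Lw_dpoly_step[OF s, of "2 * n" z] by (simp del: dpoly.simps)
  also have "\<dots> = ((norm z)\<^sup>2 / (4 * s)) ^ Suc n / fact (Suc n) * Lw s (\<lambda>y. 1)"
    unfolding Suc using s by (simp add: field_simps)
  finally show ?case .
qed simp

lemma Lw_dpoly_odd:
  assumes s: "0 < s" shows "Lw s (\<lambda>y. dpoly (Suc (2 * n)) y z) = 0"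
proof (induction n)
  case 0 then show ?case using Lw_dpoly_one[OF s] by (simp del: dpoly.simps)
next
  case (Suc n)
  then show ?case using Lw_dpoly_step[OF s, of "Suc (2 * n)" z] by (simp del: dpoly.simps)
qed

lemma dker_measurable [measurable]: "(\<lambda>y. dker y z) \<in> borel_measurable borel"
  by (intro borel_measurable_continuous_onI dker_continuous)

lemma dker_exp_growth: "exp_growth (\<lambda>y. dker y z)"
  by (rule exp_growthI[of _ 1 "norm z"]) (use dker_le_exp dker_nonneg in \<open>simp add: mult.commute\<close>)

lemma Lw_dker_integrable:
  "0 < s \<Longrightarrow> integrable lborel (\<lambda>y. dker y z * w y * exp (- s * (norm y)\<^sup>2))"
  by (intro Lw_integrable dker_exp_growth dker_measurable)

text \<open>The odd components integrate to 0, and the even ones are the terms of the exponential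
  series of \<open>(norm z)\<^sup>2 / (4 * s)\<close>. Summation under the integral is dominated by
  \<open>exp (norm z * norm y)\<close>.\<close>

lemma Lw_dker:
  assumes s: "0 < s"
  shows "Lw s (\<lambda>y. dker y z) = exp ((norm z)\<^sup>2 / (4 * s)) * Lw s (\<lambda>y. 1)"
proof -
  let ?e = "\<lambda>y. exp (- s * (norm y)\<^sup>2)"
  have pm[measurable]: "(\<lambda>y. dpoly n y z) \<in> borel_measurable borel" for n using dpoly_P P_measurable by blast
  have "(\<lambda>n. LINT y|lborel. (\<Sum>i<n. dpoly i y z) * w y * ?e y) \<longlonglongrightarrow> (LINT y|lborel. dker y z * w y * ?e y)"
  proof (rule integral_dominated_convergence[where w = "\<lambda>y. exp (norm z * norm y) * w y * ?e y"])
    show "integrable lborel (\<lambda>y. exp (norm z * norm y) * w y * ?e y)"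
      by (intro Lw_integrable s exp_growthI[of _ 1 "norm z"]) simp_all
    show "AE y in lborel. (\<lambda>n. (\<Sum>i<n. dpoly i y z) * w y * ?e y) \<longlonglongrightarrow> dker y z * w y * ?e y"
      using dpoly_sums unfolding sums_def by (intro AE_I2 tendsto_intros)
    show "AE y in lborel. norm ((\<Sum>i<n. dpoly i y z) * w y * ?e y) \<le> exp (norm z * norm y) * w y * ?e y" for n
    proof (rule AE_I2)
      fix y
      have "\<bar>\<Sum>i<n. dpoly i y z\<bar> \<le> (\<Sum>i<n. (norm y * norm z) ^ i / fact i)"
        by (rule order.trans[OF sum_abs sum_mono]) (rule dpoly_bound)
      also have "\<dots> \<le> (\<Sum>i. (norm y * norm z) ^ i / fact i)"
        by (rule sum_le_suminf[OF summable_exp_series]) auto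
      finally have "\<bar>\<Sum>i<n. dpoly i y z\<bar> \<le> exp (norm z * norm y)" by (simp add: exp_series_suminf mult.commute)
      then show "norm ((\<Sum>i<n. dpoly i y z) * w y * ?e y) \<le> exp (norm z * norm y) * w y * ?e y"
        using w_nonneg[of y] by (simp add: abs_mult mult_right_mono)
    qed
  qed measurable
  moreover have "(LINT y|lborel. (\<Sum>i<n. dpoly i y z) * w y * ?e y) = (\<Sum>i<n. Lw s (\<lambda>y. dpoly i y z))" for n
    unfolding Lw_def using P_Lw_integrable[OF dpoly_P s]
    by (simp add: sum_distrib_right Bochner_Integration.integral_sum)
  ultimately have sums: "(\<lambda>n. Lw s (\<lambda>y. dpoly n y z)) sums Lw s (\<lambda>y. dker y z)"
    by (simp add: sums_def Lw_def)
  have "(\<lambda>n. Lw s (\<lambda>y. dpoly (2 * n) y z)) sums Lw s (\<lambda>y. dker y z)"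
  proof (subst sums_mono_reindex[of "\<lambda>n. 2 * n" "\<lambda>n. Lw s (\<lambda>y. dpoly n y z)"])
    show "strict_mono (\<lambda>n::nat. 2 * n)" by (simp add: strict_mono_def)
    fix n :: nat assume "n \<notin> range ((*) 2)"
    then have "odd n" by (auto elim!: evenE)
    then obtain m where "n = Suc (2 * m)" by (auto elim!: oddE)
    then show "Lw s (\<lambda>y. dpoly n y z) = 0" using Lw_dpoly_odd[OF s] by simp
  qed (rule sums)
  moreover have "(\<lambda>n. Lw s (\<lambda>y. dpoly (2 * n) y z)) sums (exp ((norm z)\<^sup>2 / (4 * s)) * Lw s (\<lambda>y. 1))"
    unfolding Lw_dpoly_even[OF s] exp_series_suminf[symmetric]
    by (intro sums_mult2 summable_sums summable_exp_series)
  ultimately show ?thesis using sums_unique2 by blast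
qed

end

section \<open>The heat kernel\<close>

lemma powr_le_exp: "0 \<le> u \<Longrightarrow> 0 \<le> p \<Longrightarrow> u powr p \<le> exp (p * u)" for u p :: real
proof (cases "u = 0")
  case False
  assume u: "0 \<le> u" "0 \<le> p"
  then have "ln u \<le> u" using False ln_le_minus_one[of u] by simp
  then show ?thesis using u False by (simp add: powr_def mult_left_mono)
qed simp

text \<open>A form of Hoelder's inequality: Young's inequality is applied after dividing
  \<open>a\<close> by its norm, which leaves the factor \<open>1 / r + Q / r'\<close> in place of
  \<open>Q powr (1 / r')\<close>. A function \<open>a\<close> of norm 0 has to be treated
  separately.\<close>

lemma young_integral:
  fixes a b :: "'a \<Rightarrow> real"
  assumes [measurable]: "a \<in> borel_measurable M" "b \<in> borel_measurable M"
    and nn: "\<And>y. 0 \<le> a y" "\<And>y. 0 \<le> b y"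
    and r: "1 < r" "1 < r'" "1 / r + 1 / r' = 1"
    and ia: "integrable M (\<lambda>y. a y powr r)" and ib: "integrable M (\<lambda>y. b y powr r')"
    and Q: "(LINT y|M. b y powr r') \<le> Q"
  shows "integrable M (\<lambda>y. a y * b y)"
    and "(LINT y|M. a y * b y) \<le> (LINT y|M. a y powr r) powr (1 / r) * (1 / r + Q / r')"
proof -
  have young: "a y * b y \<le> a y powr r / r + b y powr r' / r'" for y
    by (rule Youngs_inequality) (use r nn in auto)
  have "integrable M (\<lambda>y. a y powr r / r + b y powr r' / r')" using ia ib by simp
  then show int: "integrable M (\<lambda>y. a y * b y)"
    by (rule Bochner_Integration.integrable_bound) (use young nn in \<open>auto intro!: AE_I2 order_trans[OF _ abs_ge_self]\<close>)
  define I where "I = (LINT y|M. a y powr r)"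
  have I0: "0 \<le> I" unfolding I_def by simp
  show "(LINT y|M. a y * b y) \<le> (LINT y|M. a y powr r) powr (1 / r) * (1 / r + Q / r')"
  proof (cases "I = 0")
    case True
    then have "AE y in M. a y powr r = 0"
      using integral_nonneg_eq_0_iff_AE[OF ia] by (simp add: I_def)
    then have "AE y in M. a y * b y = 0" by (rule eventually_mono) simp
    then have "(LINT y|M. a y * b y) = 0" by (rule integral_eq_zero_AE)
    then show ?thesis using True by (simp add: I_def)
  next
    case False
    define N where "N = I powr (1 / r)"
    have N: "0 < N" "N powr r = I" using False I0 r by (auto simp: N_def powr_powr)
    have le: "a y * b y \<le> N * (a y powr r / I / r + b y powr r' / r')" for y
    proof -
      have "(a y / N) * b y \<le> (a y / N) powr r / r + b y powr r' / r'"
        by (rule Youngs_inequality) (use r nn N in auto)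
      moreover have "(a y / N) powr r = a y powr r / I" using nn N by (simp add: powr_divide)
      ultimately have "N * ((a y / N) * b y) \<le> N * (a y powr r / I / r + b y powr r' / r')"
        using N by (intro mult_left_mono) auto
      then show ?thesis using N by simp
    qed
    have "(LINT y|M. a y * b y) \<le> (LINT y|M. N * (a y powr r / I / r + b y powr r' / r'))"
      by (rule integral_mono[OF int _ le]) (use ia ib in simp)
    also have "\<dots> = N * (I / I / r + (LINT y|M. b y powr r') / r')"
      using ia ib by (simp add: I_def)
    also have "\<dots> \<le> N * (1 / r + Q / r')"
      using N False Q r by (intro mult_left_mono add_mono divide_right_mono) auto
    finally show ?thesis by (simp add: N_def I_def)
  qed
qed

context dunkl begin

text \<open>The heat kernel without its normalizing power, in the variable
  \<open>s = 1 / (4 * t)\<close>. For \<open>k = 0\<close> it is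
  \<open>exp (- s * (norm (x - y))\<^sup>2)\<close>.\<close>

definition hk :: "real \<Rightarrow> real ^ 'n \<Rightarrow> real ^ 'n \<Rightarrow> real" where
  "hk s x y = exp (- s * ((norm x)\<^sup>2 + (norm y)\<^sup>2)) * dker ((2 * s) *\<^sub>R x) y"

lemma dunkl_heat_kernel_eq:
  assumes t: "0 < t"
  shows "dunkl_heat_kernel Rp k t x y = (2 * t) powr (- dunkl_dim Rp k / 2) * hk (1 / (4 * t)) x y"
proof -
  have "dker ((1 / sqrt (2 * t)) *\<^sub>R x) ((1 / sqrt (2 * t)) *\<^sub>R y) = dker ((1 / (2 * t)) *\<^sub>R x) y"
    using t by (subst dker_scale[symmetric]) simp
  then show ?thesis
    by (simp add: dunkl_heat_kernel_def hk_def dunkl_kernel_eq add_divide_distrib diff_divide_distrib)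
qed

lemma hk_nonneg: "0 \<le> hk s x y"
  by (simp add: hk_def dker_nonneg)

lemma hk_le: assumes "0 < s" shows "hk s x y \<le> exp (- s * (norm x - norm y)\<^sup>2)"
proof -
  have "hk s x y \<le> exp (- s * ((norm x)\<^sup>2 + (norm y)\<^sup>2)) * exp (norm ((2 * s) *\<^sub>R x) * norm y)"
    unfolding hk_def by (intro mult_left_mono dker_le_exp) simp
  also have "\<dots> = exp (- s * (norm x - norm y)\<^sup>2)"
    unfolding exp_add[symmetric] using assms by (simp add: power2_eq_square algebra_simps)
  finally show ?thesis .
qed

lemma hk_le_1: "0 < s \<Longrightarrow> hk s x y \<le> 1"
  by (rule order_trans[OF hk_le]) auto

lemma hk_measurable [measurable]: "hk s x \<in> borel_measurable borel"
  unfolding hk_def by (subst dker_commute) measurable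

text \<open>\<open>Lw_dker\<close> at \<open>z = 2 * s * x\<close> yields the factor
  \<open>exp (s * (norm x)\<^sup>2)\<close>, which cancels the Gaussian in \<open>x\<close>; so the
  mass does not depend on \<open>x\<close>.\<close>

lemma hk_mass:
  assumes s: "0 < s"
  shows "integrable lborel (\<lambda>y. w y * hk s x y)" "(LINT y|lborel. w y * hk s x y) = Lw s (\<lambda>y. 1)"
proof -
  have e: "w y * hk s x y = exp (- s * (norm x)\<^sup>2) * (dker y ((2 * s) *\<^sub>R x) * w y * exp (- s * (norm y)\<^sup>2))" for y
    by (simp only: hk_def dker_commute[of y] distrib_left exp_add mult_ac)
  show "integrable lborel (\<lambda>y. w y * hk s x y)"
    unfolding e by (intro integrable_mult_right Lw_dker_integrable s)
  have "(LINT y|lborel. w y * hk s x y) = exp (- s * (norm x)\<^sup>2) * Lw s (\<lambda>y. dker y ((2 * s) *\<^sub>R x))"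
    unfolding e Lw_def by simp
  also have "\<dots> = exp (- s * (norm x)\<^sup>2) * (exp (s * (norm x)\<^sup>2) * Lw s (\<lambda>y. 1))"
    using s by (simp add: Lw_dker power_mult_distrib power2_eq_square)
  finally show "(LINT y|lborel. w y * hk s x y) = Lw s (\<lambda>y. 1)"
    by (simp add: mult.assoc[symmetric] exp_add[symmetric])
qed

text \<open>By the mean value theorem a factor \<open>sqrt s * norm z\<close> appears; half of the
  exponent absorbs it. Returning from the intermediate point \<open>z\<close> to \<open>q\<close>
  halves the rate once more and costs \<open>exp (s / 2)\<close>, whence \<open>s / 4\<close>. The
  number \<open>m\<close> later stands for
  \<open>(norm y)\<^sup>2 - (norm z)\<^sup>2\<close>.\<close>

lemma gauss_shift_difference:
  fixes q v :: "'a::real_inner"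
  assumes s: "0 < s" and v: "norm v \<le> 1" and m: "0 \<le> m"
  shows "\<bar>exp (- s * ((norm (q + v))\<^sup>2 + m)) - exp (- s * ((norm q)\<^sup>2 + m))\<bar>
    \<le> 2 * sqrt s * exp (s / 2) * norm v * exp (- (s / 4) * ((norm q)\<^sup>2 + m))"
proof -
  define \<phi> where "\<phi> u = exp (- s * ((norm (q + u *\<^sub>R v))\<^sup>2 + m))" for u
  have d: "(\<phi> has_real_derivative \<phi> u * (- (2 * s * ((q + u *\<^sub>R v) \<bullet> v)))) (at u)" for u
    unfolding \<phi>_def power2_norm_eq_inner inner_add_left inner_add_right inner_scaleR_left inner_scaleR_right
    by (rule derivative_eq_intros refl)+ (simp add: inner_commute algebra_simps)
  obtain u where u: "0 < u" "u < 1" "\<phi> 1 - \<phi> 0 = (1 - 0) * (\<phi> u * (- (2 * s * ((q + u *\<^sub>R v) \<bullet> v))))"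
    using MVT2[of 0 1 \<phi> "\<lambda>u. \<phi> u * (- (2 * s * ((q + u *\<^sub>R v) \<bullet> v)))"] d by auto
  define z where "z = q + u *\<^sub>R v"
  have "\<bar>\<phi> 1 - \<phi> 0\<bar> = \<phi> u * (2 * s * \<bar>z \<bullet> v\<bar>)"
    using u(3) s by (simp add: abs_mult z_def \<phi>_def)
  also have "\<dots> \<le> \<phi> u * (2 * s * (norm z * norm v))"
    using s by (intro mult_left_mono Cauchy_Schwarz_ineq2) (auto simp: \<phi>_def)
  also have "\<dots> = 2 * sqrt s * norm v * (sqrt s * norm z) * \<phi> u"
  proof -
    have "2 * sqrt s * norm v * (sqrt s * norm z) * \<phi> u = \<phi> u * (2 * (sqrt s * sqrt s) * (norm z * norm v))"
      by (simp only: mult_ac)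
    then show ?thesis using s by simp
  qed
  also have "\<dots> \<le> 2 * sqrt s * norm v * exp (s / 2 * (norm z)\<^sup>2) * \<phi> u"
  proof (intro mult_right_mono mult_left_mono)
    let ?u = "sqrt s * norm z"
    have "?u \<le> 1 + ?u\<^sup>2 / 2"
      using sum_squares_bound[of ?u 1] by simp
    also have "\<dots> \<le> exp (?u\<^sup>2 / 2)" by (rule exp_ge_add_one_self)
    finally show "?u \<le> exp (s / 2 * (norm z)\<^sup>2)" using s by (simp add: power_mult_distrib)
  qed (use s in \<open>auto simp: \<phi>_def\<close>)
  also have "\<dots> = 2 * sqrt s * norm v * exp (- (s / 2) * (norm z)\<^sup>2 - s * m)"
    by (simp add: \<phi>_def z_def[symmetric] mult.assoc exp_add[symmetric]) (simp add: algebra_simps)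
  also have "\<dots> \<le> 2 * sqrt s * norm v * exp (s / 2 - (s / 4) * ((norm q)\<^sup>2 + m))"
  proof (rule mult_left_mono)
    have "norm q \<le> norm z + norm (u *\<^sub>R v)" unfolding z_def by (metis add_diff_cancel_right' norm_triangle_ineq4)
    also have "norm (u *\<^sub>R v) \<le> 1" using u v mult_mono[of u 1 "norm v" 1] by simp
    finally have "(norm q)\<^sup>2 \<le> (norm z + 1)\<^sup>2" by (intro power_mono) auto
    also have "\<dots> \<le> 2 * (norm z)\<^sup>2 + 2"
      using sum_squares_bound[of "norm z" 1] by (simp add: power2_sum)
    finally have "s * (norm q)\<^sup>2 \<le> s * (2 * (norm z)\<^sup>2 + 2)" using s by (intro mult_left_mono) auto
    then have "s * (norm q)\<^sup>2 \<le> 2 * (s * (norm z)\<^sup>2) + 2 * s" by (simp add: distrib_left)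
    moreover have "0 \<le> s * m" using s m by simp
    moreover have "(s / 4) * ((norm q)\<^sup>2 + m) = (s * (norm q)\<^sup>2) / 4 + (s * m) / 4"
      "- (s / 2) * (norm z)\<^sup>2 = - (s * (norm z)\<^sup>2) / 2"
      by (simp_all add: distrib_left)
    ultimately have "- (s / 2) * (norm z)\<^sup>2 - s * m \<le> s / 2 - (s / 4) * ((norm q)\<^sup>2 + m)"
      by linarith
    then show "exp (- (s / 2) * (norm z)\<^sup>2 - s * m) \<le> exp (s / 2 - (s / 4) * ((norm q)\<^sup>2 + m))"
      by simp
  qed (use s in auto)
  also have "\<dots> = 2 * sqrt s * exp (s / 2) * norm v * exp (- (s / 4) * ((norm q)\<^sup>2 + m))"
  proof -
    have "exp (s / 2 - (s / 4) * ((norm q)\<^sup>2 + m)) = exp (s / 2) * exp (- (s / 4) * ((norm q)\<^sup>2 + m))"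
      unfolding exp_add[symmetric] by simp
    then show ?thesis by (simp only: mult_ac)
  qed
  finally show ?thesis by (simp add: \<phi>_def)
qed

text \<open>By positivity of \<open>dker\<close>, the estimate reduces to the elementary Gaussian estimate
  obtained by replacing \<open>dker x y\<close> with \<open>exp (x \<bullet> z)\<close>, for every \<open>z\<close> with \<open>norm z \<le> norm y\<close>.\<close>
lemma hk_shift_difference:
  assumes s: "0 < s" and v: "norm v \<le> 1"
  shows "\<bar>hk s (x + v) y - hk s x y\<bar> \<le> 2 * sqrt s * exp (s / 2) * norm v * hk (s / 4) x y"
proof -
  define K where "K = 2 * sqrt s * exp (s / 2) * norm v"
  \<comment> \<open>Completing the square: with the exponential in place of \<open>dker\<close>, the
    kernel is a Gaussian centred at \<open>z\<close>, damped by a factor that is at most 1 when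
    \<open>norm z \<le> norm y\<close>.\<close>
  have ex: "exp (- s' * ((norm x')\<^sup>2 + (norm y)\<^sup>2)) * exp (z \<bullet> ((2 * s') *\<^sub>R x'))
      = exp (- s' * ((norm (x' - z))\<^sup>2 + ((norm y)\<^sup>2 - (norm z)\<^sup>2)))" for s' x' z
    unfolding exp_add[symmetric] power2_norm_eq_inner
    by (simp add: inner_diff_left inner_diff_right inner_commute algebra_simps)
  \<comment> \<open>The two signs \<open>\<theta> = 1\<close> and \<open>\<theta> = - 1\<close>
    together give the absolute value.\<close>
  have pos: "0 \<le> K * hk (s / 4) x y + \<theta> * hk s (x + v) y - \<theta> * hk s x y" if th: "\<bar>\<theta>\<bar> = 1" for \<theta>
  proof -
    let ?c = "\<lambda>j::nat. if j = 0 then K * exp (- (s / 4) * ((norm x)\<^sup>2 + (norm y)\<^sup>2))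
      else if j = 1 then \<theta> * exp (- s * ((norm (x + v))\<^sup>2 + (norm y)\<^sup>2))
      else - \<theta> * exp (- s * ((norm x)\<^sup>2 + (norm y)\<^sup>2))"
    let ?x = "\<lambda>j::nat. if j = 0 then (2 * (s / 4)) *\<^sub>R x else if j = 1 then (2 * s) *\<^sub>R (x + v) else (2 * s) *\<^sub>R x"
    have "0 \<le> (\<Sum>j\<in>{0, 1, 2}. ?c j * dker (?x j) y)"
    proof (rule dker_positivity)
      fix z :: "real ^ 'n" assume z: "norm z \<le> norm y"
      let ?m = "(norm y)\<^sup>2 - (norm z)\<^sup>2"
      have m: "0 \<le> ?m" using z by (simp add: power_mono)
      have e0: "exp (- (s / 4) * ((norm x)\<^sup>2 + (norm y)\<^sup>2)) * exp (z \<bullet> ((2 * (s / 4)) *\<^sub>R x)) = exp (- (s / 4) * ((norm (x - z))\<^sup>2 + ?m))"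
        by (rule ex)
      have e1: "exp (- s * ((norm (x + v))\<^sup>2 + (norm y)\<^sup>2)) * exp (z \<bullet> ((2 * s) *\<^sub>R (x + v))) = exp (- s * ((norm (x - z + v))\<^sup>2 + ?m))"
        unfolding ex by (simp add: algebra_simps)
      have e2: "exp (- s * ((norm x)\<^sup>2 + (norm y)\<^sup>2)) * exp (z \<bullet> ((2 * s) *\<^sub>R x)) = exp (- s * ((norm (x - z))\<^sup>2 + ?m))"
        by (rule ex)
      have d: "\<bar>exp (- s * ((norm (x - z + v))\<^sup>2 + ?m)) - exp (- s * ((norm (x - z))\<^sup>2 + ?m))\<bar>
          \<le> K * exp (- (s / 4) * ((norm (x - z))\<^sup>2 + ?m))"
        unfolding K_def by (rule gauss_shift_difference[OF s v m])
      have "(\<Sum>j\<in>{0, 1, 2}. ?c j * exp (z \<bullet> ?x j)) = K * exp (- (s / 4) * ((norm (x - z))\<^sup>2 + ?m))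
          + \<theta> * (exp (- s * ((norm (x - z + v))\<^sup>2 + ?m)) - exp (- s * ((norm (x - z))\<^sup>2 + ?m)))"
        unfolding e0[symmetric] e1[symmetric] e2[symmetric] by (simp add: right_diff_distrib mult.assoc)
      moreover have "- \<bar>exp (- s * ((norm (x - z + v))\<^sup>2 + ?m)) - exp (- s * ((norm (x - z))\<^sup>2 + ?m))\<bar>
          \<le> \<theta> * (exp (- s * ((norm (x - z + v))\<^sup>2 + ?m)) - exp (- s * ((norm (x - z))\<^sup>2 + ?m)))"
      proof -
        have "- \<bar>D\<bar> \<le> \<theta> * D" for D
          using abs_ge_minus_self[of "\<theta> * D"] abs_mult[of \<theta> D] th by simp
        then show ?thesis .
      qed
      ultimately show "0 \<le> (\<Sum>j\<in>{0, 1, 2}. ?c j * exp (z \<bullet> ?x j))" using d by linarith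
    qed simp
    then show ?thesis by (simp add: hk_def mult.assoc)
  qed
  show ?thesis using pos[of 1] pos[of "-1"] unfolding K_def by simp
qed

lemma hk_differentiable: "(\<lambda>x. hk s x y) differentiable (at x)"
proof -
  have "(\<lambda>x::real ^ 'n. exp (- s * ((norm x)\<^sup>2 + (norm y)\<^sup>2))) differentiable (at x)"
    unfolding power2_norm_eq_inner
    by (rule differentiableI) (rule derivative_eq_intros refl)+
  moreover have "(\<lambda>x. dker ((2 * s) *\<^sub>R x) y) differentiable (at x)"
    using differentiable_chain_at[of "\<lambda>x. (2 * s) *\<^sub>R x" x "\<lambda>x. dker x y"] dker_differentiable
    by (simp add: o_def linear_imp_differentiable linear_scaleR)
  ultimately show ?thesis unfolding hk_def by (rule differentiable_mult)
qed

section \<open>The weighted measure and the singularity at the origin\<close>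

abbreviation Mw :: "(real ^ 'n) measure" where "Mw \<equiv> weighted_measure w"

lemma w_measurable_lebesgue [measurable]: "w \<in> borel_measurable lebesgue"
  using w_measurable by (simp add: measurable_completion)

lemma Mw_measurable_eq [simp]: "borel_measurable Mw = borel_measurable lebesgue"
  by (rule measurable_cong_sets) (simp_all add: weighted_measure_def)

lemma Mw_integrable:
  fixes g :: "real ^ 'n \<Rightarrow> 'b::{banach, second_countable_topology}"
  assumes "g \<in> borel_measurable lebesgue"
  shows "integrable Mw g \<longleftrightarrow> integrable lebesgue (\<lambda>y. w y *\<^sub>R g y)"
  unfolding weighted_measure_def by (rule integrable_density[OF assms]) (auto simp: w_nonneg)

lemma Mw_integral:
  fixes g :: "real ^ 'n \<Rightarrow> 'b::{banach, second_countable_topology}"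
  assumes "g \<in> borel_measurable lebesgue"
  shows "(LINT y|Mw. g y) = (LINT y|lebesgue. w y *\<^sub>R g y)"
  unfolding weighted_measure_def by (rule integral_density[OF assms]) (auto simp: w_nonneg)

lemma Mw_lborel:
  fixes g :: "real ^ 'n \<Rightarrow> real"
  assumes [measurable]: "g \<in> borel_measurable borel" and i: "integrable lborel (\<lambda>y. w y * g y)"
  shows "integrable Mw g" "(LINT y|Mw. g y) = (LINT y|lborel. w y * g y)"
proof -
  have g: "g \<in> borel_measurable lebesgue" by (simp add: measurable_completion)
  show "integrable Mw g"
    using i by (simp add: Mw_integrable[OF g] integrable_completion)
  show "(LINT y|Mw. g y) = (LINT y|lborel. w y * g y)"
    by (simp add: Mw_integral[OF g] integral_completion)
qed

lemma hk_Mw: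
  assumes s: "0 < s"
  shows "integrable Mw (hk s x)" "(LINT y|Mw. hk s x y) = Lw s (\<lambda>y. 1)"
  using Mw_lborel[OF hk_measurable hk_mass(1)[OF s]] hk_mass(2)[OF s] by auto

lemma gauss_Mw:
  assumes "0 < s"
  shows "integrable Mw (\<lambda>y. exp (- s * (norm y)\<^sup>2))" "(LINT y|Mw. exp (- s * (norm y)\<^sup>2)) = Lw s (\<lambda>y. 1)"
  using hk_Mw[OF assms, of 0] by (simp_all add: hk_def[abs_def] dker_zero)

lemma AE_Mw_nonzero: "AE y in Mw. y \<noteq> 0"
proof -
  obtain b :: "real ^ 'n" where "b \<in> Basis" using nonempty_Basis by blast
  then have "AE y in lborel. b \<bullet> y \<noteq> 0" by (intro AE_hyperplane) auto
  then have "AE y::real ^ 'n in lborel. y \<noteq> 0" by (rule eventually_mono) auto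
  then have "AE y::real ^ 'n in lebesgue. y \<noteq> 0" by (rule AE_completion)
  then show ?thesis unfolding weighted_measure_def by (subst AE_density) auto
qed

definition sing_const :: "real \<Rightarrow> real" where
  "sing_const b = (LINT y|Mw. (if norm y \<le> 1 then norm y powr (- b) else 0))"

text \<open>The weight vanishes at the origin to order \<open>2 * gam\<close>, so on the unit ball
  the integrand is bounded by a multiple of \<open>norm y powr (- \<sigma>)\<close>. The condition
  \<open>b < dunkl_dim Rp k\<close> says that \<open>b - 2 * gam\<close> is below the
  dimension.\<close>

lemma sing_integrable:
  assumes b: "0 < b" "b < dunkl_dim Rp k"
  shows "integrable Mw (\<lambda>y. if norm y \<le> 1 then norm y powr (- b) else 0)"
proof (rule Mw_lborel)
  define \<sigma> where "\<sigma> = max 0 (b - 2 * gam)"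
  \<comment> \<open>\<open>exp 1\<close> compensates the Gaussian, which is at least
    \<open>exp (- 1)\<close> on the unit ball.\<close>
  define K where "K = exp 1 * sqrt 2 powr (2 * gam)"
  have \<sigma>: "0 \<le> \<sigma>" "\<sigma> < real DIM(real ^ 'n)" "- \<sigma> \<le> 2 * gam - b"
    using b by (auto simp: \<sigma>_def dunkl_dim_def)
  have "integrable lborel (\<lambda>y::real ^ 'n. K * (norm y powr (- \<sigma>) * exp (- 1 * (norm y)\<^sup>2)))"
    using \<sigma> by (intro integrable_mult_right integrable_powr_gauss) auto
  then show "integrable lborel (\<lambda>y. w y * (if norm y \<le> 1 then norm y powr (- b) else 0))"
  proof (rule Bochner_Integration.integrable_bound)
    show "AE y in lborel. norm (w y * (if norm y \<le> 1 then norm y powr (- b) else 0))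
        \<le> norm (K * (norm y powr (- \<sigma>) * exp (- 1 * (norm y)\<^sup>2)))"
    proof (rule AE_I2)
      fix y
      show "norm (w y * (if norm y \<le> 1 then norm y powr (- b) else 0))
        \<le> norm (K * (norm y powr (- \<sigma>) * exp (- 1 * (norm y)\<^sup>2)))"
      proof (cases "norm y \<le> 1 \<and> y \<noteq> 0")
        case True
        have "w y * norm y powr (- b) \<le> (sqrt 2 * norm y) powr (2 * gam) * norm y powr (- b)"
          using True by (intro mult_right_mono w_le_powr) auto
        also have "\<dots> = sqrt 2 powr (2 * gam) * norm y powr (2 * gam - b)"
          by (simp add: powr_mult powr_add[symmetric] mult.assoc)
        also have "\<dots> \<le> sqrt 2 powr (2 * gam) * norm y powr (- \<sigma>)"
          using True \<sigma> by (intro mult_left_mono powr_mono') auto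
        also have "\<dots> \<le> sqrt 2 powr (2 * gam) * norm y powr (- \<sigma>) * (exp 1 * exp (- 1 * (norm y)\<^sup>2))"
        proof -
          have "(norm y)\<^sup>2 \<le> 1" using True by (simp add: power_le_one)
          then have "1 \<le> exp 1 * exp (- 1 * (norm y)\<^sup>2)" unfolding exp_add[symmetric] by simp
          then show ?thesis using mult_left_mono[of 1 _ "sqrt 2 powr (2 * gam) * norm y powr (- \<sigma>)"] by simp
        qed
        finally show ?thesis using True w_nonneg[of y] by (simp add: K_def mult_ac abs_mult)
      qed auto
    qed
  qed measurable
qed measurable

lemma sing_const_nonneg: "0 \<le> sing_const b"
  unfolding sing_const_def by (intro integral_nonneg_AE AE_I2) auto

text \<open>Inside the unit ball use \<open>V y \<le> 1\<close>, outside use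
  \<open>norm y powr (- b) \<le> 1\<close>.\<close>

lemma sing_bound:
  assumes b: "0 < b" "b < dunkl_dim Rp k"
    and [measurable]: "V \<in> borel_measurable lebesgue" and V: "\<And>y. 0 \<le> V y" "\<And>y. V y \<le> 1" and i: "integrable Mw V"
  shows "integrable Mw (\<lambda>y. norm y powr (- b) * V y)"
    and "(LINT y|Mw. norm y powr (- b) * V y) \<le> sing_const b + (LINT y|Mw. V y)"
proof -
  let ?S = "\<lambda>y::real ^ 'n. if norm y \<le> 1 then norm y powr (- b) else 0"
  have [measurable]: "(\<lambda>y::real ^ 'n. norm y) \<in> borel_measurable lebesgue" by (simp add: measurable_completion)
  have le: "norm y powr (- b) * V y \<le> ?S y + V y" for y
  proof (cases "norm y \<le> 1")
    case True
    then show ?thesis using V mult_left_mono[of "V y" 1 "norm y powr (- b)"] by (simp add: add_increasing2)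
  next
    case False
    then have "norm y powr (- b) \<le> norm y powr 0" using b by (intro powr_mono) auto
    then show ?thesis using V False mult_right_mono[of "norm y powr (- b)" 1 "V y"] by (auto split: if_splits)
  qed
  have iS: "integrable Mw (\<lambda>y. ?S y + V y)" by (intro Bochner_Integration.integrable_add sing_integrable b i)
  then show int: "integrable Mw (\<lambda>y. norm y powr (- b) * V y)"
  proof (rule Bochner_Integration.integrable_bound)
    show "AE y in Mw. norm (norm y powr (- b) * V y) \<le> norm (?S y + V y)"
      using le V by (intro AE_I2) (simp add: abs_mult order_trans[OF _ abs_ge_self])
  qed simp
  have "(LINT y|Mw. norm y powr (- b) * V y) \<le> (LINT y|Mw. ?S y + V y)"
    by (rule integral_mono[OF int iS le])
  also have "\<dots> = sing_const b + (LINT y|Mw. V y)"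
    unfolding sing_const_def by (intro Bochner_Integration.integral_add sing_integrable b i)
  finally show "(LINT y|Mw. norm y powr (- b) * V y) \<le> sing_const b + (LINT y|Mw. V y)" .
qed

end

section \<open>The heat semigroup\<close>

lemma Linf_norm_le:
  assumes "g \<in> borel_measurable lebesgue" "\<And>x. norm (g x) \<le> B"
  shows "Linf_norm g \<le> ennreal B"
  unfolding Linf_norm_def
  by (rule esssup_I) (use assms in \<open>auto intro!: AE_I2 ennreal_leI\<close>)

context dunkl begin

text \<open>The factor of \<open>young_integral\<close> for the kernel:
  \<open>sing_const (\<beta> * r') + Lw s (\<lambda>y. 1)\<close> bounds the moment in question
  uniformly in \<open>x\<close>, since the mass of \<open>hk s x\<close> is the same for all
  \<open>x\<close>.\<close>

definition heat_const :: "real \<Rightarrow> real \<Rightarrow> real \<Rightarrow> real \<Rightarrow> real" where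
  "heat_const r r' \<beta> s = 1 / r + (sing_const (\<beta> * r') + Lw s (\<lambda>y. 1)) / r'"

lemma Lw_one_nonneg: "0 \<le> Lw s (\<lambda>y. 1)"
  unfolding Lw_def by (intro integral_nonneg_AE AE_I2) (simp add: w_nonneg)

lemma heat_const_nonneg: "0 < r \<Longrightarrow> 0 < r' \<Longrightarrow> 0 \<le> heat_const r r' \<beta> s"
  unfolding heat_const_def by (intro add_nonneg_nonneg divide_nonneg_pos sing_const_nonneg Lw_one_nonneg) auto

definition heat :: "real \<Rightarrow> (real ^ 'n \<Rightarrow> complex) \<Rightarrow> real ^ 'n \<Rightarrow> complex" where
  "heat s f x = (LINT y|Mw. hk s x y *\<^sub>R f y)"

end

text \<open>The estimates for one fixed \<open>f\<close>. They are uniform in \<open>f\<close>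
  because \<open>heat_const\<close> and \<open>lip\<close> do not mention it; \<open>f\<close>
  enters only through \<open>N\<close>.\<close>

locale dunkl_lp = dunkl R Rp k
  for R Rp :: "(real ^ 'n) set" and k :: "real ^ 'n \<Rightarrow> real" +
  fixes r r' \<beta> :: real and f :: "real ^ 'n \<Rightarrow> complex"
  assumes r: "1 < r" and r': "1 / r + 1 / r' = 1"
    and beta: "0 < \<beta>" "\<beta> < dunkl_dim Rp k / r'"
    and f: "f \<in> Lp_space r (weighted_measure (\<lambda>x. norm x powr (\<beta> * r) * dunkl_weight Rp k x))"
begin

definition N :: real where
  "N = Lp_norm r Mw (\<lambda>x. of_real (norm x powr \<beta>) * f x)"

lemma r'_gt_1: "1 < r'"
proof -
  have "0 < 1 / r" "1 / r < 1" using r by simp_all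
  then have i: "0 < 1 / r'" "1 / r' < 1" using r' by linarith+
  then show ?thesis by (simp add: divide_less_eq split: if_splits)
qed

lemma beta_r': "0 < \<beta> * r'" "\<beta> * r' < dunkl_dim Rp k"
  using beta r'_gt_1 by (simp_all add: pos_less_divide_eq)

lemma norm_measurable_lebesgue [measurable]: "(\<lambda>y::real ^ 'n. norm y) \<in> borel_measurable lebesgue"
  by (simp add: measurable_completion)

lemma f_measurable [measurable]: "f \<in> borel_measurable lebesgue"
  using f by (simp add: Lp_space_def weighted_measure_def)

lemma hk_measurable_lebesgue [measurable]: "hk s x \<in> borel_measurable lebesgue"
  using hk_measurable by (simp add: measurable_completion)

definition a :: "real ^ 'n \<Rightarrow> real" where "a y = norm y powr \<beta> * norm (f y)"

lemma a_measurable [measurable]: "a \<in> borel_measurable lebesgue"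
  unfolding a_def by measurable

lemma a_nonneg: "0 \<le> a y"
  by (simp add: a_def)

lemma a_integrable: "integrable Mw (\<lambda>y. a y powr r)"
proof -
  have "integrable (density lebesgue (\<lambda>x. ennreal (norm x powr (\<beta> * r) * w x))) (\<lambda>x. norm (f x) powr r)"
    using f by (simp add: Lp_space_def weighted_measure_def)
  then have "integrable lebesgue (\<lambda>x. (norm x powr (\<beta> * r) * w x) *\<^sub>R (norm (f x) powr r))"
    by (subst (asm) integrable_density) (auto simp: w_nonneg)
  also have "(\<lambda>x. (norm x powr (\<beta> * r) * w x) *\<^sub>R (norm (f x) powr r)) = (\<lambda>x. w x *\<^sub>R (a x powr r))"
    by (simp add: fun_eq_iff a_def powr_mult powr_powr)
  finally show ?thesis by (subst Mw_integrable) simp_all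
qed

lemma N_eq: "N = (LINT y|Mw. a y powr r) powr (1 / r)"
  by (simp add: N_def Lp_norm_def a_def norm_mult)

lemma N_nonneg: "0 \<le> N"
  by (simp add: N_eq)

text \<open>Here the weight \<open>norm y powr \<beta>\<close> stays with \<open>f\<close>. Since
  \<open>0 \<le> V y \<le> 1\<close> and \<open>1 < r'\<close>, the moment of order
  \<open>r'\<close> is at most the mass.\<close>

lemma holder_weight:
  assumes Vm[measurable]: "V \<in> borel_measurable lebesgue" and V: "\<And>y. 0 \<le> V y" "\<And>y. V y \<le> 1"
    and i: "integrable Mw V"
  shows "integrable Mw (\<lambda>y. a y * V y)"
    and "(LINT y|Mw. a y * V y) \<le> N * (1 / r + (LINT y|Mw. V y) / r')"
proof -
  have le: "V y powr r' \<le> V y" for y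
    using powr_mono'[of 1 r' "V y"] V[of y] r'_gt_1 by simp
  have int: "integrable Mw (\<lambda>y. V y powr r')"
    by (rule Bochner_Integration.integrable_bound[OF i]) (use le V in \<open>auto intro!: AE_I2\<close>)
  have Q: "(LINT y|Mw. V y powr r') \<le> (LINT y|Mw. V y)"
    by (rule integral_mono[OF int i le])
  show "integrable Mw (\<lambda>y. a y * V y)"
    by (rule young_integral(1)[OF _ _ a_nonneg V(1) r r'_gt_1 r' a_integrable int Q]) simp_all
  show "(LINT y|Mw. a y * V y) \<le> N * (1 / r + (LINT y|Mw. V y) / r')"
    unfolding N_eq
    by (rule young_integral(2)[OF _ _ a_nonneg V(1) r r'_gt_1 r' a_integrable int Q]) simp_all
qed

text \<open>The factorization is
  \<open>norm (f y) * V y = a y * (norm y powr (- \<beta>) * V y)\<close>, valid off the origin. The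
  moment of the second factor is controlled by \<open>sing_bound\<close>.\<close>

lemma holder:
  assumes Vm[measurable]: "V \<in> borel_measurable lebesgue" and V: "\<And>y. 0 \<le> V y" "\<And>y. V y \<le> 1"
    and i: "integrable Mw V"
  shows "integrable Mw (\<lambda>y. norm (f y) * V y)"
    and "(LINT y|Mw. norm (f y) * V y) \<le> N * (1 / r + (sing_const (\<beta> * r') + (LINT y|Mw. V y)) / r')"
proof -
  define b where "b y = norm y powr (- \<beta>) * V y" for y
  have bm[measurable]: "b \<in> borel_measurable lebesgue" unfolding b_def by measurable
  have b0: "0 \<le> b y" for y using V by (simp add: b_def)
  note sing = sing_bound[OF beta_r' Vm V i]
  have le: "b y powr r' \<le> norm y powr (- (\<beta> * r')) * V y" for y
  proof -
    have "V y powr r' \<le> V y" using powr_mono'[of 1 r' "V y"] V[of y] r'_gt_1 by simp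
    then show ?thesis using V by (simp add: b_def powr_mult powr_powr mult_left_mono)
  qed
  have int: "integrable Mw (\<lambda>y. b y powr r')"
  proof (rule Bochner_Integration.integrable_bound[OF sing(1)])
    show "AE y in Mw. norm (b y powr r') \<le> norm (norm y powr (- (\<beta> * r')) * V y)"
      using le V by (intro AE_I2) (simp add: abs_mult)
  qed simp
  have Q: "(LINT y|Mw. b y powr r') \<le> sing_const (\<beta> * r') + (LINT y|Mw. V y)"
    using integral_mono[OF int sing(1) le] sing(2) by linarith
  have ae: "AE y in Mw. a y * b y = norm (f y) * V y"
    using AE_Mw_nonzero
  proof eventually_elim
    case (elim y)
    have "norm y powr \<beta> * norm y powr (- \<beta>) = 1" using elim by (simp add: powr_add[symmetric])
    moreover have "a y * b y = (norm y powr \<beta> * norm y powr (- \<beta>)) * (norm (f y) * V y)"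
      by (simp add: a_def b_def)
    ultimately show ?case by simp
  qed
  have "integrable Mw (\<lambda>y. a y * b y)"
    by (rule young_integral(1)[OF _ _ a_nonneg b0 r r'_gt_1 r' a_integrable int Q]) simp_all
  then show "integrable Mw (\<lambda>y. norm (f y) * V y)"
    using integrable_cong_AE[OF _ _ ae] by simp
  have "(LINT y|Mw. norm (f y) * V y) = (LINT y|Mw. a y * b y)"
    using integral_cong_AE[OF _ _ ae] by simp
  also have "\<dots> \<le> N * (1 / r + (sing_const (\<beta> * r') + (LINT y|Mw. V y)) / r')"
    unfolding N_eq
    by (rule young_integral(2)[OF _ _ a_nonneg b0 r r'_gt_1 r' a_integrable int Q]) simp_all
  finally show "(LINT y|Mw. norm (f y) * V y) \<le> N * (1 / r + (sing_const (\<beta> * r') + (LINT y|Mw. V y)) / r')" .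
qed

abbreviation A :: "real \<Rightarrow> real" where "A \<equiv> heat_const r r' \<beta>"

lemma f_hk:
  assumes s: "0 < s"
  shows "integrable Mw (\<lambda>y. norm (f y) * hk s x y)" "(LINT y|Mw. norm (f y) * hk s x y) \<le> N * A s"
  using holder[OF _ hk_nonneg hk_le_1[OF s] hk_Mw(1)[OF s], of x] hk_Mw(2)[OF s]
  by (simp_all add: heat_const_def)

lemma heat_integrable:
  assumes s: "0 < s" shows "integrable Mw (\<lambda>y. hk s x y *\<^sub>R f y)"
  by (rule Bochner_Integration.integrable_bound[OF f_hk(1)[OF s, of x]])
    (auto intro!: AE_I2 simp: hk_nonneg mult.commute)

lemma heat_bound:
  assumes s: "0 < s" shows "norm (heat s f x) \<le> N * A s"
proof -
  have "norm (heat s f x) \<le> (LINT y|Mw. norm (hk s x y *\<^sub>R f y))"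
    unfolding heat_def by (rule integral_norm_bound)
  also have "\<dots> = (LINT y|Mw. norm (f y) * hk s x y)"
    by (simp add: hk_nonneg mult.commute)
  finally show ?thesis using f_hk(2)[OF s, of x] by simp
qed

text \<open>If \<open>norm x \<le> 2 * norm y\<close>, the weight passes from \<open>x\<close> to
  \<open>y\<close> and \<open>holder_weight\<close> applies. Otherwise
  \<open>hk s x y \<le> exp (- (s / 4) * (norm x)\<^sup>2)\<close>: one half of this exponent
  absorbs \<open>norm x powr \<beta>\<close>, the other is at most a Gaussian in \<open>y\<close>,
  and \<open>holder\<close> applies.\<close>

lemma heat_weight_bound:
  assumes s: "0 < s"
  shows "norm x powr \<beta> * norm (heat s f x)
    \<le> N * (2 powr \<beta> * (1 / r + Lw s (\<lambda>y. 1) / r') + exp (4 * \<beta>\<^sup>2 / s) * A (s / 2))"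
proof -
  let ?g = "\<lambda>y::real ^ 'n. exp (- (s / 2) * (norm y)\<^sup>2)"
  have gm[measurable]: "?g \<in> borel_measurable lebesgue" by measurable
  have pw: "norm x powr \<beta> * hk s x y \<le> 2 powr \<beta> * (norm y powr \<beta> * hk s x y) + exp (4 * \<beta>\<^sup>2 / s) * ?g y" for y
  proof (cases "norm x \<le> 2 * norm y")
    case True
    then have "norm x powr \<beta> \<le> (2 * norm y) powr \<beta>" using beta by (intro powr_mono2) auto
    also have "\<dots> = 2 powr \<beta> * norm y powr \<beta>" by (simp add: powr_mult)
    finally have "norm x powr \<beta> * hk s x y \<le> 2 powr \<beta> * (norm y powr \<beta> * hk s x y)"
      using hk_nonneg[of s x y] by (simp add: mult_right_mono mult.assoc[symmetric])
    then show ?thesis by (simp add: add_increasing2)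
  next
    case False
    have "(norm x / 2)\<^sup>2 \<le> (norm x - norm y)\<^sup>2" using False by (intro power_mono) auto
    then have "(norm x)\<^sup>2 / 4 \<le> (norm x - norm y)\<^sup>2" by (simp add: power_divide)
    then have "s * ((norm x)\<^sup>2 / 4) \<le> s * (norm x - norm y)\<^sup>2" using s by (intro mult_left_mono) auto
    then have h: "hk s x y \<le> exp (- (s / 8) * (norm x)\<^sup>2) * exp (- (s / 8) * (norm x)\<^sup>2)"
      using hk_le[OF s, of x y] unfolding exp_add[symmetric]
      by (elim order_trans) simp
    have "(2 * norm y)\<^sup>2 \<le> (norm x)\<^sup>2" using False by (intro power_mono) auto
    then have "4 * (norm y)\<^sup>2 \<le> (norm x)\<^sup>2" by (simp add: power_mult_distrib)
    then have "s / 8 * (4 * (norm y)\<^sup>2) \<le> s / 8 * (norm x)\<^sup>2" using s by (intro mult_left_mono) auto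
    then have g: "exp (- (s / 8) * (norm x)\<^sup>2) \<le> ?g y" by simp
    have "norm x powr \<beta> * exp (- (s / 8) * (norm x)\<^sup>2) \<le> exp (\<beta> * norm x) * exp (- (s / 8) * (norm x)\<^sup>2)"
      using beta by (intro mult_right_mono powr_le_exp) auto
    \<comment> \<open>This is the origin of the constant:
      \<open>\<beta>\<^sup>2 / (2 * (s / 8)) = 4 * \<beta>\<^sup>2 / s\<close>.\<close>
    also have "\<dots> \<le> exp (\<beta>\<^sup>2 / (2 * (s / 8))) * exp (- (s / 8 / 2) * (norm x)\<^sup>2)"
      by (rule exp_linear_minus_square_le) (use s in simp)
    also have "\<dots> \<le> exp (4 * \<beta>\<^sup>2 / s) * 1" using s by (intro mult_mono) (auto simp: mult.commute)
    finally have p: "norm x powr \<beta> * exp (- (s / 8) * (norm x)\<^sup>2) \<le> exp (4 * \<beta>\<^sup>2 / s)" by simp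
    have "norm x powr \<beta> * hk s x y \<le> (norm x powr \<beta> * exp (- (s / 8) * (norm x)\<^sup>2)) * exp (- (s / 8) * (norm x)\<^sup>2)"
      using mult_left_mono[OF h, of "norm x powr \<beta>"] by (simp add: mult.assoc)
    also have "\<dots> \<le> exp (4 * \<beta>\<^sup>2 / s) * ?g y" by (intro mult_mono p g) auto
    finally show ?thesis using hk_nonneg[of s x y] by (simp add: add_increasing)
  qed
  have "norm x powr \<beta> * norm (heat s f x) \<le> norm x powr \<beta> * (LINT y|Mw. norm (hk s x y *\<^sub>R f y))"
    unfolding heat_def by (intro mult_left_mono integral_norm_bound) simp
  also have "\<dots> = (LINT y|Mw. norm x powr \<beta> * (norm (f y) * hk s x y))"
    by (simp add: hk_nonneg mult.commute)
  also have "\<dots> \<le> (LINT y|Mw. 2 powr \<beta> * (a y * hk s x y) + exp (4 * \<beta>\<^sup>2 / s) * (norm (f y) * ?g y))"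
  proof (rule integral_mono)
    show "integrable Mw (\<lambda>y. norm x powr \<beta> * (norm (f y) * hk s x y))"
      using f_hk(1)[OF s, of x] by simp
    show "integrable Mw (\<lambda>y. 2 powr \<beta> * (a y * hk s x y) + exp (4 * \<beta>\<^sup>2 / s) * (norm (f y) * ?g y))"
      using holder_weight(1)[OF _ hk_nonneg hk_le_1[OF s] hk_Mw(1)[OF s], of x]
        holder(1)[OF gm _ _ gauss_Mw(1)] s
      by (intro Bochner_Integration.integrable_add integrable_mult_right) simp_all
    fix y
    show "norm x powr \<beta> * (norm (f y) * hk s x y) \<le> 2 powr \<beta> * (a y * hk s x y) + exp (4 * \<beta>\<^sup>2 / s) * (norm (f y) * ?g y)"
      using mult_left_mono[OF pw[of y], of "norm (f y)"] by (simp add: a_def distrib_left mult_ac)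
  qed
  also have "\<dots> = 2 powr \<beta> * (LINT y|Mw. a y * hk s x y) + exp (4 * \<beta>\<^sup>2 / s) * (LINT y|Mw. norm (f y) * ?g y)"
    using holder_weight(1)[OF _ hk_nonneg hk_le_1[OF s] hk_Mw(1)[OF s], of x]
      holder(1)[OF gm _ _ gauss_Mw(1)] s by simp
  also have "\<dots> \<le> 2 powr \<beta> * (N * (1 / r + Lw s (\<lambda>y. 1) / r')) + exp (4 * \<beta>\<^sup>2 / s) * (N * A (s / 2))"
  proof (intro add_mono mult_left_mono)
    show "(LINT y|Mw. a y * hk s x y) \<le> N * (1 / r + Lw s (\<lambda>y. 1) / r')"
      using holder_weight(2)[OF _ hk_nonneg hk_le_1[OF s] hk_Mw(1)[OF s], of x] hk_Mw(2)[OF s, of x] by simp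
    show "(LINT y|Mw. norm (f y) * ?g y) \<le> N * A (s / 2)"
      using holder(2)[OF gm _ _ gauss_Mw(1)] gauss_Mw(2)[of "s / 2"] s by (simp add: heat_const_def)
  qed simp_all
  finally show ?thesis by (simp add: distrib_left mult_ac)
qed

section \<open>Regularity of the semigroup in the space variable\<close>

definition lip :: "real \<Rightarrow> real" where "lip s = 2 * sqrt s * exp (s / 2)"

text \<open>This Lipschitz bound yields continuity, hence measurability, of \<open>heat s f\<close>,
  and it bounds the difference quotients and with them the derivative.\<close>

lemma heat_shift_difference:
  assumes s: "0 < s" and v: "norm v \<le> 1"
  shows "norm (heat s f (x + v) - heat s f x) \<le> lip s * norm v * (N * A (s / 4))"
proof -
  have s4: "0 < s / 4" using s by simp
  have "norm (heat s f (x + v) - heat s f x) = norm (LINT y|Mw. (hk s (x + v) y - hk s x y) *\<^sub>R f y)"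
    unfolding heat_def using heat_integrable[OF s] by (simp add: scaleR_diff_left)
  also have "\<dots> \<le> (LINT y|Mw. norm ((hk s (x + v) y - hk s x y) *\<^sub>R f y))"
    by (rule integral_norm_bound)
  also have "\<dots> \<le> (LINT y|Mw. (lip s * norm v) * (norm (f y) * hk (s / 4) x y))"
  proof (rule integral_mono)
    show "integrable Mw (\<lambda>y. norm ((hk s (x + v) y - hk s x y) *\<^sub>R f y))"
      using heat_integrable[OF s] by (simp add: scaleR_diff_left)
    show "integrable Mw (\<lambda>y. lip s * norm v * (norm (f y) * hk (s / 4) x y))"
      by (intro integrable_mult_right f_hk s4)
    fix y
    show "norm ((hk s (x + v) y - hk s x y) *\<^sub>R f y) \<le> lip s * norm v * (norm (f y) * hk (s / 4) x y)"
      using mult_right_mono[OF hk_shift_difference[OF s v, of x y], of "norm (f y)"]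
      by (simp add: lip_def mult_ac)
  qed
  also have "\<dots> \<le> (lip s * norm v) * (N * A (s / 4))"
    using f_hk(2)[OF s4, of x] s by (simp add: lip_def mult_left_mono)
  finally show ?thesis .
qed

lemma heat_continuous:
  assumes s: "0 < s" shows "continuous_on UNIV (heat s f)"
proof (intro continuous_at_imp_continuous_on ballI)
  fix x
  have "((\<lambda>v. heat s f (x + v) - heat s f x) \<longlongrightarrow> 0) (at 0)"
  proof (rule Lim_null_comparison)
    show "\<forall>\<^sub>F v in at 0. norm (heat s f (x + v) - heat s f x) \<le> lip s * norm v * (N * A (s / 4))"
      unfolding eventually_at
      by (rule exI[of _ 1]) (use heat_shift_difference[OF s] in \<open>auto simp: dist_norm\<close>)
    have "((\<lambda>v::real ^ 'n. (lip s * (N * A (s / 4))) * norm v) \<longlongrightarrow> 0) (at 0)"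
      by (intro tendsto_mult_right_zero tendsto_norm_zero tendsto_ident_at)
    then show "((\<lambda>v::real ^ 'n. lip s * norm v * (N * A (s / 4))) \<longlongrightarrow> 0) (at 0)"
      by (simp only: mult_ac)
  qed
  then have "((\<lambda>v. heat s f (x + v)) \<longlongrightarrow> heat s f x) (at 0)" by (rule LIM_zero_cancel)
  then show "isCont (heat s f) x" by (simp add: isCont_iff)
qed

lemma heat_measurable [measurable]: "0 < s \<Longrightarrow> heat s f \<in> borel_measurable borel"
  by (intro borel_measurable_continuous_onI heat_continuous)

lemma heat_quotient_bound:
  assumes s: "0 < s" and e: "norm e = 1" and u: "u \<noteq> 0" "\<bar>u\<bar> \<le> 1"
  shows "norm ((heat s f (x + u *\<^sub>R e) - heat s f x) /\<^sub>R u) \<le> lip s * (N * A (s / 4))"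
proof -
  have "norm (heat s f (x + u *\<^sub>R e) - heat s f x) \<le> lip s * \<bar>u\<bar> * (N * A (s / 4))"
    using heat_shift_difference[OF s, of "u *\<^sub>R e" x] e u by simp
  then have "\<bar>inverse u\<bar> * norm (heat s f (x + u *\<^sub>R e) - heat s f x) \<le> \<bar>inverse u\<bar> * (lip s * \<bar>u\<bar> * (N * A (s / 4)))"
    by (intro mult_left_mono) auto
  also have "\<dots> = lip s * (N * A (s / 4))" using u by simp
  finally show ?thesis by simp
qed

lemma heat_has_derivative:
  assumes s: "0 < s" and e: "norm e = 1"
  shows "\<exists>l. ((\<lambda>u. heat s f (x + u *\<^sub>R e)) has_vector_derivative l) (at 0) \<and>
    ((\<lambda>u. (heat s f (x + u *\<^sub>R e) - heat s f x) /\<^sub>R u) \<longlongrightarrow> l) (at 0) \<and> norm l \<le> lip s * (N * A (s / 4))"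
proof -
  have s4: "0 < s / 4" using s by simp
  define D where "D y = dir_deriv e (\<lambda>x. hk s x y) x" for y
  define l where "l = (LINT y|Mw. D y *\<^sub>R f y)"
  have der: "((\<lambda>u. (hk s (x + u *\<^sub>R e) y - hk s x y) / u) \<longlongrightarrow> D y) (at 0)" for y
    using line_derivative[where p = "\<lambda>x. hk s x y" and x = x and \<xi> = e and s = 0, OF hk_differentiable] by (simp add: has_field_derivative_iff D_def)
  \<comment> \<open>The limit is taken within \<open>[-1, 1]\<close> so that every approximating
    sequence stays in the range of \<open>hk_shift_difference\<close>; this supplies the dominating
    function.\<close>
  have "((\<lambda>u. (heat s f (x + u *\<^sub>R e) - heat s f x) /\<^sub>R u) \<longlongrightarrow> l) (at 0 within {-1..1})"
    unfolding tendsto_at_iff_sequentially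
  proof (intro allI impI)
    fix X :: "nat \<Rightarrow> real" assume X: "\<forall>i. X i \<in> {-1..1} - {0}" "X \<longlonglongrightarrow> 0"
    then have X0: "X i \<noteq> 0" "\<bar>X i\<bar> \<le> 1" for i by (auto simp: abs_le_iff)
    have Xf: "filterlim X (at 0) sequentially" using X X0 by (simp add: filterlim_at)
    have lim: "(\<lambda>i. ((hk s (x + X i *\<^sub>R e) y - hk s x y) / X i) *\<^sub>R f y) \<longlonglongrightarrow> D y *\<^sub>R f y" for y
      using filterlim_compose[OF der Xf] by (intro tendsto_scaleR tendsto_const) simp
    have m: "(\<lambda>y. ((hk s (x + X i *\<^sub>R e) y - hk s x y) / X i) *\<^sub>R f y) \<in> borel_measurable lebesgue" for i
      by measurable
    have "(\<lambda>i. LINT y|Mw. ((hk s (x + X i *\<^sub>R e) y - hk s x y) / X i) *\<^sub>R f y) \<longlonglongrightarrow> l"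
      unfolding l_def
    proof (rule integral_dominated_convergence)
      show "(\<lambda>y. D y *\<^sub>R f y) \<in> borel_measurable Mw"
        using borel_measurable_LIMSEQ_metric[OF m lim] by simp
      show "integrable Mw (\<lambda>y. lip s * (norm (f y) * hk (s / 4) x y))"
        by (intro integrable_mult_right f_hk s4)
      show "AE y in Mw. norm (((hk s (x + X i *\<^sub>R e) y - hk s x y) / X i) *\<^sub>R f y) \<le> lip s * (norm (f y) * hk (s / 4) x y)" for i
      proof (rule AE_I2)
        fix y
        have "\<bar>hk s (x + X i *\<^sub>R e) y - hk s x y\<bar> \<le> lip s * \<bar>X i\<bar> * hk (s / 4) x y"
          using hk_shift_difference[OF s, of "X i *\<^sub>R e" x y] e X0[of i] by (simp add: lip_def)
        then have "\<bar>hk s (x + X i *\<^sub>R e) y - hk s x y\<bar> / \<bar>X i\<bar> \<le> lip s * hk (s / 4) x y"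
          using X0[of i] by (simp add: pos_divide_le_eq mult_ac)
        then have "\<bar>hk s (x + X i *\<^sub>R e) y - hk s x y\<bar> / \<bar>X i\<bar> * norm (f y) \<le> lip s * hk (s / 4) x y * norm (f y)"
          by (rule mult_right_mono) simp
        then show "norm (((hk s (x + X i *\<^sub>R e) y - hk s x y) / X i) *\<^sub>R f y) \<le> lip s * (norm (f y) * hk (s / 4) x y)"
          by (simp add: mult_ac)
      qed
    qed (use m lim in auto)
    moreover have "(LINT y|Mw. ((hk s (x + X i *\<^sub>R e) y - hk s x y) / X i) *\<^sub>R f y)
        = (heat s f (x + X i *\<^sub>R e) - heat s f x) /\<^sub>R X i" for i
    proof -
      have "((hk s (x + X i *\<^sub>R e) y - hk s x y) / X i) *\<^sub>R f y
        = (1 / X i) *\<^sub>R (hk s (x + X i *\<^sub>R e) y *\<^sub>R f y - hk s x y *\<^sub>R f y)" for y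
        by (simp add: scaleR_diff_left[symmetric])
      then have "(LINT y|Mw. ((hk s (x + X i *\<^sub>R e) y - hk s x y) / X i) *\<^sub>R f y)
        = (1 / X i) *\<^sub>R (LINT y|Mw. hk s (x + X i *\<^sub>R e) y *\<^sub>R f y - hk s x y *\<^sub>R f y)"
        by (simp only: integral_scaleR_right)
      then show ?thesis
        unfolding heat_def using heat_integrable[OF s] by (simp add: inverse_eq_divide)
    qed
    ultimately show "((\<lambda>u. (heat s f (x + u *\<^sub>R e) - heat s f x) /\<^sub>R u) \<circ> X) \<longlonglongrightarrow> l"
      by (simp add: o_def)
  qed
  moreover have "at (0::real) within {-1..1} = at 0" by (rule at_within_interior) simp
  ultimately have lim: "((\<lambda>u. (heat s f (x + u *\<^sub>R e) - heat s f x) /\<^sub>R u) \<longlongrightarrow> l) (at 0)" by simp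
  have "((\<lambda>h. norm (heat s f (x + (0 + h) *\<^sub>R e) - heat s f (x + 0 *\<^sub>R e) - h *\<^sub>R l) / norm h) \<longlongrightarrow> 0) (at 0)"
  proof (rule Lim_transform_eventually)
    show "((\<lambda>h. norm ((heat s f (x + h *\<^sub>R e) - heat s f x) /\<^sub>R h - l)) \<longlongrightarrow> 0) (at 0)"
      by (intro tendsto_norm_zero LIM_zero lim)
    show "\<forall>\<^sub>F h in at 0. norm ((heat s f (x + h *\<^sub>R e) - heat s f x) /\<^sub>R h - l)
        = norm (heat s f (x + (0 + h) *\<^sub>R e) - heat s f (x + 0 *\<^sub>R e) - h *\<^sub>R l) / norm h"
      unfolding eventually_at
    proof (rule exI[of _ 1], intro conjI ballI impI)
      fix h :: real assume "h \<noteq> 0 \<and> dist h 0 < 1"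
      then have h: "h \<noteq> 0" by simp
      have "(heat s f (x + h *\<^sub>R e) - heat s f x) /\<^sub>R h - l = inverse h *\<^sub>R (heat s f (x + h *\<^sub>R e) - heat s f x - h *\<^sub>R l)"
        using h by (simp add: scaleR_diff_right)
      then show "norm ((heat s f (x + h *\<^sub>R e) - heat s f x) /\<^sub>R h - l)
          = norm (heat s f (x + (0 + h) *\<^sub>R e) - heat s f (x + 0 *\<^sub>R e) - h *\<^sub>R l) / norm h"
        using h by (simp add: divide_inverse_commute)
    qed simp
  qed
  then have "((\<lambda>u. heat s f (x + u *\<^sub>R e)) has_vector_derivative l) (at 0)"
    unfolding has_vector_derivative_def has_derivative_at by (simp add: bounded_linear_scaleR_left)
  moreover have "norm l \<le> lip s * (N * A (s / 4))"
  proof (rule Lim_norm_ubound[OF _ lim])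
    show "\<forall>\<^sub>F u in at 0. norm ((heat s f (x + u *\<^sub>R e) - heat s f x) /\<^sub>R u) \<le> lip s * (N * A (s / 4))"
      unfolding eventually_at
      by (rule exI[of _ 1]) (use heat_quotient_bound[OF s e] in \<open>auto simp: dist_norm\<close>)
  qed simp
  ultimately show ?thesis using lim by blast
qed

lemma heat_dir_deriv:
  assumes s: "0 < s" and e: "norm e = 1"
  shows "((\<lambda>u. heat s f (x + u *\<^sub>R e)) has_vector_derivative dir_deriv e (heat s f) x) (at 0)"
    and "((\<lambda>u. (heat s f (x + u *\<^sub>R e) - heat s f x) /\<^sub>R u) \<longlongrightarrow> dir_deriv e (heat s f) x) (at 0)"
    and "norm (dir_deriv e (heat s f) x) \<le> lip s * (N * A (s / 4))"
proof -
  obtain l where l: "((\<lambda>u. heat s f (x + u *\<^sub>R e)) has_vector_derivative l) (at 0)"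
    "((\<lambda>u. (heat s f (x + u *\<^sub>R e) - heat s f x) /\<^sub>R u) \<longlongrightarrow> l) (at 0)" "norm l \<le> lip s * (N * A (s / 4))"
    using heat_has_derivative[OF s e] by blast
  have "dir_deriv e (heat s f) x = l" unfolding dir_deriv_def by (rule vector_derivative_at[OF l(1)])
  then show "((\<lambda>u. heat s f (x + u *\<^sub>R e)) has_vector_derivative dir_deriv e (heat s f) x) (at 0)"
    "((\<lambda>u. (heat s f (x + u *\<^sub>R e) - heat s f x) /\<^sub>R u) \<longlongrightarrow> dir_deriv e (heat s f) x) (at 0)"
    "norm (dir_deriv e (heat s f) x) \<le> lip s * (N * A (s / 4))" using l by simp_all
qed

text \<open>A pointwise limit of difference quotients of a continuous function. Measurability
  matters because \<open>Linf_norm\<close> is infinite when the modulus is not measurable.\<close>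

lemma heat_dir_deriv_measurable:
  assumes s: "0 < s" and e: "norm e = 1"
  shows "dir_deriv e (heat s f) \<in> borel_measurable borel"
proof -
  define h where "h n = 1 / real (Suc n)" for n
  have hf: "filterlim h (at 0) sequentially"
    unfolding filterlim_at h_def using LIMSEQ_inverse_real_of_nat by (simp add: inverse_eq_divide)
  note [measurable] = heat_measurable[OF s]
  show ?thesis
  proof (rule borel_measurable_LIMSEQ_metric)
    show "(\<lambda>x. (heat s f (x + h n *\<^sub>R e) - heat s f x) /\<^sub>R h n) \<in> borel_measurable borel" for n
      by measurable
    fix x
    show "(\<lambda>n. (heat s f (x + h n *\<^sub>R e) - heat s f x) /\<^sub>R h n) \<longlonglongrightarrow> dir_deriv e (heat s f) x"
      by (rule filterlim_compose[OF heat_dir_deriv(2)[OF s e] hf])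
  qed
qed

end

theorem proposition5p1:
  fixes R Rp :: "(real ^ 'n) set"
    and k :: "real ^ 'n \<Rightarrow> real"
    and r r' \<beta> t :: real
  assumes dim: "CARD('n) \<ge> 2"
    and R: "normalized_root_system R"
    and Rp: "positive_subsystem R Rp"
    and k: "multiplicity_function R k"
    and r: "1 < r"
    and r': "1 / r + 1 / r' = 1"
    and beta: "0 < \<beta>" "\<beta> < dunkl_dim Rp k / r'"
    and t: "0 < t"
  shows "\<exists>C>0. \<exists>D>0. \<exists>E>0.
    \<forall>f \<in> Lp_space r (weighted_measure (\<lambda>x. norm x powr (\<beta> * r) * dunkl_weight Rp k x)).
      (let F = dunkl_heat Rp k t f;
           N = Lp_norm r (weighted_measure (dunkl_weight Rp k)) (\<lambda>x. of_real (norm x powr \<beta>) * f x)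
       in
         (\<forall>x. integrable lebesgue (dunkl_heat_integrand Rp k t f x)) \<and>
         Linf_norm F \<le> ennreal (C * N) \<and>
         (\<forall>w. 0 < w \<and> w \<le> \<beta> \<longrightarrow>
            Linf_norm (\<lambda>x. of_real (norm x powr w) * F x) \<le> ennreal (D * N)) \<and>
         (\<forall>i. (\<forall>x. has_dir_deriv (axis i 1) F x) \<and>
            Linf_norm (dir_deriv (axis i 1) F) \<le> ennreal (E * N)))"
proof -
  interpret dunkl R Rp k by unfold_locales (fact R Rp k)+
  define s where "s = 1 / (4 * t)"
  have s: "0 < s" "0 < s / 4" using t by (simp_all add: s_def)
  define \<kappa> where "\<kappa> = (2 * t) powr (- dunkl_dim Rp k / 2)"
  define c where "c = \<bar>inverse (dunkl_const Rp k)\<bar> * \<kappa>"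
  have c: "0 \<le> c" by (simp add: c_def \<kappa>_def)
  define A where "A = heat_const r r' \<beta>"
  define B where "B = 2 powr \<beta> * (1 / r + Lw s (\<lambda>y. 1) / r') + exp (4 * \<beta>\<^sup>2 / s) * A (s / 2)"
  define L where "L = 2 * sqrt s * exp (s / 2)"
  \<comment> \<open>The summand 1 makes the constants positive even if \<open>c\<close> should be
    0.\<close>
  define C where "C = c * A s + 1"
  define D where "D = c * (A s + B) + 1"
  define E where "E = c * (L * A (s / 4)) + 1"
  have "0 < 1 / r" "1 / r < 1" using r by simp_all
  then have "0 < 1 / r'" using r' by linarith
  then have r'0: "0 < r'" by simp
  have A0: "0 \<le> A u" for u unfolding A_def using r r'0 by (intro heat_const_nonneg) auto
  have B0: "0 \<le> B" unfolding B_def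
    using r r'0 A0 Lw_one_nonneg by (intro add_nonneg_nonneg mult_nonneg_nonneg divide_nonneg_pos) auto
  have L0: "0 \<le> L" using s by (simp add: L_def)
  have pos: "0 < C" "0 < D" "0 < E"
    unfolding C_def D_def E_def using c A0 B0 L0 by (auto intro!: add_nonneg_pos)
  have main: "(\<forall>x. integrable lebesgue (dunkl_heat_integrand Rp k t f x)) \<and>
      Linf_norm F \<le> ennreal (C * N) \<and>
      (\<forall>w. 0 < w \<and> w \<le> \<beta> \<longrightarrow> Linf_norm (\<lambda>x. of_real (norm x powr w) * F x) \<le> ennreal (D * N)) \<and>
      (\<forall>i. (\<forall>x. has_dir_deriv (axis i 1) F x) \<and> Linf_norm (dir_deriv (axis i 1) F) \<le> ennreal (E * N))"
    if f: "f \<in> Lp_space r (weighted_measure (\<lambda>x. norm x powr (\<beta> * r) * dunkl_weight Rp k x))"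
      and F: "F = dunkl_heat Rp k t f"
      and N: "N = Lp_norm r (weighted_measure (dunkl_weight Rp k)) (\<lambda>x. of_real (norm x powr \<beta>) * f x)"
    for f F N
  proof -
    interpret lp: dunkl_lp R Rp k r r' \<beta> f by unfold_locales (fact r r' beta f)+
    have N': "N = lp.N" by (simp add: N lp.N_def)
    have N0: "0 \<le> N" using lp.N_nonneg N' by simp
    have integrand: "dunkl_heat_integrand Rp k t f x = (\<lambda>y. \<kappa> *\<^sub>R (w y *\<^sub>R (hk s x y *\<^sub>R f y)))" for x
      using t by (simp add: fun_eq_iff dunkl_heat_integrand_def dunkl_heat_kernel_eq \<kappa>_def s_def scaleR_conv_of_real mult_ac)
    have hm: "(\<lambda>y. hk s x y *\<^sub>R f y) \<in> borel_measurable lebesgue" for x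
      by (intro borel_measurable_scaleR lp.hk_measurable_lebesgue lp.f_measurable)
    have int: "integrable lebesgue (dunkl_heat_integrand Rp k t f x)" for x
      unfolding integrand using lp.heat_integrable[OF s(1), of x] unfolding Mw_integrable[OF hm]
      by (rule integrable_scaleR_right)
    define z where "z = inverse (dunkl_const Rp k) * \<kappa>"
    have z: "\<bar>z\<bar> = c" by (simp add: z_def c_def abs_mult \<kappa>_def)
    have F_eq: "F = (\<lambda>x. z *\<^sub>R heat s f x)"
    proof
      fix x
      have "(LINT y|lebesgue. dunkl_heat_integrand Rp k t f x y) = \<kappa> *\<^sub>R heat s f x"
        unfolding integrand heat_def Mw_integral[OF hm] by (rule integral_scaleR_right)
      then show "F x = z *\<^sub>R heat s f x"
        by (simp add: F dunkl_heat_def z_def scaleR_conv_of_real)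
    qed
    have [measurable]: "heat s f \<in> borel_measurable lebesgue"
      using lp.heat_measurable[OF s(1)] by (simp add: measurable_completion)
    have Fm[measurable]: "F \<in> borel_measurable lebesgue" unfolding F_eq by measurable
    have F_bound: "norm (F x) \<le> c * (N * A s)" for x
      using mult_left_mono[OF lp.heat_bound[OF s(1), of x] c] z by (simp add: F_eq N' A_def)
    have "Linf_norm F \<le> ennreal (C * N)"
    proof (rule Linf_norm_le[OF Fm])
      show "norm (F x) \<le> C * N" for x
        using F_bound[of x] N0 by (simp add: C_def algebra_simps)
    qed
    moreover have "Linf_norm (\<lambda>x. of_real (norm x powr u) * F x) \<le> ennreal (D * N)" if u: "0 < u" "u \<le> \<beta>" for u
    proof (rule Linf_norm_le)
      show "(\<lambda>x. of_real (norm x powr u) * F x) \<in> borel_measurable lebesgue" by measurable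
      fix x :: "real ^ 'n"
      \<comment> \<open>Interpolation between the exponents 0 and \<open>\<beta>\<close>, so that a
        single constant \<open>D\<close> serves all exponents \<open>u\<close>.\<close>
      have "norm x powr u \<le> 1 + norm x powr \<beta>"
      proof (cases "norm x \<le> 1")
        case True
        then have "norm x powr u \<le> 1 powr u" using u by (intro powr_mono2) auto
        then show ?thesis by (simp add: add_increasing2)
      next
        case False
        then have "norm x powr u \<le> norm x powr \<beta>" using u by (intro powr_mono) auto
        then show ?thesis by simp
      qed
      then have "norm x powr u * norm (F x) \<le> (1 + norm x powr \<beta>) * norm (F x)"
        by (rule mult_right_mono) simp
      also have "\<dots> = norm (F x) + c * (norm x powr \<beta> * norm (heat s f x))"
        using z by (simp add: F_eq algebra_simps)
      also have "\<dots> \<le> c * (N * A s) + c * (N * B)"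
        using lp.heat_weight_bound[OF s(1), of x] unfolding N'[symmetric] A_def[symmetric] B_def[symmetric]
        by (intro add_mono F_bound mult_left_mono c)
      also have "\<dots> \<le> D * N" using N0 by (simp add: D_def algebra_simps)
      finally show "norm (of_real (norm x powr u) * F x) \<le> D * N" by (simp add: norm_mult)
    qed
    moreover have "has_dir_deriv (axis i 1) F x" "Linf_norm (dir_deriv (axis i 1) F) \<le> ennreal (E * N)" for i x
    proof -
      have e: "norm (axis i 1 :: real ^ 'n) = 1" by simp
      have vd: "((\<lambda>u. F (x + u *\<^sub>R axis i 1)) has_vector_derivative z *\<^sub>R dir_deriv (axis i 1) (heat s f) x) (at 0)" for x
        unfolding F_eq
        by (rule bounded_linear.has_vector_derivative[OF bounded_linear_scaleR_right lp.heat_dir_deriv(1)[OF s(1) e]])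
      show "has_dir_deriv (axis i 1) F x"
        unfolding has_dir_deriv_def using vd[of x] by (rule differentiableI_vector)
      have dd: "dir_deriv (axis i 1) F = (\<lambda>x. z *\<^sub>R dir_deriv (axis i 1) (heat s f) x)"
        unfolding dir_deriv_def[of "axis i 1" F] using vd by (intro ext vector_derivative_at)
      show "Linf_norm (dir_deriv (axis i 1) F) \<le> ennreal (E * N)"
      proof (rule Linf_norm_le)
        have [measurable]: "dir_deriv (axis i 1) (heat s f) \<in> borel_measurable lebesgue"
          using lp.heat_dir_deriv_measurable[OF s(1) e] by (simp add: measurable_completion)
        show "dir_deriv (axis i 1) F \<in> borel_measurable lebesgue" unfolding dd by measurable
        fix x
        have "norm (dir_deriv (axis i 1) F x) \<le> c * (L * (N * A (s / 4)))"
          using mult_left_mono[OF lp.heat_dir_deriv(3)[OF s(1) e, of x] c] z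
          by (simp add: dd N' A_def L_def lp.lip_def)
        also have "\<dots> \<le> E * N" using N0 by (simp add: E_def algebra_simps)
        finally show "norm (dir_deriv (axis i 1) F x) \<le> E * N" .
      qed
    qed
    ultimately show ?thesis using int by blast
  qed
  show ?thesis
    unfolding Let_def
    by (rule exI[of _ C], rule conjI[OF pos(1)], rule exI[of _ D], rule conjI[OF pos(2)],
      rule exI[of _ E], rule conjI[OF pos(3)], rule ballI, rule main[OF _ refl refl])
qed

end
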